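(* Let $V$ be a separable Banach space and $r\ge0$. Then $\tau_r\subset\hat\tau_r$ on $\mathcal S(V)$; that is, convergence of a sequence $(\mathbf X^n)$ to $\mathbf X$ in $(\mathcal S(V),\hat\tau_r)$ implies convergence of $(\mathbf X^n)$ to $\mathbf X$ in $(\mathcal S(V),\tau_r)$. Moreover, for processes evolving in a compact state space $K\subset V$ the converse holds, that is, $(\mathcal S(K),\tau_r)=(\mathcal S(K),\hat\tau_r)$.
   Context: $I=\{0,1,\dots,T\}$; $(I\to Y)=Y^I$ with the product topology. An adapted process $\mathbf X=(\Omega,(\mathcal F_t)_{t\in I},\mathbb P,(X_t)_{t\in I})$ with state space $U$ is a filtered probability space with $U$-valued random variables $X_t$ that are $\mathcal F_t$-measurable; different processes may live on different filtered probability spaces. $\mathcal S(U)$ is the collection of all such processes; $\mathbb E$ is the expectation on the respective space. **Adapted functionals.** $\mathrm{AF}$ is the smallest class of maps from $\mathcal S(U)$ to real random variables such that: (i) $\mathbf X\mapsto f(X_{t_1},\dots,X_{t_n})\in\mathrm{AF}$ for $t_i\in I$, $f\in C_b(U^n,\mathbb R)$; (ii) if $f_1,\dots,f_n\in\mathrm{AF}$, $f\in C_b(\mathbb R^n,\mathbb R)$, then $\mathbf X\mapsto f(f_1(\mathbf X),\dots,f_n(\mathbf X))\in \mathrm{AF}$; (iii) if $f\in\mathrm{AF}$, $t\in I$, then $\mathbf X\mapsto\mathbb E[f(\mathbf X)|\mathcal F_t]\in\mathrm{AF}$. The rank is $0$ in case (i), the maximum of the ranks of the $f_i$ in case (ii),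 increases by one in case (iii), and the rank of $f\in \mathrm{AF}$ is the minimum over all its constructions. $\mathrm{AF}_r=\{f\in\mathrm{AF}:\operatorname{rank}(f)\le r\}$. **Prediction processes.** $\mathcal P_0(U)=U$, $\mathcal P_r(U)=\mathrm{Prob}(I\to\mathcal P_{r-1}(U))$, the Borel probability measures with the weak topology. $\hat X^0=X$ and $\hat X^{r+1}_t=\mathbb P(\hat X^r\in\cdot\,|\mathcal F_t)$ (regular conditional distribution), $t\in I$. So $\hat X^r$ is a random element of $(I\to\mathcal P_r(U))$ and $\mathrm{Law}(\hat X^r)\in\mathcal P_{r+1}(U)$. **Topologies.** $\tau_r$ (adapted topology of rank $r$): coarsest topology on $\mathcal S(U)$ making $\mathbf X\mapsto\mathbb E[f(\mathbf X)]$ continuous for all $f\in\mathrm{AF}_r$; so $\mathbf X^n\to\mathbf X$ iff $\mathbb E[f(\mathbf X^n)]\to\mathbb E[f(\mathbf X)]$ for all $f\in\mathrm{AF}_r$. $\hat\tau_r$ (extended weak topology of rank $r$): coarsest topology making $\mathbf X\mapsto \mathrm{Law}(\hat X^r)\in\mathcal P_{r+1}(U)$ continuous; so $\mathbf X^n\to\mathbf X$ iff $\hat X^{n,r}\to\hat X^r$ in law as random elements of $(I\to\mathcal P_r(U))$. *)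

theory Defs
  imports "HOL-Probability.Probability"
begin

section \<open>Borel measures and the weak topology\<close>

definition borel_of :: "'a topology \<Rightarrow> 'a measure" where
  "borel_of X = sigma (topspace X) {U. openin X U}"

definition bounded_continuous :: "'a topology \<Rightarrow> ('a \<Rightarrow> real) set" where
  "bounded_continuous X = {f. continuous_map X euclideanreal f \<and> bounded (f ` topspace X)}"

text \<open>The coarsest topology on \<open>S\<close> making every function in \<open>F\<close> continuous.
  Inserting \<open>S\<close> itself only serves to make \<open>S\<close> the underlying set when \<open>F\<close> is empty.\<close>

definition initial_topology :: "'a set \<Rightarrow> ('a \<Rightarrow> real) set \<Rightarrow> 'a topology" where
  "initial_topology S F =
     topology_generated_by (insert S {\<phi> -` V \<inter> S | \<phi> V. \<phi> \<in> F \<and> open V})"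

definition borel_probs :: "'a topology \<Rightarrow> 'a measure set" where
  "borel_probs X = space (prob_algebra (borel_of X))"

definition weak_topology :: "'a topology \<Rightarrow> 'a measure topology" where
  "weak_topology X =
     initial_topology (borel_probs X) ((\<lambda>f \<mu>. integral\<^sup>L \<mu> f) ` bounded_continuous X)"


section \<open>Adapted processes\<close>

text \<open>The time set is \<open>{..T}\<close>; the components at times beyond \<open>T\<close> are never used.
  The filtration consists of measures only because the library represents a
  sigma-algebra by a measure; only their \<open>space\<close> and \<open>sets\<close> matter. Since \<open>pspace\<close> is an
  arbitrary measure with \<open>space pspace\<close> a subset of \<open>'w\<close>, different processes may live on
  different filtered probability spaces.\<close>

record ('w, 'u) adapted_process =
  pspace :: "'w measure"
  filt :: "nat \<Rightarrow> 'w measure"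
  proc :: "nat \<Rightarrow> 'w \<Rightarrow> 'u"

definition adapted_processes :: "nat \<Rightarrow> 'u topology \<Rightarrow> ('w, 'u) adapted_process set" where
  "adapted_processes T U =
     {X. prob_space (pspace X) \<and>
         (\<forall>t\<le>T. subalgebra (pspace X) (filt X t)) \<and>
         (\<forall>t\<le>T. \<forall>s\<le>t. sets (filt X s) \<subseteq> sets (filt X t)) \<and>
         (\<forall>t\<le>T. proc X t \<in> measurable (filt X t) (borel_of U))}"


section \<open>Adapted functionals and the adapted topologies\<close>

type_synonym ('w, 'u) functional = "('w, 'u) adapted_process \<Rightarrow> 'w \<Rightarrow> real"

text \<open>\<open>af_construction T U \<phi> k\<close>: the functional \<open>\<phi>\<close> has a construction of rank \<open>k\<close>.
  Elements of an \<open>n\<close>-fold product are extensional functions on \<open>{..<n}\<close>.\<close>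

inductive af_construction :: "nat \<Rightarrow> 'u topology \<Rightarrow> ('w, 'u) functional \<Rightarrow> nat \<Rightarrow> bool"
  for T :: nat and U :: "'u topology" where
  base: "\<lbrakk>0 < (n::nat); \<forall>i<n. ts i \<le> T; f \<in> bounded_continuous (product_topology (\<lambda>_. U) {..<n})\<rbrakk>
    \<Longrightarrow> af_construction T U (\<lambda>X \<omega>. f (\<lambda>i\<in>{..<n}. proc X (ts i) \<omega>)) 0"
| comp: "\<lbrakk>0 < (n::nat); \<forall>i<n. af_construction T U (\<phi>s i) (ks i);
      f \<in> bounded_continuous (product_topology (\<lambda>_. euclideanreal) {..<n})\<rbrakk>
    \<Longrightarrow> af_construction T U (\<lambda>X \<omega>. f (\<lambda>i\<in>{..<n}. \<phi>s i X \<omega>)) (Max (ks ` {..<n}))"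
| cond: "\<lbrakk>af_construction T U \<phi> k; t \<le> T\<rbrakk>
    \<Longrightarrow> af_construction T U (\<lambda>X. real_cond_exp (pspace X) (filt X t) (\<phi> X)) (Suc k)"

definition AF :: "nat \<Rightarrow> 'u topology \<Rightarrow> ('w, 'u) functional set" where
  "AF T U = {\<phi>. \<exists>k. af_construction T U \<phi> k}"

definition af_rank :: "nat \<Rightarrow> 'u topology \<Rightarrow> ('w, 'u) functional \<Rightarrow> nat" where
  "af_rank T U \<phi> = (LEAST k. af_construction T U \<phi> k)"

definition AF_upto :: "nat \<Rightarrow> 'u topology \<Rightarrow> nat \<Rightarrow> ('w, 'u) functional set" where
  "AF_upto T U r = {\<phi> \<in> AF T U. af_rank T U \<phi> \<le> r}"

definition adapted_topology ::
    "nat \<Rightarrow> 'u topology \<Rightarrow> nat \<Rightarrow> ('w, 'u) adapted_process topology" where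
  "adapted_topology T U r =
     initial_topology (adapted_processes T U)
       ((\<lambda>\<phi> X. integral\<^sup>L (pspace X) (\<phi> X)) ` AF_upto T U r)"


section \<open>Prediction processes and the extended weak topologies\<close>

text \<open>The spaces \<open>P\<^sub>0(U) = U\<close>, \<open>P\<^sub>r\<^sub>+\<^sub>1(U) = Prob(I \<rightarrow> P\<^sub>r(U))\<close> would be types depending on the
  number \<open>r\<close>. To have them all inside one type, the points of \<open>U\<close> are tagged with \<open>Point\<close>, and
  a measure in \<open>Prob(I \<rightarrow> P\<^sub>r(U))\<close> is renamed to a real sequence by a chosen injection
  \<open>law_code\<close>, the topology being transported along this renaming. For separable metrizable \<open>U\<close>
  such an injection exists: all \<open>I \<rightarrow> P\<^sub>r(U)\<close> are then separable metrizable, and a Borel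
  probability measure on such a space is determined by its values on the finite
  intersections of a countable base.\<close>

datatype 'u pred_point = Point 'u | Law "nat \<Rightarrow> real"

definition law_code :: "'a topology \<Rightarrow> 'a measure \<Rightarrow> (nat \<Rightarrow> real)" where
  "law_code X = (SOME c. inj_on c (borel_probs X))"

definition transport_topology :: "('a \<Rightarrow> 'b) \<Rightarrow> 'a topology \<Rightarrow> 'b topology" where
  "transport_topology e X = pullback_topology (e ` topspace X) (inv_into (topspace X) e) X"

definition path_topology :: "nat \<Rightarrow> 'a topology \<Rightarrow> (nat \<Rightarrow> 'a) topology" where
  "path_topology T Y = product_topology (\<lambda>_. Y) {..T}"

primrec pred_space :: "nat \<Rightarrow> 'u topology \<Rightarrow> nat \<Rightarrow> 'u pred_point topology" where
  "pred_space T U 0 = transport_topology Point U"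
| "pred_space T U (Suc r) =
     transport_topology (\<lambda>\<mu>. Law (law_code (path_topology T (pred_space T U r)) \<mu>))
       (weak_topology (path_topology T (pred_space T U r)))"

definition regular_cond_distr ::
    "'w measure \<Rightarrow> 'w measure \<Rightarrow> 'a measure \<Rightarrow> ('w \<Rightarrow> 'a) \<Rightarrow> ('w \<Rightarrow> 'a measure) \<Rightarrow> bool" where
  "regular_cond_distr M F S Y \<kappa> \<longleftrightarrow>
     \<kappa> \<in> measurable F (prob_algebra S) \<and>
     (\<forall>A\<in>sets S. AE \<omega> in M.
        measure (\<kappa> \<omega>) A = real_cond_exp M F (indicat_real (Y -` A \<inter> space M)) \<omega>)"

text \<open>Some version of the regular conditional distribution is picked at each step; any two
  versions agree almost surely, so the law of the prediction process does not depend on the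
  choice.\<close>

primrec pred_process ::
    "nat \<Rightarrow> 'u topology \<Rightarrow> ('w, 'u) adapted_process \<Rightarrow> nat \<Rightarrow> nat \<Rightarrow> 'w \<Rightarrow> 'u pred_point" where
  "pred_process T U X 0 = (\<lambda>t \<omega>. Point (proc X t \<omega>))"
| "pred_process T U X (Suc r) = (\<lambda>t \<omega>.
     Law (law_code (path_topology T (pred_space T U r))
       ((SOME \<kappa>. regular_cond_distr (pspace X) (filt X t)
            (borel_of (path_topology T (pred_space T U r)))
            (\<lambda>\<omega>'. \<lambda>s\<in>{..T}. pred_process T U X r s \<omega>') \<kappa>) \<omega>)))"

definition pred_law ::
    "nat \<Rightarrow> 'u topology \<Rightarrow> nat \<Rightarrow> ('w, 'u) adapted_process \<Rightarrow> (nat \<Rightarrow> 'u pred_point) measure" where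
  "pred_law T U r X =
     distr (pspace X) (borel_of (path_topology T (pred_space T U r)))
       (\<lambda>\<omega>. \<lambda>t\<in>{..T}. pred_process T U X r t \<omega>)"

text \<open>Here the weak topology on \<open>Prob(I \<rightarrow> P\<^sub>r(U))\<close> is used directly, without renaming.\<close>

definition extended_weak_topology ::
    "nat \<Rightarrow> 'u topology \<Rightarrow> nat \<Rightarrow> ('w, 'u) adapted_process topology" where
  "extended_weak_topology T U r =
     pullback_topology (adapted_processes T U) (pred_law T U r)
       (weak_topology (path_topology T (pred_space T U r)))"

end

theory Submission
  imports Defs
begin

text \<open>
  The argument treats uniformly all state spaces \<open>U\<close> that are completely regular, second countable and
  whose Borel sigma-algebra is a measurable retract of the real line. This class contains the separable
  Banach spaces and their nonempty closed subsets.

  Write \<open>X\<^sup>r\<close> for the prediction process of rank \<open>r\<close>. For bounded continuous \<open>f\<close>,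
  \<open>E[f(X\<^sup>r) | F\<^sub>t]\<close> is the integral of \<open>f\<close> against the value of the next prediction process at
  time \<open>t\<close>, a continuous function of the latter, and for \<open>t = T\<close> it is \<open>f(X\<^sup>r)\<close> itself. So every adapted
  functional of rank at most \<open>r\<close> is almost surely a bounded continuous function of \<open>X\<^sup>r\<close>, the
  same function for all processes.

  Conversely, the continuous functions of \<open>X\<^sup>r\<close> that arise in this way are closed under continuous
  operations and generate the topology of the path space. By a portmanteau argument the integrals of
  such a family generate the weak topology of the laws, which then gives the claim for the
  path space of rank \<open>r + 1\<close>.

  Regular conditional distributions are constructed on the real line from conditional distribution
  functions and transferred along retracts; being a retract of the real line is inherited by path
  spaces and by spaces of probability measures.
\<close>

section \<open>Initial topologies and Borel sets\<close>

text \<open>No metric on a space of measures is ever constructed. The three properties required of a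
  state space are chosen because they pass to laws of paths directly: every initial topology of real
  functions is completely regular, a countable family of test functions gives second countability,
  and measurable retracts compose. The obstacle in the converse is that the weak topology tests
  against all bounded continuous functions, while adapted functionals supply only a family closed
  under bounded continuous operations. What survives is a one-sided approximation: the indicator of
  an open set is a pointwise limit from below of members of the family, so their integrals bound its
  mass from below at all nearby laws. Lower semicontinuity of the integrals of \<open>f\<close> and
  of \<open>- f\<close> then gives continuity. That the family is rich enough at rank
  \<open>r + 1\<close> rests on the same claim at rank \<open>r\<close>, because the path space of
  rank \<open>r + 1\<close> carries copies of the weak topology of rank \<open>r\<close>.\<close>

lemma topspace_initial_topology [simp]: "topspace (initial_topology S F) = S"
  by (auto simp: initial_topology_def)

lemma continuous_map_initial_topology:
  assumes "\<phi> \<in> F"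
  shows "continuous_map (initial_topology S F) euclideanreal \<phi>"
  unfolding continuous_map_def
proof (intro conjI allI impI)
  fix V :: "real set" assume "openin euclideanreal V"
  then have "\<phi> -` V \<inter> S \<in> insert S {\<phi> -` V \<inter> S |\<phi> V. \<phi> \<in> F \<and> open V}"
    using assms by auto
  then have "openin (initial_topology S F) (\<phi> -` V \<inter> S)"
    unfolding initial_topology_def by (rule topology_generated_by_Basis)
  moreover have "{x \<in> S. \<phi> x \<in> V} = \<phi> -` V \<inter> S"
    by auto
  ultimately show "openin (initial_topology S F) {x \<in> topspace (initial_topology S F). \<phi> x \<in> V}"
    by simp
qed auto

lemma continuous_map_into_initial_topology:
  assumes "m ` topspace Y \<subseteq> S"
    and "\<And>\<phi>. \<phi> \<in> F \<Longrightarrow> continuous_map Y euclideanreal (\<lambda>y. \<phi> (m y))"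
  shows "continuous_map Y (initial_topology S F) m"
  unfolding initial_topology_def
proof (rule continuous_on_generated_topo)
  fix U assume "U \<in> insert S {\<phi> -` V \<inter> S |\<phi> V. \<phi> \<in> F \<and> open V}"
  then consider "U = S" | \<phi> V where "\<phi> \<in> F" "open V" "U = \<phi> -` V \<inter> S"
    by auto
  then show "openin Y (m -` U \<inter> topspace Y)"
  proof cases
    case 1
    then have "m -` U \<inter> topspace Y = topspace Y"
      using assms(1) by auto
    then show ?thesis
      by simp
  next
    case 2
    then have "m -` U \<inter> topspace Y = {y \<in> topspace Y. \<phi> (m y) \<in> V}"
      using assms(1) by auto
    then show ?thesis
      using openin_continuous_map_preimage[OF assms(2)[OF 2(1)], of V] 2(2) by simp
  qed
qed (use assms(1) in auto)

lemma openin_initial_topology_mono: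
  assumes "\<And>\<phi>. \<phi> \<in> F \<Longrightarrow> continuous_map Y euclideanreal \<phi>" and "topspace Y = S"
    and "openin (initial_topology S F) W"
  shows "openin Y W"
proof -
  have "continuous_map Y (initial_topology S F) (\<lambda>x. x)"
    using assms by (intro continuous_map_into_initial_topology) auto
  from openin_continuous_map_preimage[OF this assms(3)] have "openin Y {x \<in> topspace Y. x \<in> W}" .
  moreover have "{x \<in> topspace Y. x \<in> W} = W"
    using openin_subset[OF assms(3)] assms(2) by auto
  ultimately show ?thesis
    by simp
qed

lemma initial_topology_eqI:
  assumes "\<And>\<phi>. \<phi> \<in> F \<Longrightarrow> continuous_map (initial_topology S F') euclideanreal \<phi>"
    and "\<And>\<phi>. \<phi> \<in> F' \<Longrightarrow> continuous_map (initial_topology S F) euclideanreal \<phi>"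
  shows "initial_topology S F = initial_topology S F'"
  unfolding topology_eq
  using openin_initial_topology_mono[of F "initial_topology S F'" S]
    openin_initial_topology_mono[of F' "initial_topology S F" S] assms by auto

section \<open>Second countability\<close>

text \<open>The Lindelof argument: each basic set that lies inside some member of the family selects
  one such member. It turns arbitrary unions of open sets into countable ones, which a sigma-algebra
  can handle.\<close>

lemma second_countable_subcover:
  assumes "second_countable X" and "\<And>U. U \<in> \<U> \<Longrightarrow> openin X U"
  obtains \<V> where "countable \<V>" "\<V> \<subseteq> \<U>" "\<Union>\<V> = \<Union>\<U>"
proof -
  obtain \<B> where \<B>: "countable \<B>" "\<And>U x. openin X U \<Longrightarrow> x \<in> U \<Longrightarrow> \<exists>V\<in>\<B>. x \<in> V \<and> V \<subseteq> U"
    using assms(1) unfolding second_countable_def by metis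
  define \<B>' where "\<B>' = {B\<in>\<B>. \<exists>U\<in>\<U>. B \<subseteq> U}"
  have "\<forall>B\<in>\<B>'. \<exists>U. U \<in> \<U> \<and> B \<subseteq> U"
    by (auto simp: \<B>'_def)
  then obtain c where c: "\<And>B. B \<in> \<B>' \<Longrightarrow> c B \<in> \<U> \<and> B \<subseteq> c B"
    by metis
  show thesis
  proof
    show "countable (c ` \<B>')"
      using \<B>(1) unfolding \<B>'_def by auto
    show "c ` \<B>' \<subseteq> \<U>"
      using c by auto
    show "\<Union>(c ` \<B>') = \<Union>\<U>"
    proof
      show "\<Union>\<U> \<subseteq> \<Union>(c ` \<B>')"
      proof
        fix x assume "x \<in> \<Union>\<U>"
        then obtain U where U: "U \<in> \<U>" "x \<in> U"
          by auto
        then obtain B where "B \<in> \<B>" "x \<in> B" "B \<subseteq> U"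
          using \<B>(2) assms(2) by blast
        then have "B \<in> \<B>'"
          using U by (auto simp: \<B>'_def)
        then show "x \<in> \<Union>(c ` \<B>')"
          using c \<open>x \<in> B\<close> by auto
      qed
    qed (use c in auto)
  qed
qed

lemma second_countable_generated:
  assumes "countable \<S>"
  shows "second_countable (topology_generated_by \<S>)"
  unfolding second_countable_def
proof (intro exI conjI ballI allI impI)
  show "countable (Inter ` {\<F>. finite \<F> \<and> \<F> \<subseteq> \<S> \<and> \<F> \<noteq> {}})"
    using countable_Collect_finite_subset[OF assms]
    by (intro countable_image) (rule countable_subset[rotated], assumption, auto)
next
  fix V assume "V \<in> Inter ` {\<F>. finite \<F> \<and> \<F> \<subseteq> \<S> \<and> \<F> \<noteq> {}}"
  then obtain \<F> where F: "finite \<F>" "\<F> \<subseteq> \<S>" "\<F> \<noteq> {}" "V = \<Inter>\<F>"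
    by auto
  show "openin (topology_generated_by \<S>) V"
    unfolding F(4) using F by (intro openin_Inter) (auto intro: topology_generated_by_Basis)
next
  fix U x assume "openin (topology_generated_by \<S>) U \<and> x \<in> U"
  then have "(arbitrary union_of finite' intersection_of (\<lambda>x. x \<in> \<S>)) U" "x \<in> U"
    unfolding openin_topology_generated_by_iff by (simp_all add: generate_topology_on_eq)
  then obtain \<U> where U: "\<U> \<subseteq> Collect (finite' intersection_of (\<lambda>x. x \<in> \<S>))" "\<Union>\<U> = U" "x \<in> U"
    unfolding union_of_def by auto
  then obtain V where V: "V \<in> \<U>" "x \<in> V"
    by auto
  then have "(finite' intersection_of (\<lambda>x. x \<in> \<S>)) V"
    using U(1) by auto
  then obtain \<F> where "finite \<F>" "\<F> \<noteq> {}" "\<F> \<subseteq> \<S>" "\<Inter>\<F> = V"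
    unfolding intersection_of_def by auto
  moreover have "V \<subseteq> U"
    using U V by auto
  ultimately have "finite \<F> \<and> \<F> \<noteq> {} \<and> \<F> \<subseteq> \<S> \<and> x \<in> \<Inter>\<F> \<and> \<Inter>\<F> \<subseteq> U"
    using V(2) by simp
  then show "\<exists>V\<in>Inter ` {\<F>. finite \<F> \<and> \<F> \<subseteq> \<S> \<and> \<F> \<noteq> {}}. x \<in> V \<and> V \<subseteq> U"
    by blast
qed

lemma second_countable_initial_topology:
  assumes "countable F"
  shows "second_countable (initial_topology S F)"
proof -
  obtain \<B> :: "real set set" where \<B>: "countable \<B>" "\<And>C. C \<in> \<B> \<Longrightarrow> open C"
     "\<And>V. open V \<Longrightarrow> \<exists>U. U \<subseteq> \<B> \<and> V = \<Union>U"
    by (metis univ_second_countable)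
  define \<S> where "\<S> = insert S {\<phi> -` V \<inter> S |\<phi> V. \<phi> \<in> F \<and> V \<in> \<B>}"
  have "\<S> = insert S ((\<lambda>(\<phi>, V). \<phi> -` V \<inter> S) ` (F \<times> \<B>))"
    unfolding \<S>_def by auto
  then have "countable \<S>"
    using assms \<B>(1) by simp
  moreover have "topology_generated_by \<S> = initial_topology S F"
    unfolding topology_eq
  proof (intro allI iffI)
    fix W assume "openin (topology_generated_by \<S>) W"
    then show "openin (initial_topology S F) W"
      unfolding initial_topology_def openin_topology_generated_by_iff
    proof induction
      case (Basis s)
      then show ?case
        unfolding \<S>_def using \<B>(2) by (intro generate_topology_on.Basis) auto
    qed (auto intro: generate_topology_on.intros)
  next
    fix W assume "openin (initial_topology S F) W"
    then show "openin (topology_generated_by \<S>) W"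
      unfolding initial_topology_def openin_topology_generated_by_iff
    proof induction
      case (Basis s)
      then consider "s = S" | \<phi> V where "\<phi> \<in> F" "open V" "s = \<phi> -` V \<inter> S"
        by auto
      then show ?case
      proof cases
        case 1
        then show ?thesis
          by (intro generate_topology_on.Basis) (auto simp: \<S>_def)
      next
        case 2
        then obtain \<U> where U: "\<U> \<subseteq> \<B>" "V = \<Union>\<U>"
          using \<B>(3) by blast
        have "generate_topology_on \<S> (\<Union>((\<lambda>B. \<phi> -` B \<inter> S) ` \<U>))"
          using U(1) 2(1) by (intro generate_topology_on.UN) (auto simp: \<S>_def intro!: generate_topology_on.Basis)
        moreover have "\<Union>((\<lambda>B. \<phi> -` B \<inter> S) ` \<U>) = s"
          using U(2) 2(3) by auto
        ultimately show ?thesis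
          by simp
      qed
    qed (auto intro: generate_topology_on.intros)
  qed
  ultimately show ?thesis
    using second_countable_generated by metis
qed

section \<open>Borel sigma-algebras and measurability into them\<close>

lemma space_borel_of [simp]: "space (borel_of X) = topspace X"
  unfolding borel_of_def by (rule space_measure_of) (auto dest: openin_subset)

lemma sets_borel_of: "sets (borel_of X) = sigma_sets (topspace X) {U. openin X U}"
  unfolding borel_of_def by (rule sets_measure_of) (auto dest: openin_subset)

lemma openin_sets_borel_of: "openin X U \<Longrightarrow> U \<in> sets (borel_of X)"
  by (auto simp: sets_borel_of)

lemma borel_of_euclidean: "borel_of euclidean = borel"
  by (simp add: borel_of_def borel_def)

lemma measurable_into_borel_of:
  assumes "m \<in> space M \<rightarrow> topspace X" and "\<And>U. openin X U \<Longrightarrow> m -` U \<inter> space M \<in> sets M"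
  shows "m \<in> M \<rightarrow>\<^sub>M borel_of X"
  unfolding borel_of_def
  using assms by (intro measurable_measure_of) (auto dest: openin_subset)

lemma continuous_map_measurable_borel_of:
  assumes "continuous_map X Y f"
  shows "f \<in> borel_of X \<rightarrow>\<^sub>M borel_of Y"
proof (rule measurable_into_borel_of)
  fix U assume "openin Y U"
  moreover have "{x \<in> topspace X. f x \<in> U} = f -` U \<inter> topspace X"
    by auto
  ultimately show "f -` U \<inter> space (borel_of X) \<in> sets (borel_of X)"
    using openin_continuous_map_preimage[OF assms] openin_sets_borel_of by (metis space_borel_of)
qed (use assms in \<open>auto simp: continuous_map_def\<close>)

lemma continuous_map_borel_measurable:
  "continuous_map X euclideanreal f \<Longrightarrow> f \<in> borel_measurable (borel_of X)"
  using continuous_map_measurable_borel_of[of X euclideanreal f] by (simp add: borel_of_euclidean)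

text \<open>A subbase generates the topology using arbitrary unions, but the Borel sigma-algebra
  offers only countable ones. Second countability closes this gap in the union case of the
  induction.\<close>

lemma measurable_into_borel_of_generated:
  assumes X: "X = topology_generated_by \<S>" and sc: "second_countable X"
    and m: "m \<in> space M \<rightarrow> topspace X" and ms: "\<And>U. U \<in> \<S> \<Longrightarrow> m -` U \<inter> space M \<in> sets M"
  shows "m \<in> M \<rightarrow>\<^sub>M borel_of X"
proof (rule measurable_into_borel_of[OF m])
  fix U assume "openin X U"
  then have "generate_topology_on \<S> U"
    by (simp add: X openin_topology_generated_by_iff)
  then show "m -` U \<inter> space M \<in> sets M"
  proof induction
    case (Int a b)
    moreover have "m -` (a \<inter> b) \<inter> space M = (m -` a \<inter> space M) \<inter> (m -` b \<inter> space M)"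
      by auto
    ultimately show ?case
      by auto
  next
    case (UN K)
    have "\<And>k. k \<in> K \<Longrightarrow> openin X k"
      using UN(1) by (simp add: X openin_topology_generated_by_iff)
    then obtain K' where K': "countable K'" "K' \<subseteq> K" "\<Union>K' = \<Union>K"
      using second_countable_subcover[OF sc] by metis
    have "m -` \<Union>K \<inter> space M = (\<Union>k\<in>K'. m -` k \<inter> space M)"
      unfolding K'(3)[symmetric] by auto
    also have "\<dots> \<in> sets M"
      using K' UN(2) by (intro sets.countable_UN') auto
    finally show ?case .
  qed (use ms in auto)
qed

lemma measurable_into_borel_of_initial_topology:
  assumes "second_countable (initial_topology S F)" and "m \<in> space M \<rightarrow> S"
    and "\<And>\<phi>. \<phi> \<in> F \<Longrightarrow> (\<lambda>x. \<phi> (m x)) \<in> borel_measurable M"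
  shows "m \<in> M \<rightarrow>\<^sub>M borel_of (initial_topology S F)"
proof (rule measurable_into_borel_of_generated[OF _ assms(1)])
  show "initial_topology S F = topology_generated_by (insert S {\<phi> -` V \<inter> S |\<phi> V. \<phi> \<in> F \<and> open V})"
    by (simp add: initial_topology_def)
  fix U assume "U \<in> insert S {\<phi> -` V \<inter> S |\<phi> V. \<phi> \<in> F \<and> open V}"
  then consider "U = S" | \<phi> V where "\<phi> \<in> F" "open V" "U = \<phi> -` V \<inter> S"
    by auto
  then show "m -` U \<inter> space M \<in> sets M"
  proof cases
    case 1
    then have "m -` U \<inter> space M = space M"
      using assms(2) by auto
    then show ?thesis
      by simp
  next
    case 2
    then have "m -` U \<inter> space M = (\<lambda>x. \<phi> (m x)) -` V \<inter> space M"
      using assms(2) by auto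
    then show ?thesis
      using assms(3)[OF 2(1)] 2(2) by (simp add: measurable_sets)
  qed
qed (use assms(2) in simp)

lemma second_countable_path_topology:
  assumes "second_countable Y"
  shows "second_countable (path_topology T Y)"
proof -
  obtain \<B> where \<B>: "countable \<B>" "\<And>V. V \<in> \<B> \<Longrightarrow> openin Y V"
    "\<And>U x. openin Y U \<Longrightarrow> x \<in> U \<Longrightarrow> \<exists>V\<in>\<B>. x \<in> V \<and> V \<subseteq> U"
    using assms unfolding second_countable_def by metis
  show ?thesis
    unfolding second_countable_def path_topology_def
  proof (intro exI conjI ballI allI impI)
    show "countable ((\<lambda>V. Pi\<^sub>E {..T} V) ` (\<Pi>\<^sub>E i\<in>{..T}. \<B>))"
      using \<B>(1) by (intro countable_image countable_PiE) auto
  next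
    fix W assume "W \<in> (\<lambda>V. Pi\<^sub>E {..T} V) ` (\<Pi>\<^sub>E i\<in>{..T}. \<B>)"
    then show "openin (product_topology (\<lambda>_. Y) {..T}) W"
      using \<B>(2) by (auto simp: openin_PiE_gen PiE_iff)
  next
    fix U x assume "openin (product_topology (\<lambda>_. Y) {..T}) U \<and> x \<in> U"
    then obtain V where V: "\<And>i. i \<le> T \<Longrightarrow> openin Y (V i)" "x \<in> Pi\<^sub>E {..T} V" "Pi\<^sub>E {..T} V \<subseteq> U"
      unfolding openin_product_topology_alt by (metis atMost_iff)
    have "\<exists>B\<in>\<B>. x i \<in> B \<and> B \<subseteq> V i" if "i \<le> T" for i
      using V(1)[OF that] V(2) that \<B>(3) by (auto simp: PiE_iff)
    then obtain B where B: "\<And>i. i \<le> T \<Longrightarrow> B i \<in> \<B> \<and> x i \<in> B i \<and> B i \<subseteq> V i"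
      by metis
    let ?B = "\<lambda>i\<in>{..T}. B i"
    have "Pi\<^sub>E {..T} ?B \<subseteq> Pi\<^sub>E {..T} V"
      using B by (intro PiE_mono) auto
    then have "Pi\<^sub>E {..T} ?B \<subseteq> U"
      using V(3) by (rule order_trans)
    moreover have "x \<in> Pi\<^sub>E {..T} ?B"
      using V(2) B by (auto simp: PiE_iff)
    moreover have "?B \<in> (\<Pi>\<^sub>E i\<in>{..T}. \<B>)"
      using B by auto
    ultimately show "\<exists>W\<in>(\<lambda>V. Pi\<^sub>E {..T} V) ` (\<Pi>\<^sub>E i\<in>{..T}. \<B>). x \<in> W \<and> W \<subseteq> U"
      by blast
  qed
qed

text \<open>The Borel sets of the path space are no finer than the product sigma-algebra: boxes
  suffice as test sets, and their preimages are finite intersections over the time set.\<close>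

lemma measurable_into_path_topology:
  assumes sc: "second_countable Y" and m: "\<And>i. i \<le> T \<Longrightarrow> (\<lambda>x. m x i) \<in> M \<rightarrow>\<^sub>M borel_of Y"
    and ext: "\<And>x. x \<in> space M \<Longrightarrow> m x \<in> extensional {..T}"
  shows "m \<in> M \<rightarrow>\<^sub>M borel_of (path_topology T Y)"
proof (rule measurable_into_borel_of_generated[OF _ second_countable_path_topology[OF sc]])
  show "path_topology T Y = topology_generated_by
     {(\<Pi>\<^sub>E i\<in>{..T}. X i) |X. (\<forall>i. openin Y (X i)) \<and> finite {i. X i \<noteq> topspace Y}}"
    by (simp add: path_topology_def product_topology_def)
  show "m \<in> space M \<rightarrow> topspace (path_topology T Y)"
    using measurable_space[OF m] ext by (auto simp: path_topology_def PiE_iff)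
  fix U assume "U \<in> {(\<Pi>\<^sub>E i\<in>{..T}. X i) |X. (\<forall>i. openin Y (X i)) \<and> finite {i. X i \<noteq> topspace Y}}"
  then obtain V where V: "U = Pi\<^sub>E {..T} V" "\<And>i. openin Y (V i)"
    by auto
  have "m -` U \<inter> space M = (\<Inter>i\<le>T. (\<lambda>x. m x i) -` V i \<inter> space M)"
    using ext by (auto simp: V(1) PiE_iff)
  also have "\<dots> \<in> sets M"
  proof (rule sets.finite_INT)
    fix i assume "i \<in> {..T}"
    then have "(\<lambda>x. m x i) \<in> M \<rightarrow>\<^sub>M borel_of Y"
      by (intro m) simp
    then show "(\<lambda>x. m x i) -` V i \<inter> space M \<in> sets M"
      using openin_sets_borel_of[OF V(2)] by (rule measurable_sets)
  qed auto
  finally show "m -` U \<inter> space M \<in> sets M" .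
qed

lemma continuous_map_path_coordinate:
  "i \<le> T \<Longrightarrow> continuous_map (path_topology T Y) Y (\<lambda>x. x i)"
  unfolding path_topology_def by (rule continuous_map_product_projection) simp

section \<open>Measurable retracts of the real line\<close>

text \<open>This says that \<open>M\<close> is a nonempty standard Borel space: \<open>f\<close>
  identifies it with the Borel set of all \<open>y\<close> such that \<open>f (g y) = y\<close>.
  Asking for a total \<open>g\<close> avoids carrying that subset along and makes constructions
  compose.\<close>

definition real_retract :: "'a measure \<Rightarrow> bool" where
  "real_retract M \<longleftrightarrow>
     (\<exists>f\<in>borel_measurable M. \<exists>g\<in>borel \<rightarrow>\<^sub>M M. \<forall>x\<in>space M. g (f x :: real) = x)"

lemma real_retract_trans:
  assumes "real_retract N" and [measurable]: "f \<in> M \<rightarrow>\<^sub>M N" "g \<in> N \<rightarrow>\<^sub>M M"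
    and "\<And>x. x \<in> space M \<Longrightarrow> g (f x) = x"
  shows "real_retract M"
proof -
  obtain f' :: "_ \<Rightarrow> real" and g' where [measurable]: "f' \<in> borel_measurable N" "g' \<in> borel \<rightarrow>\<^sub>M N"
    and inv: "\<And>x. x \<in> space N \<Longrightarrow> g' (f' x) = x"
    using assms(1) unfolding real_retract_def by auto
  have "(\<lambda>x. f' (f x)) \<in> borel_measurable M" "(\<lambda>x. g (g' x)) \<in> borel \<rightarrow>\<^sub>M M"
    by measurable
  moreover have "\<forall>x\<in>space M. g (g' (f' (f x))) = x"
    using inv measurable_space[OF assms(2)] assms(4) by simp
  ultimately show ?thesis
    unfolding real_retract_def by (intro bexI)
qed

text \<open>Bits are written as digits 0 and 1 in base 4. The part behind any digit is then at most
  1/3, so the floor reads the digits off without the ambiguity of binary expansions.\<close>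

lemma real_retract_bits: "real_retract (\<Pi>\<^sub>M n\<in>(UNIV::nat set). count_space (UNIV::bool set))"
proof -
  let ?B = "\<Pi>\<^sub>M n\<in>(UNIV::nat set). count_space (UNIV::bool set)"
  define f where "f b = (\<Sum>n. of_bool (b n) * (1/4::real) ^ n)" for b :: "nat \<Rightarrow> bool"
  define g where "g x = (\<lambda>n::nat. odd \<lfloor>4 ^ n * x\<rfloor>)" for x :: real
  have "(\<lambda>b. b n) \<in> ?B \<rightarrow>\<^sub>M count_space UNIV" for n
    by (rule measurable_component_singleton) simp
  then have "(\<lambda>b. of_bool (b n) * (1/4::real) ^ n) \<in> borel_measurable ?B" for n
    by (rule measurable_compose[where g="\<lambda>x. of_bool x * (1/4::real) ^ n"]) simp
  then have "f \<in> borel_measurable ?B"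
    unfolding f_def by (rule borel_measurable_suminf)
  moreover have "g \<in> borel \<rightarrow>\<^sub>M ?B"
    unfolding g_def by (rule measurable_PiM_single') (auto intro!: measurable_compose[where g=odd])
  moreover have "g (f b) = b" for b
  proof
    fix n
    define t where "t n = (\<Sum>k. of_bool (b (k + n)) * (1/4::real) ^ k)" for n
    have geo: "summable (\<lambda>k. (1/4::real) ^ k)"
      by (rule summable_geometric) simp
    have sm: "summable (\<lambda>k. of_bool (b (k + n)) * (1/4::real) ^ k)" for n
      by (rule summable_comparison_test[OF _ geo]) auto
    have t_nonneg: "0 \<le> t n" for n
      unfolding t_def by (rule suminf_nonneg[OF sm]) auto
    have "t n \<le> (\<Sum>k. (1/4::real) ^ k)" for n
      unfolding t_def by (rule suminf_le[OF _ sm geo]) auto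
    then have t_le: "t n \<le> 4/3" for n
      by (simp add: suminf_geometric)
    have t_Suc: "t n = of_bool (b n) + t (Suc n) / 4" for n
    proof -
      have "t n = of_bool (b n) + (\<Sum>k. of_bool (b (k + Suc n)) * (1/4::real) ^ k * (1/4))"
        using suminf_split_head[OF sm[of n]] by (simp add: t_def field_simps)
      also have "(\<Sum>k. of_bool (b (k + Suc n)) * (1/4::real) ^ k * (1/4)) = t (Suc n) * (1/4)"
        unfolding t_def by (rule suminf_mult2[OF sm, symmetric])
      finally show ?thesis
        by simp
    qed
    \<comment> \<open>\<open>A\<close> is the number whose base 4 digits are the first
      \<open>n + 1\<close> bits; its parity is that of the last digit, which is the bit
      wanted.\<close>
    have "\<exists>A::int. 4 ^ n * t 0 = of_int A + t (Suc n) / 4 \<and> (odd A \<longleftrightarrow> b n)"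
    proof (induction n)
      case 0
      show ?case
        by (rule exI[of _ "of_bool (b 0)"]) (use t_Suc[of 0] in auto)
    next
      case (Suc n)
      then obtain A :: int where A: "4 ^ n * t 0 = of_int A + t (Suc n) / 4"
        by auto
      show ?case
      proof (intro exI conjI)
        have "4 ^ Suc n * t 0 = 4 * (4 ^ n * t 0)"
          by simp
        also have "\<dots> = 4 * of_int A + (of_bool (b (Suc n)) + t (Suc (Suc n)) / 4)"
          unfolding A t_Suc[of "Suc n", symmetric] by simp
        finally show "4 ^ Suc n * t 0 = of_int (4 * A + of_bool (b (Suc n))) + t (Suc (Suc n)) / 4"
          by simp
      qed auto
    qed
    then obtain A :: int where A: "4 ^ n * t 0 = of_int A + t (Suc n) / 4" "odd A \<longleftrightarrow> b n"
      by auto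
    have "\<lfloor>4 ^ n * t 0\<rfloor> = A"
      unfolding A(1) using t_nonneg[of "Suc n"] t_le[of "Suc n"] by (intro floor_unique) auto
    moreover have "f b = t 0"
      by (simp add: f_def t_def)
    ultimately show "g (f b) n = b n"
      using A(2) by (simp add: g_def)
  qed
  ultimately show ?thesis
    unfolding real_retract_def by blast
qed

definition rat_enum :: "nat \<Rightarrow> real" where
  "rat_enum = from_nat_into \<rat>"

lemma rat_enum_between:
  assumes "x < y"
  obtains n where "x < rat_enum n" "rat_enum n < y"
proof -
  obtain r where "r \<in> \<rat>" "x < r" "r < y"
    using Rats_dense_in_real[OF assms] by auto
  moreover have "range rat_enum = \<rat>"
    unfolding rat_enum_def by (rule range_from_nat_into) (auto simp: countable_rat)
  ultimately show thesis
    using that by (metis imageE)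
qed

lemma SUP_rat_enum_less: "(SUP j. if rat_enum j < a then ereal (rat_enum j) else -\<infinity>) = ereal a"
proof (rule antisym)
  show "(SUP j. if rat_enum j < a then ereal (rat_enum j) else -\<infinity>) \<le> ereal a"
    by (rule SUP_least) auto
  show "ereal a \<le> (SUP j. if rat_enum j < a then ereal (rat_enum j) else -\<infinity>)"
  proof (rule dense_le)
    fix y assume "y < ereal a"
    then have "\<exists>x. y \<le> ereal x \<and> x < a"
      by (cases y) (auto intro: exI[of _ "a - 1"])
    then obtain x where "y \<le> ereal x" "x < a"
      by auto
    moreover obtain j where "x < rat_enum j" "rat_enum j < a"
      using rat_enum_between[OF \<open>x < a\<close>] .
    ultimately have "y \<le> (if rat_enum j < a then ereal (rat_enum j) else -\<infinity>)"
      by (auto intro: order_trans)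
    also have "\<dots> \<le> (SUP j. if rat_enum j < a then ereal (rat_enum j) else -\<infinity>)"
      by (rule SUP_upper) simp
    finally show "y \<le> \<dots>" .
  qed
qed

text \<open>Each real is replaced by its Dedekind cut, one bit for each rational;
  \<open>prod_encode\<close> merges the countably many cuts into one bit sequence.\<close>

lemma real_retract_sequences: "real_retract (\<Pi>\<^sub>M n\<in>(UNIV::nat set). (borel :: real measure))"
proof (rule real_retract_trans[OF real_retract_bits])
  let ?S = "\<Pi>\<^sub>M n\<in>(UNIV::nat set). (borel :: real measure)"
  let ?B = "\<Pi>\<^sub>M n\<in>(UNIV::nat set). count_space (UNIV::bool set)"
  let ?f = "\<lambda>(a :: nat \<Rightarrow> real) m. rat_enum (snd (prod_decode m)) < a (fst (prod_decode m))"
  \<comment> \<open>The supremum is taken in the extended reals, so that it behaves well and is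
    measurable also on bit sequences that are not cuts.\<close>
  let ?g = "\<lambda>b i. real_of_ereal (SUP j. if b (prod_encode (i, j)) then ereal (rat_enum j) else -\<infinity>)"
  have [measurable]: "(\<lambda>a. a n) \<in> borel_measurable ?S" for n
    by (rule measurable_component_singleton) simp
  have [measurable]: "(\<lambda>b. b n) \<in> ?B \<rightarrow>\<^sub>M count_space UNIV" for n
    by (rule measurable_component_singleton) simp
  show "?f \<in> ?S \<rightarrow>\<^sub>M ?B"
    by (rule measurable_PiM_single') (simp_all, measurable)
  show "?g \<in> ?B \<rightarrow>\<^sub>M ?S"
  proof (rule measurable_PiM_single')
    show "(\<lambda>b. ?g b i) \<in> borel_measurable ?B" for i
      by measurable
  qed simp
  show "?g (?f a) = a" for a
    by (simp only: prod_encode_inverse fst_conv snd_conv SUP_rat_enum_less real_of_ereal.simps)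
qed

text \<open>The retract of \<open>Y\<close> acts on each coordinate, and zeros beyond time
  \<open>T\<close> turn a path into an infinite sequence.\<close>

lemma real_retract_path_topology:
  assumes sc: "second_countable Y" and r: "real_retract (borel_of Y)"
  shows "real_retract (borel_of (path_topology T Y))"
proof -
  let ?S = "\<Pi>\<^sub>M n\<in>(UNIV::nat set). (borel :: real measure)"
  let ?P = "borel_of (path_topology T Y)"
  obtain f :: "_ \<Rightarrow> real" and g where f [measurable]: "f \<in> borel_measurable (borel_of Y)" 
    and g [measurable]: "g \<in> borel \<rightarrow>\<^sub>M borel_of Y"
    and inv: "\<And>x. x \<in> topspace Y \<Longrightarrow> g (f x) = x"
    using r unfolding real_retract_def by auto
  show ?thesis
  proof (rule real_retract_trans[OF real_retract_sequences])
    have "(\<lambda>p. if n \<le> T then f (p n) else 0) \<in> borel_measurable ?P" for n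
      using continuous_map_measurable_borel_of[OF continuous_map_path_coordinate[of n T Y]]
      by (cases "n \<le> T") (auto intro: measurable_compose[OF _ f])
    then show "(\<lambda>p n. if n \<le> T then f (p n) else 0) \<in> ?P \<rightarrow>\<^sub>M ?S"
      by (intro measurable_PiM_single') auto
    have "(\<lambda>a. a n) \<in> borel_measurable ?S" for n
      by (rule measurable_component_singleton) simp
    then show "(\<lambda>a. \<lambda>i\<in>{..T}. g (a i)) \<in> ?S \<rightarrow>\<^sub>M ?P"
      by (intro measurable_into_path_topology[OF sc]) (auto intro: measurable_compose[OF _ g])
    show "(\<lambda>i\<in>{..T}. g (if i \<le> T then f (p i) else 0)) = p" if "p \<in> space ?P" for p
      using that inv by (auto simp: path_topology_def fun_eq_iff PiE_iff extensional_def)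
  qed
qed

section \<open>Laws on the real line given by their distribution function at the rationals\<close>

text \<open>The limits at both ends are stated with the tolerances \<open>1 / Suc k\<close>. The
  condition is then a countable combination of inequalities, hence measurable in
  \<open>c\<close>.\<close>

definition cdf_rats :: "(nat \<Rightarrow> real) \<Rightarrow> bool" where
  "cdf_rats c \<longleftrightarrow> (\<forall>m n. rat_enum m \<le> rat_enum n \<longrightarrow> c m \<le> c n) \<and> (\<forall>n. 0 \<le> c n \<and> c n \<le> 1) \<and>
     (\<forall>k. \<exists>n. c n < 1 / Suc k) \<and> (\<forall>k. \<exists>n. 1 - c n < 1 / Suc k)"

text \<open>The infimum runs over strictly larger rationals, which yields right continuity without
  demanding it of \<open>c\<close>.\<close>

definition cdf_ext :: "(nat \<Rightarrow> real) \<Rightarrow> real \<Rightarrow> real" where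
  "cdf_ext c x = (INF n\<in>{n. x < rat_enum n}. c n)"

text \<open>The default \<open>return borel 0\<close> makes this a probability measure for every
  \<open>c\<close>; a kernel must be one also on the null set where \<open>c\<close> is not a
  distribution function.\<close>

definition law_of_cdf :: "(nat \<Rightarrow> real) \<Rightarrow> real measure" where
  "law_of_cdf c = (if cdf_rats c then interval_measure (cdf_ext c) else return borel 0)"

lemma rat_enum_above: "\<exists>n. x < rat_enum n"
  by (meson less_add_one rat_enum_between)

lemma cdf_ext_eqI:
  assumes "\<And>n. x < rat_enum n \<Longrightarrow> y \<le> c n" and "\<And>e. 0 < e \<Longrightarrow> \<exists>n. x < rat_enum n \<and> c n < y + e"
  shows "cdf_ext c x = y"
  unfolding cdf_ext_def
proof (rule cInf_eq_non_empty)
  fix z assume z: "\<And>w. w \<in> c ` {n. x < rat_enum n} \<Longrightarrow> z \<le> w"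
  show "z \<le> y"
  proof (rule field_le_epsilon)
    fix e :: real assume "0 < e"
    then obtain n where "x < rat_enum n" "c n < y + e"
      using assms(2) by blast
    then show "z \<le> y + e"
      using z[of "c n"] by auto
  qed
qed (use assms(1) rat_enum_above in auto)

context
  fixes c assumes c: "cdf_rats c"
begin

private lemma c_bdd: "bdd_below (c ` N)"
  using c by (intro bdd_belowI[of _ 0]) (auto simp: cdf_rats_def)

private lemma cdf_ext_le: "x < rat_enum n \<Longrightarrow> cdf_ext c x \<le> c n"
  unfolding cdf_ext_def using c_bdd by (intro cINF_lower) auto

private lemma cdf_ext_ge: "(\<And>n. x < rat_enum n \<Longrightarrow> y \<le> c n) \<Longrightarrow> y \<le> cdf_ext c x"
  unfolding cdf_ext_def using rat_enum_above by (intro cINF_greatest) auto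

private lemma cdf_ext_approx: "cdf_ext c x < y \<Longrightarrow> \<exists>n. x < rat_enum n \<and> c n < y"
  unfolding cdf_ext_def using rat_enum_above c_bdd by (subst (asm) cINF_less_iff) auto

lemma cdf_ext_mono: "x \<le> y \<Longrightarrow> cdf_ext c x \<le> cdf_ext c y"
  by (rule cdf_ext_ge) (auto intro: cdf_ext_le)

lemma cdf_ext_nonneg: "0 \<le> cdf_ext c x"
  using c by (intro cdf_ext_ge) (auto simp: cdf_rats_def)

private lemma cdf_ext_le_1: "cdf_ext c x \<le> 1"
  using cdf_ext_le rat_enum_above[of x] c unfolding cdf_rats_def by (meson order_trans)

lemma cdf_ext_right_cont: "continuous (at_right a) (cdf_ext c)"
  unfolding continuous_within
proof (rule order_tendstoI)
  fix y assume "y < cdf_ext c a"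
  then show "\<forall>\<^sub>F x in at_right a. y < cdf_ext c x"
    unfolding eventually_at_right_field using cdf_ext_mono by (intro exI[of _ "a + 1"]) (force intro: less_le_trans)
next
  fix y assume "cdf_ext c a < y"
  then obtain n where "a < rat_enum n" "c n < y"
    using cdf_ext_approx by blast
  then show "\<forall>\<^sub>F x in at_right a. cdf_ext c x < y"
    unfolding eventually_at_right_field using cdf_ext_le by (intro exI[of _ "rat_enum n"]) (force intro: le_less_trans)
qed

lemma cdf_ext_at_bot: "(cdf_ext c \<longlongrightarrow> 0) at_bot"
proof (rule order_tendstoI)
  fix y :: real assume "y < 0"
  then show "\<forall>\<^sub>F x in at_bot. y < cdf_ext c x"
    using cdf_ext_nonneg by (intro always_eventually) (auto intro: less_le_trans)
next
  fix y :: real assume "0 < y"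
  then obtain k where "1 / Suc k < y"
    using nat_approx_posE by blast
  moreover obtain n where "c n < 1 / Suc k"
    using c unfolding cdf_rats_def by blast
  ultimately have "cdf_ext c x < y" if "x < rat_enum n" for x
    using cdf_ext_le[OF that] by simp
  then show "\<forall>\<^sub>F x in at_bot. cdf_ext c x < y"
    unfolding eventually_at_bot_dense by blast
qed

lemma cdf_ext_at_top: "(cdf_ext c \<longlongrightarrow> 1) at_top"
proof (rule order_tendstoI)
  fix y :: real assume "1 < y"
  then show "\<forall>\<^sub>F x in at_top. cdf_ext c x < y"
    using cdf_ext_le_1 by (intro always_eventually) (auto intro: le_less_trans)
next
  fix y :: real assume "y < 1"
  then obtain k where "1 / Suc k < 1 - y"
    using nat_approx_posE[of "1 - y"] by auto
  moreover obtain n where "1 - c n < 1 / Suc k"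
    using c unfolding cdf_rats_def by blast
  moreover have "c n \<le> cdf_ext c x" if "rat_enum n < x" for x
    using c that by (intro cdf_ext_ge) (auto simp: cdf_rats_def)
  ultimately have "y < cdf_ext c x" if "rat_enum n < x" for x
    using that by fastforce
  then show "\<forall>\<^sub>F x in at_top. y < cdf_ext c x"
    unfolding eventually_at_top_dense by blast
qed

lemma real_distribution_law_of_cdf: "real_distribution (law_of_cdf c)"
  using real_distribution_interval_measure[OF cdf_ext_mono cdf_ext_right_cont cdf_ext_at_bot cdf_ext_at_top] c
  by (simp add: law_of_cdf_def)

lemma cdf_law_of_cdf: "cdf (law_of_cdf c) = cdf_ext c"
  using cdf_interval_measure[OF cdf_ext_mono cdf_ext_right_cont cdf_ext_at_bot] c
  by (simp add: law_of_cdf_def)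

end

lemma prob_space_law_of_cdf: "prob_space (law_of_cdf c)"
proof (cases "cdf_rats c")
  case True
  then interpret real_distribution "law_of_cdf c"
    by (rule real_distribution_law_of_cdf)
  show ?thesis
    by (rule prob_space_axioms)
qed (simp add: law_of_cdf_def prob_space_return)

lemma sets_law_of_cdf: "sets (law_of_cdf c) = sets borel"
  by (simp add: law_of_cdf_def)

lemma emeasure_law_of_cdf_Iic:
  "emeasure (law_of_cdf c) {..x} = (if cdf_rats c then ennreal (cdf_ext c x) else indicator {..x} 0)"
proof (cases "cdf_rats c")
  case True
  interpret prob_space "law_of_cdf c"
    by (rule prob_space_law_of_cdf)
  show ?thesis
    using True cdf_law_of_cdf[OF True] by (simp add: emeasure_eq_measure cdf_def fun_eq_iff)
qed (simp add: law_of_cdf_def)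

text \<open>This turns measurable families of conditional distribution functions into kernels.
  Half-lines suffice as test sets, and on them the mass is an infimum over countably many
  coordinates of \<open>c\<close>.\<close>

lemma measurable_law_of_cdf:
  "law_of_cdf \<in> (\<Pi>\<^sub>M n\<in>(UNIV::nat set). (borel :: real measure)) \<rightarrow>\<^sub>M prob_algebra borel"
proof (rule measurable_prob_algebra_generated)
  let ?S = "\<Pi>\<^sub>M n\<in>(UNIV::nat set). (borel :: real measure)"
  have [measurable]: "(\<lambda>a. a n) \<in> borel_measurable ?S" for n
    by (rule measurable_component_singleton) simp
  show "sets borel = sigma_sets UNIV (range (\<lambda>a::real. {..a}))"
    by (subst borel_eq_atMost) (rule sets_measure_of, simp)
  show "Int_stable (range (\<lambda>a::real. {..a}))"
    by (auto simp: Int_stable_def)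
  fix A :: "real set" assume "A \<in> range (\<lambda>a. {..a})"
  then obtain x where A: "A = {..x}"
    by auto
  have comp: "(\<lambda>a. a n) \<in> borel_measurable ?S" for n
    by (rule measurable_component_singleton) simp
  have "Measurable.pred ?S (\<lambda>c. c m \<le> c n)" "Measurable.pred ?S (\<lambda>c. 0 \<le> c n)" "Measurable.pred ?S (\<lambda>c. c n \<le> 1)"
    "Measurable.pred ?S (\<lambda>c. c n < y)" "Measurable.pred ?S (\<lambda>c. 1 - c n < y)" for m n and y :: real
    unfolding pred_def
    by (intro borel_measurable_le borel_measurable_less borel_measurable_diff borel_measurable_const comp)+
  then have [measurable]: "Measurable.pred ?S cdf_rats"
    unfolding cdf_rats_def
    by (intro pred_intros_logic(3) pred_intros_countable pred_intros_imp' pred_intros_conj1')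
  have [measurable]: "(\<lambda>c. cdf_ext c x) \<in> borel_measurable ?S"
    unfolding cdf_ext_def by (intro borel_measurable_cINF_real) auto
  show "(\<lambda>c. emeasure (law_of_cdf c) A) \<in> borel_measurable ?S"
    unfolding A emeasure_law_of_cdf_Iic by measurable
qed (auto simp: prob_space_law_of_cdf sets_law_of_cdf)

text \<open>By right continuity a distribution function is determined by its values at the
  rationals, and it in turn determines the law.\<close>

lemma law_of_cdf_cdf:
  assumes "real_distribution \<mu>"
  shows "law_of_cdf (\<lambda>n. cdf \<mu> (rat_enum n)) = \<mu>"
proof -
  interpret real_distribution \<mu>
    by fact
  let ?c = "\<lambda>n. cdf \<mu> (rat_enum n)"
  have "\<exists>n. ?c n < 1 / Suc k" for k
  proof -
    have "\<forall>\<^sub>F x in at_bot. cdf \<mu> x < 1 / Suc k"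
      using cdf_lim_at_bot by (rule order_tendstoD) simp
    then obtain x where "\<And>y. y < x \<Longrightarrow> cdf \<mu> y < 1 / Suc k"
      unfolding eventually_at_bot_dense by auto
    then show ?thesis
      using rat_enum_between[of "x - 1" x] by (metis diff_less_eq less_add_one)
  qed
  moreover have "\<exists>n. 1 - ?c n < 1 / Suc k" for k
  proof -
    have "\<forall>\<^sub>F x in at_top. 1 - 1 / Suc k < cdf \<mu> x"
      using cdf_lim_at_top_prob by (rule order_tendstoD) simp
    then obtain x where "\<And>y. x < y \<Longrightarrow> 1 - 1 / Suc k < cdf \<mu> y"
      unfolding eventually_at_top_dense by auto
    then show ?thesis
      using rat_enum_above[of x] by (smt (verit))
  qed
  ultimately have c: "cdf_rats ?c"
    by (auto simp: cdf_rats_def cdf_nondecreasing cdf_nonneg cdf_bounded_prob)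
  have "cdf_ext ?c x = cdf \<mu> x" for x
  proof (rule cdf_ext_eqI)
    fix e :: real assume "0 < e"
    have "(cdf \<mu> \<longlongrightarrow> cdf \<mu> x) (at_right x)"
      using cdf_is_right_cont[of x] by (simp add: continuous_within)
    then have "\<forall>\<^sub>F y in at_right x. cdf \<mu> y < cdf \<mu> x + e"
      by (rule order_tendstoD) (use \<open>0 < e\<close> in simp)
    then obtain b where "x < b" "\<And>y. x < y \<Longrightarrow> y < b \<Longrightarrow> cdf \<mu> y < cdf \<mu> x + e"
      unfolding eventually_at_right_field by auto
    then show "\<exists>n. x < rat_enum n \<and> ?c n < cdf \<mu> x + e"
      using rat_enum_between by metis
  qed (simp add: cdf_nondecreasing)
  then have "cdf (law_of_cdf ?c) = cdf \<mu>"
    using cdf_law_of_cdf[OF c] by auto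
  then show ?thesis
    using cdf_unique real_distribution_law_of_cdf[OF c] real_distribution_axioms by blast
qed

text \<open>The law of \<open>f\<close> under \<mu> is recorded by its distribution function at the
  rationals. Going back, the law on the line is pushed forward by \<open>g\<close>, and
  \<open>g\<close> after \<open>f\<close> is the identity.\<close>

lemma real_retract_prob_algebra:
  assumes "real_retract S"
  shows "real_retract (prob_algebra S)"
proof -
  let ?R = "\<Pi>\<^sub>M n\<in>(UNIV::nat set). (borel :: real measure)"
  obtain f :: "_ \<Rightarrow> real" and g where f [measurable]: "f \<in> borel_measurable S"
    and g [measurable]: "g \<in> borel \<rightarrow>\<^sub>M S"
    and inv: "\<And>x. x \<in> space S \<Longrightarrow> g (f x) = x"
    using assms unfolding real_retract_def by auto
  show ?thesis
  proof (rule real_retract_trans[OF real_retract_sequences])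
    show "(\<lambda>\<mu> n. cdf (distr \<mu> borel f) (rat_enum n)) \<in> prob_algebra S \<rightarrow>\<^sub>M ?R"
      unfolding cdf_def
      by (rule measurable_PiM_single')
        (auto intro!: measurable_compose[OF measurable_distr_prob_space[OF f]])
    show "(\<lambda>c. distr (law_of_cdf c) S g) \<in> ?R \<rightarrow>\<^sub>M prob_algebra S"
      by (rule measurable_compose[OF measurable_law_of_cdf measurable_distr_prob_space[OF g]])
    fix \<mu> assume "\<mu> \<in> space (prob_algebra S)"
    then have [measurable_cong]: "sets \<mu> = sets S" and "prob_space \<mu>"
      by (auto simp: space_prob_algebra)
    interpret prob_space \<mu>
      by fact
    have "real_distribution (distr \<mu> borel f)"
      by (rule real_distribution_distr) measurable
    then have "distr (law_of_cdf (\<lambda>n. cdf (distr \<mu> borel f) (rat_enum n))) S g = distr (distr \<mu> borel f) S g"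
      by (simp add: law_of_cdf_cdf)
    also have "\<dots> = distr \<mu> S (\<lambda>x. g (f x))"
      by (subst distr_distr) (auto simp: comp_def)
    also have "\<dots> = distr \<mu> \<mu> (\<lambda>x. x)"
      using inv sets_eq_imp_space_eq[OF \<open>sets \<mu> = sets S\<close>] by (intro distr_cong) (auto simp: \<open>sets \<mu> = sets S\<close>)
    also have "\<dots> = \<mu>"
      by (rule distr_id)
    finally show "distr (law_of_cdf (\<lambda>n. cdf (distr \<mu> borel f) (rat_enum n))) S g = \<mu>" .
  qed
qed

section \<open>Regular conditional distributions\<close>

context prob_space
begin

text \<open>The pointwise infimum \<open>D\<close> of the \<open>Z n\<close> lies above
  \<open>E\<close> almost everywhere, yet its expectation is at most that of \<open>E\<close>; hence
  \<open>D = E\<close> almost everywhere. This transfers limits known for expectations to almost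
  every \<omega>, and is applied to both tails and to the right limits of conditional distribution
  functions.\<close>

lemma AE_integral_squeeze:
  fixes Z :: "'i \<Rightarrow> 'a \<Rightarrow> real"
  assumes N: "countable N" "N \<noteq> {}" and Z: "\<And>n. n \<in> N \<Longrightarrow> integrable M (Z n)" and E: "integrable M E"
    and le: "\<And>n. n \<in> N \<Longrightarrow> AE \<omega> in M. E \<omega> \<le> Z n \<omega>"
    and int: "\<And>e. 0 < e \<Longrightarrow> \<exists>n\<in>N. expectation (Z n) \<le> expectation E + e"
  shows "AE \<omega> in M. (\<forall>n\<in>N. E \<omega> \<le> Z n \<omega>) \<and> (\<forall>e>0. \<exists>n\<in>N. Z n \<omega> < E \<omega> + e)"
proof -
  define D where "D \<omega> = (INF n\<in>N. Z n \<omega>)" for \<omega>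
  obtain n0 where n0: "n0 \<in> N"
    using N by auto
  have ae: "AE \<omega> in M. \<forall>n\<in>N. E \<omega> \<le> Z n \<omega>"
    using le N(1) by (simp add: AE_ball_countable)
  have D_le: "AE \<omega> in M. \<forall>n\<in>N. D \<omega> \<le> Z n \<omega>"
    using ae by eventually_elim (auto simp: D_def intro!: cINF_lower bdd_belowI2)
  have E_le: "AE \<omega> in M. E \<omega> \<le> D \<omega>"
    using ae by eventually_elim (use N(2) in \<open>auto simp: D_def intro!: cINF_greatest\<close>)
  have [measurable]: "D \<in> borel_measurable M"
    unfolding D_def using Z N(1) by (intro borel_measurable_cINF_real) auto
  have D: "integrable M D"
  proof (rule Bochner_Integration.integrable_bound)
    show "integrable M (\<lambda>\<omega>. \<bar>E \<omega>\<bar> + \<bar>Z n0 \<omega>\<bar>)"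
      using E Z[OF n0] by auto
    show "AE \<omega> in M. norm (D \<omega>) \<le> norm (\<bar>E \<omega>\<bar> + \<bar>Z n0 \<omega>\<bar>)"
      using D_le E_le by eventually_elim (use n0 in force)
  qed simp
  have "expectation D \<le> expectation E + e" if e: "0 < e" for e
  proof -
    obtain n where n: "n \<in> N" "expectation (Z n) \<le> expectation E + e"
      using int[OF e] by auto
    have "expectation D \<le> expectation (Z n)"
      using D Z[OF n(1)] by (rule integral_mono_AE) (use D_le n(1) in auto)
    then show ?thesis
      using n(2) by simp
  qed
  then have "expectation D \<le> expectation E"
    by (rule field_le_epsilon)
  moreover have "expectation E \<le> expectation D"
    using E D E_le by (rule integral_mono_AE)
  ultimately have "expectation (\<lambda>\<omega>. D \<omega> - E \<omega>) = 0"
    using D E by simp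
  then have "AE \<omega> in M. D \<omega> - E \<omega> = 0"
    using D E E_le by (subst (asm) integral_nonneg_eq_0_iff_AE) auto
  then show ?thesis
    using ae
  proof eventually_elim
    case (elim \<omega>)
    have "\<exists>n\<in>N. Z n \<omega> < E \<omega> + e" if "0 < e" for e
    proof -
      have "(INF n\<in>N. Z n \<omega>) < E \<omega> + e"
        using elim(1) that by (simp add: D_def)
      then show ?thesis
        using N(2) elim(2) by (subst (asm) cINF_less_iff) (auto intro: bdd_belowI2)
    qed
    then show ?case
      using elim(2) by auto
  qed
qed

end

lemma (in prob_space) sigma_finite_subalgebraI:
  "subalgebra M F \<Longrightarrow> sigma_finite_subalgebra M F"
  by (intro finite_measure_subalgebra_is_sigma_finite finite_measure_subalgebra.intro
      finite_measure_subalgebra_axioms.intro finite_measure_axioms)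

section \<open>Kernels compared with conditional expectations\<close>

locale kernel_setup = prob_space M for M :: "'w measure" +
  fixes F :: "'w measure" and S :: "'a measure" and Y :: "'w \<Rightarrow> 'a"
  assumes subalg: "subalgebra M F" and Y [measurable]: "Y \<in> M \<rightarrow>\<^sub>M S"
begin

sublocale ce: sigma_finite_subalgebra M F
  by (rule sigma_finite_subalgebraI[OF subalg])

lemma space_F: "space F = space M" and sets_F: "A \<in> sets F \<Longrightarrow> A \<in> sets M"
  using subalg by (auto simp: subalgebra_def)

text \<open>Integrals over an event \<open>B\<close> of the conditioning sigma-algebra are rewritten as integrals
  against the image of \<open>restr B\<close> under \<open>Y\<close> or under a kernel. That two such images agree is then
  an equality of measures, which can be checked on a generator.\<close>

definition restr :: "'w set \<Rightarrow> 'w measure" where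
  "restr B = density M (indicator B)"

lemma finite_measure_restr: "B \<in> sets M \<Longrightarrow> finite_measure (restr B)"
  unfolding restr_def
  by (intro finite_measureI) (simp add: emeasure_restricted)

lemma integral_restr:
  fixes f :: "'w \<Rightarrow> real"
  assumes "B \<in> sets M" "f \<in> borel_measurable M"
  shows "integral\<^sup>L (restr B) f = (\<integral>\<omega>\<in>B. f \<omega> \<partial>M)"
proof -
  have "restr B = density M (\<lambda>\<omega>. ennreal (indicator B \<omega>))"
    unfolding restr_def by (simp add: ennreal_indicator)
  then show ?thesis
    using assms by (simp add: integral_density set_lebesgue_integral_def)
qed

lemma integral_distr_restr:
  fixes f :: "'a \<Rightarrow> real"
  assumes "B \<in> sets M" and [measurable]: "f \<in> borel_measurable S"
  shows "integral\<^sup>L (distr (restr B) S Y) f = (\<integral>\<omega>\<in>B. f (Y \<omega>) \<partial>M)"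
proof -
  have "Y \<in> restr B \<rightarrow>\<^sub>M S"
    using Y by (simp add: restr_def)
  then have "integral\<^sup>L (distr (restr B) S Y) f = integral\<^sup>L (restr B) (\<lambda>\<omega>. f (Y \<omega>))"
    by (intro integral_distr) auto
  also have "\<dots> = (\<integral>\<omega>\<in>B. f (Y \<omega>) \<partial>M)"
    using measurable_compose[OF Y assms(2)] assms(1) by (intro integral_restr)
  finally show ?thesis .
qed

context
  fixes \<kappa> :: "'w \<Rightarrow> 'a measure" assumes \<kappa>: "\<kappa> \<in> F \<rightarrow>\<^sub>M prob_algebra S"
begin

lemma kernel_measurable: "\<kappa> \<in> M \<rightarrow>\<^sub>M prob_algebra S"
  using measurable_from_subalg[OF subalg \<kappa>] .

lemma prob_space_kernel: "\<omega> \<in> space M \<Longrightarrow> prob_space (\<kappa> \<omega>)"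
  and sets_kernel: "\<omega> \<in> space M \<Longrightarrow> sets (\<kappa> \<omega>) = sets S"
  using measurable_space[OF kernel_measurable] by (auto simp: space_prob_algebra)

lemma borel_measurable_integral_kernel:
  fixes f :: "'a \<Rightarrow> real"
  assumes "f \<in> borel_measurable S"
  shows "(\<lambda>\<omega>. integral\<^sup>L (\<kappa> \<omega>) f) \<in> borel_measurable F"
  using measurable_compose[OF measurable_prob_algebraD[OF \<kappa>] integral_measurable_subprob_algebra[OF assms]] .

lemma kernel_restr: "\<kappa> \<in> restr B \<rightarrow>\<^sub>M subprob_algebra S"
  using measurable_prob_algebraD[OF kernel_measurable] by (simp add: restr_def)

lemma integral_bind_restr:
  fixes f :: "'a \<Rightarrow> real"
  assumes B: "B \<in> sets M" and f: "f \<in> borel_measurable S" and bd: "\<And>x. x \<in> space S \<Longrightarrow> \<bar>f x\<bar> \<le> C"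
  shows "integral\<^sup>L (restr B \<bind> \<kappa>) f = (\<integral>\<omega>\<in>B. integral\<^sup>L (\<kappa> \<omega>) f \<partial>M)"
    and "integrable (restr B \<bind> \<kappa>) f"
proof -
  have "AE \<omega> in restr B. emeasure (\<kappa> \<omega>) (space (\<kappa> \<omega>)) \<le> ennreal 1"
    using prob_space.emeasure_space_1[OF prob_space_kernel] by (intro AE_I2) (simp add: restr_def)
  note * = f bd kernel_restr finite_measure_restr[OF B] this
  have "integral\<^sup>L (restr B \<bind> \<kappa>) f = integral\<^sup>L (restr B) (\<lambda>\<omega>. integral\<^sup>L (\<kappa> \<omega>) f)"
    by (rule integral_bind[OF *])
  also have "\<dots> = (\<integral>\<omega>\<in>B. integral\<^sup>L (\<kappa> \<omega>) f \<partial>M)"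
    by (rule integral_restr[OF B measurable_from_subalg[OF subalg borel_measurable_integral_kernel[OF f]]])
  finally show "integral\<^sup>L (restr B \<bind> \<kappa>) f = (\<integral>\<omega>\<in>B. integral\<^sup>L (\<kappa> \<omega>) f \<partial>M)" .
  show "integrable (restr B \<bind> \<kappa>) f"
    by (rule integrable_bind[OF *])
qed

lemma space_restr_nonempty: "space (restr B) \<noteq> {}"
  using not_empty by (simp add: restr_def)

lemma sets_bind_restr: "sets (restr B \<bind> \<kappa>) = sets S"
  using space_restr_nonempty sets_kernel by (intro sets_bind) (auto simp: restr_def)

lemma finite_measure_bind_restr:
  assumes "B \<in> sets M"
  shows "finite_measure (restr B \<bind> \<kappa>)"
proof (rule finite_measureI)
  have "integrable (restr B \<bind> \<kappa>) (\<lambda>x. 1 :: real)"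
    using assms by (intro integral_bind_restr(2)[where C=1]) auto
  then show "emeasure (restr B \<bind> \<kappa>) (space (restr B \<bind> \<kappa>)) \<noteq> \<infinity>"
    by (simp add: integrable_iff_bounded less_top)
qed

text \<open>Because \<open>B\<close> lies in the conditioning sigma-algebra, the averaging property
  of conditional expectation gives both measures the same mass on every member of the generator.
  Both are finite, so uniqueness of extension applies.\<close>

lemma bind_restr_eq_distr:
  assumes B: "B \<in> sets F"
    and G: "sets S = sigma_sets (space S) G" "Int_stable G" "G \<subseteq> Pow (space S)"
    and A: "range A \<subseteq> G" "(\<Union>i::nat. A i) = space S"
    and eq: "\<And>A. A \<in> G \<Longrightarrow> AE \<omega> in M. measure (\<kappa> \<omega>) A = real_cond_exp M F (\<lambda>\<omega>. indicator A (Y \<omega>)) \<omega>"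
  shows "restr B \<bind> \<kappa> = distr (restr B) S Y"
proof (rule measure_eqI_generator_eq[OF G(2,3), where A=A])
  interpret b: finite_measure "restr B \<bind> \<kappa>"
    using B by (intro finite_measure_bind_restr sets_F)
  interpret r: finite_measure "restr B"
    using B by (intro finite_measure_restr sets_F)
  interpret d: finite_measure "distr (restr B) S Y"
    using Y by (intro r.finite_measure_distr) (simp add: restr_def)
  show "emeasure (restr B \<bind> \<kappa>) (A i) \<noteq> \<infinity>" for i
    by simp
  fix D assume D: "D \<in> G"
  then have D' [measurable]: "D \<in> sets S"
    unfolding G(1) by auto
  have "measure (restr B \<bind> \<kappa>) D = integral\<^sup>L (restr B \<bind> \<kappa>) (indicator D)"
    using D' sets_bind_restr sets.sets_into_space[OF D'] sets_eq_imp_space_eq[OF sets_bind_restr] by (auto simp: Int_absorb2)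
  also have "\<dots> = (\<integral>\<omega>\<in>B. integral\<^sup>L (\<kappa> \<omega>) (indicator D) \<partial>M)"
    using sets_F[OF B] by (intro integral_bind_restr(1)[where C=1]) (auto simp: indicator_def)
  also have "\<dots> = (\<integral>\<omega>\<in>B. real_cond_exp M F (\<lambda>\<omega>. indicator D (Y \<omega>)) \<omega> \<partial>M)"
  proof (rule set_lebesgue_integral_cong_AE)
    show "AE \<omega>\<in>B in M. integral\<^sup>L (\<kappa> \<omega>) (indicator D) = real_cond_exp M F (\<lambda>\<omega>. indicator D (Y \<omega>)) \<omega>"
      using eq[OF D] AE_space
    proof eventually_elim
      case (elim \<omega>)
      then show ?case
        using D' sets_kernel[of \<omega>] sets.sets_into_space[OF D'] sets_eq_imp_space_eq[OF sets_kernel, of \<omega>] by (auto simp: Int_absorb2)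
    qed
    show "(\<lambda>\<omega>. integral\<^sup>L (\<kappa> \<omega>) (indicat_real D)) \<in> borel_measurable M"
      by (rule measurable_from_subalg[OF subalg borel_measurable_integral_kernel]) simp
  qed (use sets_F[OF B] in auto)
  also have "\<dots> = (\<integral>\<omega>\<in>B. indicator D (Y \<omega>) \<partial>M)"
    using B by (intro ce.real_cond_exp_intA[symmetric] integrable_const_bound[where B=1]) auto
  also have "\<dots> = integral\<^sup>L (distr (restr B) S Y) (indicator D)"
    using sets_F[OF B] by (intro integral_distr_restr[symmetric]) auto
  also have "\<dots> = measure (distr (restr B) S Y) D"
    using sets.sets_into_space[OF D'] by (simp add: Int_absorb2)
  finally show "emeasure (restr B \<bind> \<kappa>) D = emeasure (distr (restr B) S Y) D"
    by (simp add: b.emeasure_eq_measure d.emeasure_eq_measure)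
qed (use A G sets_bind_restr in auto)

text \<open>A conditional expectation is characterized by its integrals over events \<open>B\<close>
  of \<open>F\<close>, and these are integrals of \<open>f\<close> against the two measures assumed
  equal.\<close>

lemma integral_kernel_eq_cond_exp:
  fixes f :: "'a \<Rightarrow> real"
  assumes eq: "\<And>B. B \<in> sets F \<Longrightarrow> restr B \<bind> \<kappa> = distr (restr B) S Y"
    and f [measurable]: "f \<in> borel_measurable S" and bd: "\<And>x. x \<in> space S \<Longrightarrow> \<bar>f x\<bar> \<le> C"
  shows "AE \<omega> in M. real_cond_exp M F (\<lambda>\<omega>. f (Y \<omega>)) \<omega> = integral\<^sup>L (\<kappa> \<omega>) f"
proof (rule ce.real_cond_exp_charact)
  fix B assume B: "B \<in> sets F"
  show "(\<integral>\<omega>\<in>B. f (Y \<omega>) \<partial>M) = (\<integral>\<omega>\<in>B. integral\<^sup>L (\<kappa> \<omega>) f \<partial>M)"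
    using integral_bind_restr(1)[OF sets_F[OF B] f bd] integral_distr_restr[OF sets_F[OF B] f] eq[OF B] by simp
next
  have "\<bar>f (Y \<omega>)\<bar> \<le> C" if "\<omega> \<in> space M" for \<omega>
    using bd measurable_space[OF Y that] by auto
  then show "integrable M (\<lambda>\<omega>. f (Y \<omega>))"
    by (intro integrable_const_bound[where B=C]) auto
  show m: "(\<lambda>\<omega>. integral\<^sup>L (\<kappa> \<omega>) f) \<in> borel_measurable F"
    by (rule borel_measurable_integral_kernel[OF f])
  have "norm (integral\<^sup>L (\<kappa> \<omega>) f) \<le> C" if w: "\<omega> \<in> space M" for \<omega>
  proof -
    interpret k: prob_space "\<kappa> \<omega>"
      by (rule prob_space_kernel[OF w])
    have sp: "space (\<kappa> \<omega>) = space S"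
      using sets_kernel[OF w] by (rule sets_eq_imp_space_eq)
    have "C \<ge> 0"
      using bd k.not_empty sp by force
    have "norm (integral\<^sup>L (\<kappa> \<omega>) f) \<le> integral\<^sup>L (\<kappa> \<omega>) (\<lambda>x. norm (f x))"
      by (rule integral_norm_bound)
    also have "\<dots> \<le> integral\<^sup>L (\<kappa> \<omega>) (\<lambda>x. C)"
      using bd sp \<open>C \<ge> 0\<close> by (intro integral_mono_AE') auto
    finally show ?thesis
      by (simp add: k.prob_space)
  qed
  then show "integrable M (\<lambda>\<omega>. integral\<^sup>L (\<kappa> \<omega>) f)"
    using measurable_from_subalg[OF subalg m] by (intro integrable_const_bound[where B=C]) auto
qed

end

lemma cond_prob_eq:
  assumes "A \<in> sets S"
  shows "AE \<omega> in M. real_cond_exp M F (indicat_real (Y -` A \<inter> space M)) \<omega> = real_cond_exp M F (\<lambda>\<omega>. indicator A (Y \<omega>)) \<omega>"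
  using assms by (intro ce.real_cond_exp_cong AE_I2) (auto simp: indicator_def)

text \<open>Agreement on a generator extends to all measurable sets by passing through equality of
  measures, so on the line only half-lines have to be examined.\<close>

lemma regular_cond_distrI:
  assumes "\<kappa> \<in> F \<rightarrow>\<^sub>M prob_algebra S"
    and "sets S = sigma_sets (space S) G" "Int_stable G" "G \<subseteq> Pow (space S)"
    and "range A \<subseteq> G" "(\<Union>i::nat. A i) = space S"
    and "\<And>A. A \<in> G \<Longrightarrow> AE \<omega> in M. measure (\<kappa> \<omega>) A = real_cond_exp M F (\<lambda>\<omega>. indicator A (Y \<omega>)) \<omega>"
  shows "regular_cond_distr M F S Y \<kappa>"
  unfolding regular_cond_distr_def
proof (intro conjI ballI)
  fix D assume D: "D \<in> sets S"
  have "AE \<omega> in M. real_cond_exp M F (\<lambda>\<omega>. indicator D (Y \<omega>)) \<omega> = integral\<^sup>L (\<kappa> \<omega>) (indicator D)"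
    using D by (intro integral_kernel_eq_cond_exp[OF assms(1) bind_restr_eq_distr[OF assms(1) _ assms(2-7)], where C=1])
      (auto simp: indicator_def)
  then show "AE \<omega> in M. measure (\<kappa> \<omega>) D = real_cond_exp M F (indicat_real (Y -` D \<inter> space M)) \<omega>"
    using cond_prob_eq[OF D] AE_space
  proof eventually_elim
    case (elim \<omega>)
    then show ?case
      using sets.sets_into_space[OF D] sets_eq_imp_space_eq[OF sets_kernel[OF assms(1)], of \<omega>]
      by (simp add: Int_absorb2)
  qed
qed fact

lemma regular_cond_distr_integral:
  fixes f :: "'a \<Rightarrow> real"
  assumes r: "regular_cond_distr M F S Y \<kappa>"
    and f: "f \<in> borel_measurable S" and bd: "\<And>x. x \<in> space S \<Longrightarrow> \<bar>f x\<bar> \<le> C"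
  shows "AE \<omega> in M. real_cond_exp M F (\<lambda>\<omega>. f (Y \<omega>)) \<omega> = integral\<^sup>L (\<kappa> \<omega>) f"
proof -
  have \<kappa>: "\<kappa> \<in> F \<rightarrow>\<^sub>M prob_algebra S"
    using r by (simp add: regular_cond_distr_def)
  have "AE \<omega> in M. measure (\<kappa> \<omega>) A = real_cond_exp M F (\<lambda>\<omega>. indicator A (Y \<omega>)) \<omega>" if A: "A \<in> sets S" for A
  proof -
    have "AE \<omega> in M. measure (\<kappa> \<omega>) A = real_cond_exp M F (indicat_real (Y -` A \<inter> space M)) \<omega>"
      using r A by (simp add: regular_cond_distr_def)
    then show ?thesis
      using cond_prob_eq[OF A] by eventually_elim simp
  qed
  \<comment> \<open>Here the full sigma-algebra plays the part of the generator, exhausted by a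
    constant sequence.\<close>
  then have "restr B \<bind> \<kappa> = distr (restr B) S Y" if "B \<in> sets F" for B
    using that sets.space_closed
    by (intro bind_restr_eq_distr[OF \<kappa> _ _ _ _ _ _, where G="sets S" and A="\<lambda>_. space S"])
      (auto simp: sets.sigma_sets_eq Int_stable_def)
  then show ?thesis
    by (intro integral_kernel_eq_cond_exp[OF \<kappa> _ f bd])
qed

end

section \<open>Existence of regular conditional distributions\<close>

text \<open>Conditional probabilities of half-lines are fixed only up to null sets. Restricting to
  rational endpoints leaves countably many requirements, which hold simultaneously off one null set;
  there they define a law.\<close>

lemma regular_cond_distr_real_exists:
  fixes Y :: "'w \<Rightarrow> real"
  assumes "prob_space M" and sub: "subalgebra M F" and Y: "Y \<in> borel_measurable M"
  shows "\<exists>\<kappa>. regular_cond_distr M F borel Y \<kappa>"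
proof -
  interpret kernel_setup M F borel Y
    using assms by (intro kernel_setup.intro kernel_setup_axioms.intro)
  note Y [measurable]
  define p where "p x = (\<lambda>\<omega>. indicator {..x} (Y \<omega>) :: real)" for x
  have [measurable]: "p x \<in> borel_measurable M" for x
    unfolding p_def by measurable
  have p_int: "integrable M (p x)" for x
    by (intro integrable_const_bound[where B=1]) (auto simp: p_def)
  define P where "P x = real_cond_exp M F (p x)" for x
  define C where "C \<omega> n = P (rat_enum n) \<omega>" for \<omega> n
  define d where "d = distr M borel Y"
  interpret d: real_distribution d
    unfolding d_def by (rule real_distribution_distr) measurable
  have E_p: "expectation (p x) = cdf d x" for x
    unfolding p_def d_def cdf_def by (simp add: measure_distr flip: indicator_vimage)
  have P_int: "integrable M (P x)" and E_P: "expectation (P x) = cdf d x" for x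
    using ce.real_cond_exp_int[OF p_int[of x]] E_p by (auto simp: P_def)
  have P_mono: "AE \<omega> in M. P x \<omega> \<le> P y \<omega>" if "x \<le> y" for x y
    unfolding P_def using that by (intro ce.real_cond_exp_mono p_int AE_I2) (auto simp: p_def indicator_def)
  have P_nonneg: "AE \<omega> in M. 0 \<le> P x \<omega>" for x
    unfolding P_def by (intro ce.real_cond_exp_pos AE_I2) (auto simp: p_def)
  have P_le1: "AE \<omega> in M. P x \<omega> \<le> 1" for x
  proof -
    have "AE \<omega> in M. P x \<omega> \<le> real_cond_exp M F (\<lambda>_. 1) \<omega>"
      unfolding P_def by (intro ce.real_cond_exp_mono p_int AE_I2) (auto simp: p_def indicator_def)
    moreover have "AE \<omega> in M. real_cond_exp M F (\<lambda>_. 1) \<omega> = 1"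
      by (rule ce.real_cond_exp_F_meas) auto
    ultimately show ?thesis
      by eventually_elim simp
  qed
  have "AE \<omega> in M. (\<forall>n\<in>UNIV. 0 \<le> C \<omega> n) \<and> (\<forall>e>0. \<exists>n\<in>UNIV. C \<omega> n < 0 + e)"
  proof (rule AE_integral_squeeze)
    fix e :: real assume "0 < e"
    then have "\<forall>\<^sub>F x in at_bot. cdf d x < e"
      using d.cdf_lim_at_bot by (rule order_tendstoD[rotated])
    then obtain x where "\<And>y. y < x \<Longrightarrow> cdf d y < e"
      unfolding eventually_at_bot_dense by auto
    moreover obtain n where "rat_enum n < x"
      using rat_enum_between[of "x - 1" x] by auto
    ultimately show "\<exists>n\<in>UNIV. expectation (\<lambda>\<omega>. C \<omega> n) \<le> expectation (\<lambda>\<omega>. 0) + e"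
      using E_P by (auto simp: C_def intro!: exI[of _ n] less_imp_le)
  qed (use P_int P_nonneg in \<open>auto simp: C_def\<close>)
  moreover have "AE \<omega> in M. (\<forall>n\<in>UNIV. 0 \<le> 1 - C \<omega> n) \<and> (\<forall>e>0. \<exists>n\<in>UNIV. 1 - C \<omega> n < 0 + e)"
  proof (rule AE_integral_squeeze)
    fix e :: real assume "0 < e"
    then have "\<forall>\<^sub>F x in at_top. 1 - e < cdf d x"
      using d.cdf_lim_at_top_prob by (intro order_tendstoD) auto
    then obtain x where x: "\<And>y. x < y \<Longrightarrow> 1 - e < cdf d y"
      unfolding eventually_at_top_dense by auto
    obtain n where "x < rat_enum n"
      using rat_enum_above by auto
    then show "\<exists>n\<in>UNIV. expectation (\<lambda>\<omega>. 1 - C \<omega> n) \<le> expectation (\<lambda>\<omega>. 0) + e"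
      using x[of "rat_enum n"] P_int E_P by (auto simp: C_def prob_space intro!: exI[of _ n])
  qed (use P_int P_le1 in \<open>auto simp: C_def\<close>)
  moreover have "AE \<omega> in M. \<forall>m n. rat_enum m \<le> rat_enum n \<longrightarrow> C \<omega> m \<le> C \<omega> n"
    unfolding AE_all_countable C_def using P_mono by auto
  ultimately have good: "AE \<omega> in M. cdf_rats (C \<omega>)"
    by eventually_elim (auto simp: cdf_rats_def)
  \<comment> \<open>The exceptional null set may depend on the real number \<open>x\<close>. That is
    harmless, since the defining property of the kernel is required for each set separately.\<close>
  have right: "AE \<omega> in M. cdf_ext (C \<omega>) x = P x \<omega>" for x
  proof -
    have "AE \<omega> in M. (\<forall>n\<in>{n. x < rat_enum n}. P x \<omega> \<le> C \<omega> n) \<and> (\<forall>e>0. \<exists>n\<in>{n. x < rat_enum n}. C \<omega> n < P x \<omega> + e)"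
    proof (rule AE_integral_squeeze)
      fix e :: real assume "0 < e"
      have "(cdf d \<longlongrightarrow> cdf d x) (at_right x)"
        using d.cdf_is_right_cont[of x] by (simp add: continuous_within)
      then have "\<forall>\<^sub>F y in at_right x. cdf d y < cdf d x + e"
        by (rule order_tendstoD) (use \<open>0 < e\<close> in simp)
      then obtain b where b: "x < b" "\<And>y. x < y \<Longrightarrow> y < b \<Longrightarrow> cdf d y < cdf d x + e"
        unfolding eventually_at_right_field by auto
      obtain n where "x < rat_enum n" "rat_enum n < b"
        using rat_enum_between[OF b(1)] .
      then show "\<exists>n\<in>{n. x < rat_enum n}. expectation (\<lambda>\<omega>. C \<omega> n) \<le> expectation (P x) + e"
        using b(2)[of "rat_enum n"] E_P by (auto simp: C_def intro!: exI[of _ n] less_imp_le)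
    qed (use P_int P_mono rat_enum_above in \<open>auto simp: C_def\<close>)
    then show ?thesis
      by eventually_elim (rule cdf_ext_eqI, auto)
  qed
  have "regular_cond_distr M F borel Y (\<lambda>\<omega>. law_of_cdf (C \<omega>))"
  proof (rule regular_cond_distrI)
    have "(\<lambda>\<omega>. C \<omega>) \<in> F \<rightarrow>\<^sub>M (\<Pi>\<^sub>M n\<in>(UNIV::nat set). (borel :: real measure))"
      unfolding C_def P_def by (rule measurable_PiM_single') auto
    then show "(\<lambda>\<omega>. law_of_cdf (C \<omega>)) \<in> F \<rightarrow>\<^sub>M prob_algebra borel"
      by (rule measurable_compose[OF _ measurable_law_of_cdf])
    have "sets borel = sigma_sets UNIV (range (\<lambda>a::real. {..a}))"
      by (subst borel_eq_atMost) (rule sets_measure_of, simp)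
    then show "sets borel = sigma_sets (space borel) (range (\<lambda>a::real. {..a}))"
      by simp
    show "Int_stable (range (\<lambda>a::real. {..a}))"
      by (auto simp: Int_stable_def)
    show "range (\<lambda>n. {..real n}) \<subseteq> range (\<lambda>a::real. {..a})"
      by auto
    show "(\<Union>n. {..real n}) = space borel"
      by (auto intro: real_arch_simple)
    fix A :: "real set" assume "A \<in> range (\<lambda>a. {..a})"
    then obtain x where A: "A = {..x}"
      by auto
    show "AE \<omega> in M. measure (law_of_cdf (C \<omega>)) A = real_cond_exp M F (\<lambda>\<omega>. indicator A (Y \<omega>)) \<omega>"
      using right[of x] good
    proof eventually_elim
      case (elim \<omega>)
      then show ?case
        using cdf_law_of_cdf[of "C \<omega>"] by (auto simp: A P_def p_def cdf_def fun_eq_iff)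
    qed
  qed simp
  then show ?thesis
    by blast
qed

text \<open>Condition the real variable \<open>f (Y \<omega>)\<close> and push the resulting kernel
  forward by \<open>g\<close>: the event that \<open>f (Y \<omega>)\<close> lies in the preimage of
  \<open>A\<close> under \<open>g\<close> is the event that \<open>Y \<omega>\<close> lies in
  \<open>A\<close>.\<close>

lemma regular_cond_distr_exists:
  assumes M: "prob_space M" and sub: "subalgebra M F" and Y [measurable]: "Y \<in> M \<rightarrow>\<^sub>M S"
    and "real_retract S"
  shows "\<exists>\<kappa>. regular_cond_distr M F S Y \<kappa>"
proof -
  obtain f :: "_ \<Rightarrow> real" and g where f [measurable]: "f \<in> borel_measurable S"
    and g [measurable]: "g \<in> borel \<rightarrow>\<^sub>M S"
    and inv: "\<And>x. x \<in> space S \<Longrightarrow> g (f x) = x"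
    using assms(4) unfolding real_retract_def by auto
  obtain \<kappa> where \<kappa>: "regular_cond_distr M F borel (\<lambda>\<omega>. f (Y \<omega>)) \<kappa>"
    using regular_cond_distr_real_exists[OF M sub, of "\<lambda>\<omega>. f (Y \<omega>)"] by auto
  have m: "\<kappa> \<in> F \<rightarrow>\<^sub>M prob_algebra borel"
    using \<kappa> by (simp add: regular_cond_distr_def)
  have "regular_cond_distr M F S Y (\<lambda>\<omega>. distr (\<kappa> \<omega>) S g)"
    unfolding regular_cond_distr_def
  proof (intro conjI ballI)
    show "(\<lambda>\<omega>. distr (\<kappa> \<omega>) S g) \<in> F \<rightarrow>\<^sub>M prob_algebra S"
      by (rule measurable_compose[OF m measurable_distr_prob_space[OF g]])
    fix A assume A [measurable]: "A \<in> sets S"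
    have gA: "g -` A \<in> sets borel"
      using measurable_sets[OF g A] by simp
    have eq: "(\<lambda>\<omega>. f (Y \<omega>)) -` (g -` A) \<inter> space M = Y -` A \<inter> space M"
      using inv measurable_space[OF Y] by auto
    have "AE \<omega> in M. measure (\<kappa> \<omega>) (g -` A) = real_cond_exp M F (indicat_real (Y -` A \<inter> space M)) \<omega>"
      using \<kappa> gA unfolding regular_cond_distr_def eq[symmetric] by auto
    then show "AE \<omega> in M. measure (distr (\<kappa> \<omega>) S g) A = real_cond_exp M F (indicat_real (Y -` A \<inter> space M)) \<omega>"
      using AE_space
    proof eventually_elim
      case (elim \<omega>)
      then have "sets (\<kappa> \<omega>) = sets borel"
        using measurable_space[OF m, of \<omega>] sub by (auto simp: space_prob_algebra subalgebra_def)
      then have "g \<in> \<kappa> \<omega> \<rightarrow>\<^sub>M S" "space (\<kappa> \<omega>) = UNIV"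
        using g sets_eq_imp_space_eq[of "\<kappa> \<omega>" borel] by (simp_all cong: measurable_cong_sets)
      then show ?case
        using elim by (simp add: measure_distr)
    qed
  qed
  then show ?thesis
    by blast
qed

section \<open>Subfamilies of test functions that generate the weak topology\<close>

text \<open>A bump equals 1 on a whole neighbourhood of the point, so that countably many bumps can
  exhaust an open set; closure under maxima merges them. Values are constrained only on the carrier,
  as functions may differ outside it.\<close>

definition bump_family :: "'a topology \<Rightarrow> ('a \<Rightarrow> real) set \<Rightarrow> bool" where
  "bump_family X H \<longleftrightarrow>
     (\<forall>h\<in>H. continuous_map X euclideanreal h \<and> (\<forall>x\<in>topspace X. 0 \<le> h x \<and> h x \<le> 1)) \<and>
     (\<exists>h\<in>H. \<forall>x\<in>topspace X. h x = 0) \<and>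
     (\<forall>g\<in>H. \<forall>h\<in>H. \<exists>k\<in>H. \<forall>x\<in>topspace X. k x = max (g x) (h x)) \<and>
     (\<forall>G x. openin X G \<longrightarrow> x \<in> G \<longrightarrow> (\<exists>h\<in>H. \<exists>N. openin X N \<and> x \<in> N \<and>
        (\<forall>y\<in>N. h y = 1) \<and> (\<forall>y\<in>topspace X - G. h y = 0)))"

lemma bump_familyD:
  assumes "bump_family X H" "h \<in> H"
  shows "continuous_map X euclideanreal h" "x \<in> topspace X \<Longrightarrow> 0 \<le> h x" "x \<in> topspace X \<Longrightarrow> h x \<le> 1"
proof -
  have "\<forall>h\<in>H. continuous_map X euclideanreal h \<and> (\<forall>x\<in>topspace X. 0 \<le> h x \<and> h x \<le> 1)"
    using assms(1) unfolding bump_family_def by (rule conjunct1)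
  then show "continuous_map X euclideanreal h" "x \<in> topspace X \<Longrightarrow> 0 \<le> h x" "x \<in> topspace X \<Longrightarrow> h x \<le> 1"
    using assms(2) by auto
qed

lemma bump_family_zero: "bump_family X H \<Longrightarrow> \<exists>h\<in>H. \<forall>x\<in>topspace X. h x = 0"
  unfolding bump_family_def by (elim conjE)

lemma bump_family_max:
  "bump_family X H \<Longrightarrow> g \<in> H \<Longrightarrow> h \<in> H \<Longrightarrow> \<exists>k\<in>H. \<forall>x\<in>topspace X. k x = max (g x) (h x)"
  unfolding bump_family_def by (elim conjE) (drule (1) bspec)+

lemma bump_family_bump:
  assumes "bump_family X H" "openin X G" "x \<in> G"
  obtains h N where "h \<in> H" "openin X N" "x \<in> N" "\<forall>y\<in>N. h y = 1" "\<forall>y\<in>topspace X - G. h y = 0"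
proof -
  have "\<forall>G x. openin X G \<longrightarrow> x \<in> G \<longrightarrow> (\<exists>h\<in>H. \<exists>N. openin X N \<and> x \<in> N \<and>
        (\<forall>y\<in>N. h y = 1) \<and> (\<forall>y\<in>topspace X - G. h y = 0))"
    using assms(1) unfolding bump_family_def by (elim conjE)
  then have "\<exists>h\<in>H. \<exists>N. openin X N \<and> x \<in> N \<and> (\<forall>y\<in>N. h y = 1) \<and> (\<forall>y\<in>topspace X - G. h y = 0)"
    using assms(2,3) by simp
  then show thesis
    using that by (elim bexE exE conjE)
qed

text \<open>Countably many neighbourhoods on which some bump equals 1 already cover
  \<open>G\<close>. Running maxima of the chosen bumps reach the value 1 at every point of
  \<open>G\<close> after finitely many terms.\<close>

lemma bump_sequence:
  assumes H: "bump_family X H" and sc: "second_countable X" and G: "openin X G"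
  obtains h :: "nat \<Rightarrow> 'a \<Rightarrow> real" where "\<And>k. h k \<in> H"
    "\<And>k x. x \<in> topspace X - G \<Longrightarrow> h k x = 0" "\<And>x. x \<in> G \<Longrightarrow> (\<lambda>k. h k x) \<longlonglongrightarrow> 1"
proof -
  define P where "P N h \<longleftrightarrow> h \<in> H \<and> (\<forall>y\<in>N. h y = 1) \<and> (\<forall>y\<in>topspace X - G. h y = 0)" for N and h :: "'a \<Rightarrow> real"
  define \<U> where "\<U> = {N. openin X N \<and> (\<exists>h. P N h)}"
  obtain \<V> where V: "countable \<V>" "\<V> \<subseteq> \<U>" "\<Union>\<V> = \<Union>\<U>"
    by (rule second_countable_subcover[OF sc, of \<U>]) (auto simp: \<U>_def)
  have G_sub: "G \<subseteq> \<Union>\<U>"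
  proof
    fix x assume "x \<in> G"
    obtain h N where "h \<in> H" "openin X N" "x \<in> N" "\<forall>y\<in>N. h y = 1" "\<forall>y\<in>topspace X - G. h y = 0"
      using bump_family_bump[OF H G \<open>x \<in> G\<close>] .
    then show "x \<in> \<Union>\<U>"
      unfolding \<U>_def P_def by blast
  qed
  have "\<exists>h. P {} h"
    using bump_family_zero[OF H] unfolding P_def by auto
  then have "{} \<in> \<U>"
    by (simp add: \<U>_def)
  \<comment> \<open>The empty set is added so that the enumerated family is nonempty even when no
    neighbourhood was selected; the zero function serves as its bump.\<close>
  define N where "N = from_nat_into (insert {} \<V>)"
  have ran: "range N = insert {} \<V>"
    unfolding N_def using V(1) by (intro range_from_nat_into) auto
  have "\<exists>h. P (N k) h" for k
  proof -
    have "N k \<in> \<U>"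
      using ran V(2) \<open>{} \<in> \<U>\<close> by (metis insert_iff rangeI subsetD)
    then show ?thesis
      by (simp add: \<U>_def)
  qed
  then obtain g where g: "\<And>k. P (N k) (g k)"
    by metis
  have gH: "g k \<in> H" for k
    using g by (simp add: P_def)
  \<comment> \<open>\<open>H\<close> has maxima only up to equality on the carrier, so just the two
    consequences of being a maximum are kept.\<close>
  have "\<exists>h. h \<in> H \<and> (\<forall>x\<in>topspace X. (\<forall>j\<le>k. g j x \<le> h x) \<and> ((\<forall>j\<le>k. g j x = 0) \<longrightarrow> h x = 0))" for k
  proof (induction k)
    case 0
    show ?case
      by (rule exI[of _ "g 0"]) (use gH in auto)
  next
    case (Suc k)
    then obtain h where h: "h \<in> H" "\<And>x j. x \<in> topspace X \<Longrightarrow> j \<le> k \<Longrightarrow> g j x \<le> h x"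
      "\<And>x. x \<in> topspace X \<Longrightarrow> (\<forall>j\<le>k. g j x = 0) \<Longrightarrow> h x = 0"
      by blast
    obtain h' where h': "h' \<in> H" "\<And>x. x \<in> topspace X \<Longrightarrow> h' x = max (h x) (g (Suc k) x)"
      using bump_family_max[OF H h(1) gH[of "Suc k"]] by auto
    show ?case
      using h h' by (intro exI[of _ h']) (auto simp: le_Suc_eq le_max_iff_disj)
  qed
  then obtain h where h: "\<And>k. h k \<in> H" "\<And>k x j. x \<in> topspace X \<Longrightarrow> j \<le> k \<Longrightarrow> g j x \<le> h k x"
      "\<And>k x. x \<in> topspace X \<Longrightarrow> (\<forall>j\<le>k. g j x = 0) \<Longrightarrow> h k x = 0"
    by metis
  show thesis
  proof
    show "h k \<in> H" for k
      by (rule h)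
    show "h k x = 0" if "x \<in> topspace X - G" for k x
      using g that by (intro h(3)) (auto simp: P_def)
    show "(\<lambda>k. h k x) \<longlonglongrightarrow> 1" if x: "x \<in> G" for x
    proof -
      have xX: "x \<in> topspace X"
        using x openin_subset[OF G] by auto
      have "x \<in> \<Union>(insert {} \<V>)"
        using x G_sub V(3) by auto
      then obtain j where "x \<in> N j"
        unfolding ran[symmetric] by auto
      then have "g j x = 1"
        using g[of j] by (auto simp: P_def)
      then have "h k x = 1" if "j \<le> k" for k
        using h(2)[OF xX that] bump_familyD(3)[OF H h(1)[of k] xX] by simp
      then show ?thesis
        by (intro tendsto_eventually eventually_sequentiallyI)
    qed
  qed
qed

lemma borel_probsD:
  assumes "\<mu> \<in> borel_probs X"
  shows "prob_space \<mu>" "sets \<mu> = sets (borel_of X)" "space \<mu> = topspace X"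
  using assms sets_eq_imp_space_eq[of \<mu> "borel_of X"] by (auto simp: borel_probs_def space_prob_algebra)

lemma bounded_continuousD:
  assumes "f \<in> bounded_continuous X"
  shows "continuous_map X euclideanreal f" "\<exists>B>0. \<forall>x\<in>topspace X. \<bar>f x\<bar> \<le> B"
  using assms unfolding bounded_continuous_def bounded_pos by auto

lemma integrable_continuous_map:
  assumes "\<mu> \<in> borel_probs X" "continuous_map X euclideanreal f" "\<And>x. x \<in> topspace X \<Longrightarrow> \<bar>f x\<bar> \<le> B"
  shows "integrable \<mu> f"
proof -
  interpret prob_space \<mu>
    by (rule borel_probsD(1)[OF assms(1)])
  have "f \<in> borel_measurable \<mu>"
    using continuous_map_borel_measurable[OF assms(2)] borel_probsD(2)[OF assms(1)]
    by (simp cong: measurable_cong_sets)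
  then show ?thesis
    using assms(3) borel_probsD(3)[OF assms(1)] by (intro integrable_const_bound[where B=B]) auto
qed

lemma integral_bounded_continuous_bound:
  assumes "\<mu> \<in> borel_probs X" "continuous_map X euclideanreal f" "\<And>x. x \<in> topspace X \<Longrightarrow> \<bar>f x\<bar> \<le> B"
  shows "\<bar>integral\<^sup>L \<mu> f\<bar> \<le> B"
proof -
  interpret prob_space \<mu>
    by (rule borel_probsD(1)[OF assms(1)])
  have i: "integrable \<mu> f"
    by (rule integrable_continuous_map[OF assms])
  have "integral\<^sup>L \<mu> f \<le> B" "- B \<le> integral\<^sup>L \<mu> f"
    using assms(3) borel_probsD(3)[OF assms(1)] i
    by (auto intro!: integral_le_const integral_ge_const AE_I2 simp: abs_le_iff minus_le_iff)
  then show ?thesis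
    by simp
qed

lemma bump_sequence_integral:
  assumes H: "bump_family X H" and "\<And>k. h k \<in> H" and G: "openin X G"
    and "\<And>k x. x \<in> topspace X - G \<Longrightarrow> h k x = 0" "\<And>x. x \<in> G \<Longrightarrow> (\<lambda>k. h k x) \<longlonglongrightarrow> 1"
    and \<mu>: "\<mu> \<in> borel_probs X"
  shows "(\<lambda>k. integral\<^sup>L \<mu> (h k)) \<longlonglongrightarrow> measure \<mu> G"
proof -
  interpret prob_space \<mu>
    by (rule borel_probsD(1)[OF \<mu>])
  have G': "G \<in> sets \<mu>"
    using openin_sets_borel_of[OF G] borel_probsD(2)[OF \<mu>] by simp
  have "(\<lambda>k. integral\<^sup>L \<mu> (h k)) \<longlonglongrightarrow> integral\<^sup>L \<mu> (indicat_real G)"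
  proof (rule integral_dominated_convergence[where w="\<lambda>_. 1"])
    show "h k \<in> borel_measurable \<mu>" for k
      using continuous_map_borel_measurable[OF bump_familyD(1)[OF H assms(2)]] borel_probsD(2)[OF \<mu>]
      by (simp cong: measurable_cong_sets)
    show "AE x in \<mu>. norm (h k x) \<le> 1" for k
      using bump_familyD(2,3)[OF H assms(2)] borel_probsD(3)[OF \<mu>] by (intro AE_I2) auto
    show "AE x in \<mu>. (\<lambda>k. h k x) \<longlonglongrightarrow> indicat_real G x"
    proof (rule AE_I2)
      fix x assume "x \<in> space \<mu>"
      then show "(\<lambda>k. h k x) \<longlonglongrightarrow> indicat_real G x"
        using assms(4,5)[of x] borel_probsD(3)[OF \<mu>] by (cases "x \<in> G") auto
    qed
  qed (use G' in auto)
  then show ?thesis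
    using sets.sets_into_space[OF G'] by (simp add: Int_absorb2)
qed

section \<open>Lower semicontinuity of integrals\<close>

text \<open>The sum counts the integers from 1 to \<open>n\<close> strictly below \<open>y\<close>;
  it rounds \<open>y\<close> down by at most 1. The last conjunct, saturation at \<open>n\<close>,
  is what carries the induction.\<close>

lemma staircase:
  fixes y :: real
  assumes "0 \<le> y"
  shows "(\<Sum>k=1..n. of_bool (real k < y)) \<le> y \<and> (y \<le> real n + 1 \<longrightarrow> y - 1 \<le> (\<Sum>k=1..n. of_bool (real k < y)))
    \<and> (real n < y \<longrightarrow> (\<Sum>k=1..n. of_bool (real k < y)) = real n)"
proof (induction n)
  case (Suc n)
  obtain s :: real where s: "s = (\<Sum>k=1..n. of_bool (real k < y))"
    by simp
  have eq: "(\<Sum>k=1..Suc n. of_bool (real k < y)) = s + of_bool (real n + 1 < y)"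
    unfolding s by (subst sum.cl_ivl_Suc) (simp add: add.commute)
  have IH: "s \<le> y \<and> (y \<le> real n + 1 \<longrightarrow> y - 1 \<le> s) \<and> (real n < y \<longrightarrow> s = real n)"
    using Suc unfolding s .
  show ?case
  proof (cases "real n + 1 < y")
    case True
    then have "s = real n"
      using IH by simp
    then show ?thesis
      unfolding eq using True by simp
  next
    case False
    then have "y - 1 \<le> s" "s \<le> y"
      using IH by simp_all
    then show ?thesis
      unfolding eq using False by simp
  qed
qed (use assms in auto)

text \<open>The integral of \<open>f\<close> is approximated from below by \<open>\<mu>\<close>-masses of superlevel sets, and these by
  integrals of members of \<open>H\<close>. So \<open>H\<close> makes the integral of \<open>f\<close> lower semicontinuous,
  although \<open>f\<close> need not be a uniform limit of members of \<open>H\<close>.\<close>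

lemma openin_integral_greater_unit:
  assumes H: "bump_family X H" and sc: "second_countable X"
    and f: "continuous_map X euclideanreal f" "\<And>x. x \<in> topspace X \<Longrightarrow> 0 \<le> f x \<and> f x \<le> 1"
  shows "openin (initial_topology (borel_probs X) ((\<lambda>h \<mu>. integral\<^sup>L \<mu> h) ` H)) {\<mu> \<in> borel_probs X. a < integral\<^sup>L \<mu> f}"
    (is "openin ?W ?A")
proof (subst openin_subopen, intro ballI)
  fix \<mu>0 assume "\<mu>0 \<in> ?A"
  then have \<mu>0: "\<mu>0 \<in> borel_probs X" "a < integral\<^sup>L \<mu>0 f"
    by auto
  obtain m where "1 / real (Suc m) < integral\<^sup>L \<mu>0 f - a"
    using nat_approx_posE[of "integral\<^sup>L \<mu>0 f - a"] \<mu>0(2) by auto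
  \<comment> \<open>With \<open>n\<close> levels the staircase loses at most \<open>1 / n\<close> of
    the integral of \<open>f\<close>, and this must fit into the gap above \<open>a\<close>.\<close>
  then obtain n where n: "0 < n" "1 / real n < integral\<^sup>L \<mu>0 f - a"
    by (meson zero_less_Suc)
  define G where "G k = {x \<in> topspace X. real k < real n * f x}" for k
  have cont_nf: "continuous_map X euclideanreal (\<lambda>x. real n * f x)"
    using f(1) by (intro continuous_map_real_mult_left)
  have G: "openin X (G k)" for k
    using cont_nf unfolding continuous_map_upper_lower_semicontinuous_lt G_def by blast
  have "\<exists>h. (\<forall>j. h j \<in> H) \<and> (\<forall>j x. x \<in> topspace X - G k \<longrightarrow> h j x = 0) \<and> (\<forall>x. x \<in> G k \<longrightarrow> (\<lambda>j. h j x) \<longlonglongrightarrow> 1)" for k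
    by (rule bump_sequence[OF H sc G[of k]]) blast
  then obtain h where h: "\<And>k j. h k j \<in> H" "\<And>k j x. x \<in> topspace X - G k \<Longrightarrow> h k j x = 0"
    "\<And>k x. x \<in> G k \<Longrightarrow> (\<lambda>j. h k j x) \<longlonglongrightarrow> 1"
    by metis
  have int_h: "integrable \<mu> (h k j)" if "\<mu> \<in> borel_probs X" for \<mu> k j
    using bump_familyD[OF H h(1)] by (intro integrable_continuous_map[OF that, where B=1]) auto
  have int_nf: "integrable \<mu> (\<lambda>x. real n * f x)" if "\<mu> \<in> borel_probs X" for \<mu>
    using integrable_continuous_map[OF that f(1), of 1] f(2) by simp
  have "(\<lambda>j. \<Sum>k=1..n. integral\<^sup>L \<mu>0 (h k j)) \<longlonglongrightarrow> (\<Sum>k=1..n. measure \<mu>0 (G k))"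
    using bump_sequence_integral[OF H h(1) G h(2,3) \<mu>0(1)] by (intro tendsto_sum)
  moreover have "real n * a < (\<Sum>k=1..n. measure \<mu>0 (G k))"
  proof -
    interpret prob_space \<mu>0
      by (rule borel_probsD(1)[OF \<mu>0(1)])
    have G': "G k \<in> sets \<mu>0" for k
      using openin_sets_borel_of[OF G] borel_probsD(2)[OF \<mu>0(1)] by simp
    have int_G: "integrable \<mu>0 (indicat_real (G k))" for k
      using G' by (intro integrable_const_bound[where B=1]) (auto simp: indicator_def)
    have "real n * a < real n * integral\<^sup>L \<mu>0 f - 1"
      using n by (simp add: field_simps)
    also have "\<dots> = (\<integral>x. real n * f x - 1 \<partial>\<mu>0)"
      using int_nf[OF \<mu>0(1)] by (simp add: prob_space)
    also have "\<dots> \<le> (\<integral>x. (\<Sum>k=1..n. indicat_real (G k) x) \<partial>\<mu>0)"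
    proof (rule integral_mono)
      fix x assume x: "x \<in> space \<mu>0"
      then have "(\<Sum>k=1..n. indicat_real (G k) x) = (\<Sum>k=1..n. of_bool (real k < real n * f x))"
        using borel_probsD(3)[OF \<mu>0(1)] by (intro sum.cong) (auto simp: G_def indicator_def)
      moreover have "0 \<le> real n * f x" "real n * f x \<le> real n"
        using f(2)[of x] x borel_probsD(3)[OF \<mu>0(1)] by (auto intro: mult_left_le)
      ultimately show "real n * f x - 1 \<le> (\<Sum>k=1..n. indicat_real (G k) x)"
        using staircase[of "real n * f x" n] by simp
    qed (use int_G int_nf[OF \<mu>0(1)] in \<open>auto intro!: Bochner_Integration.integrable_sum\<close>)
    also have "\<dots> = (\<Sum>k=1..n. measure \<mu>0 (G k))"
      using int_G sets.sets_into_space[OF G'] by (subst Bochner_Integration.integral_sum) (auto simp: Int_absorb2)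
    finally show ?thesis .
  qed
  ultimately have "\<forall>\<^sub>F j in sequentially. real n * a < (\<Sum>k=1..n. integral\<^sup>L \<mu>0 (h k j))"
    by (rule order_tendstoD)
  then obtain j where j: "real n * a < (\<Sum>k=1..n. integral\<^sup>L \<mu>0 (h k j))"
    unfolding eventually_sequentially by auto
  \<comment> \<open>At \<open>\<mu>0\<close> the index \<open>j\<close> makes the bumps nearly
    exhaust the superlevel sets. At other laws only the inequality from bump to indicator to
    \<open>n * f\<close> is used, and it holds everywhere.\<close>
  define T where "T = {\<mu> \<in> borel_probs X. real n * a < (\<Sum>k=1..n. integral\<^sup>L \<mu> (h k j))}"
  have "continuous_map ?W euclideanreal (\<lambda>\<mu>. integral\<^sup>L \<mu> (h k j))" for k
    using h(1) by (intro continuous_map_initial_topology) auto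
  then have "continuous_map ?W euclideanreal (\<lambda>\<mu>. \<Sum>k=1..n. integral\<^sup>L \<mu> (h k j))"
    by (intro continuous_map_sum) auto
  then have "openin ?W T"
    unfolding continuous_map_upper_lower_semicontinuous_lt T_def topspace_initial_topology by blast
  moreover have "\<mu>0 \<in> T"
    using \<mu>0 j by (simp add: T_def)
  moreover have "T \<subseteq> ?A"
  proof
    fix \<mu> assume "\<mu> \<in> T"
    then have \<mu>: "\<mu> \<in> borel_probs X" and gt: "real n * a < (\<Sum>k=1..n. integral\<^sup>L \<mu> (h k j))"
      by (auto simp: T_def)
    have "(\<Sum>k=1..n. integral\<^sup>L \<mu> (h k j)) = (\<integral>x. (\<Sum>k=1..n. h k j x) \<partial>\<mu>)"
      using int_h[OF \<mu>] by (subst Bochner_Integration.integral_sum) auto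
    also have "\<dots> \<le> (\<integral>x. real n * f x \<partial>\<mu>)"
    proof (rule integral_mono)
      fix x assume "x \<in> space \<mu>"
      then have x: "x \<in> topspace X"
        using borel_probsD(3)[OF \<mu>] by simp
      have "h k j x \<le> of_bool (real k < real n * f x)" for k
        using bump_familyD(3)[OF H h(1) x] h(2)[of x k j] x by (auto simp: G_def)
      then have "(\<Sum>k=1..n. h k j x) \<le> (\<Sum>k=1..n. of_bool (real k < real n * f x))"
        by (rule sum_mono)
      also have "\<dots> \<le> real n * f x"
        using staircase[of "real n * f x" n] f(2)[OF x] by simp
      finally show "(\<Sum>k=1..n. h k j x) \<le> real n * f x" .
    qed (use int_h[OF \<mu>] int_nf[OF \<mu>] in \<open>auto intro!: Bochner_Integration.integrable_sum\<close>)
    finally have "real n * a < real n * integral\<^sup>L \<mu> f"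
      using gt by simp
    then show "\<mu> \<in> ?A"
      using n(1) \<mu> by simp
  qed
  ultimately show "\<exists>T. openin ?W T \<and> \<mu>0 \<in> T \<and> T \<subseteq> ?A"
    by blast
qed

lemma openin_integral_greater:
  assumes H: "bump_family X H" and sc: "second_countable X" and f: "f \<in> bounded_continuous X"
  shows "openin (initial_topology (borel_probs X) ((\<lambda>h \<mu>. integral\<^sup>L \<mu> h) ` H)) {\<mu> \<in> borel_probs X. a < integral\<^sup>L \<mu> f}"
proof -
  obtain B where B: "0 < B" "\<And>x. x \<in> topspace X \<Longrightarrow> \<bar>f x\<bar> \<le> B"
    using bounded_continuousD(2)[OF f] by auto
  have cont: "continuous_map X euclideanreal f"
    by (rule bounded_continuousD(1)[OF f])
  define g where "g x = (f x + B) / (2 * B)" for x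
  have "integral\<^sup>L \<mu> g = (integral\<^sup>L \<mu> f + B) / (2 * B)" if \<mu>: "\<mu> \<in> borel_probs X" for \<mu>
  proof -
    interpret prob_space \<mu>
      by (rule borel_probsD(1)[OF \<mu>])
    show ?thesis
      unfolding g_def using integrable_continuous_map[OF \<mu> cont B(2)] by (simp add: prob_space)
  qed
  then have "a < integral\<^sup>L \<mu> f \<longleftrightarrow> (a + B) / (2 * B) < integral\<^sup>L \<mu> g" if "\<mu> \<in> borel_probs X" for \<mu>
    using that B(1) by (simp add: divide_less_cancel)
  then have "{\<mu> \<in> borel_probs X. a < integral\<^sup>L \<mu> f} = {\<mu> \<in> borel_probs X. (a + B) / (2 * B) < integral\<^sup>L \<mu> g}"
    by auto
  moreover have "continuous_map X euclideanreal g"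
    unfolding g_def using cont B(1) by (intro continuous_intros) auto
  moreover have "0 \<le> g x \<and> g x \<le> 1" if "x \<in> topspace X" for x
    using B(1) B(2)[OF that] by (simp add: g_def abs_le_iff)
  ultimately show ?thesis
    using openin_integral_greater_unit[OF H sc] by simp
qed

text \<open>Lower semicontinuity is available for \<open>f\<close> and for \<open>- f\<close>, and
  together these give continuity of the integral of \<open>f\<close>.\<close>

lemma weak_topology_bump_family:
  assumes H: "bump_family X H" and sc: "second_countable X"
  shows "weak_topology X = initial_topology (borel_probs X) ((\<lambda>h \<mu>. integral\<^sup>L \<mu> h) ` H)"
  unfolding weak_topology_def
proof (rule initial_topology_eqI)
  let ?W = "initial_topology (borel_probs X) ((\<lambda>h \<mu>. integral\<^sup>L \<mu> h) ` H)"
  fix \<phi> assume "\<phi> \<in> (\<lambda>f \<mu>. integral\<^sup>L \<mu> f) ` bounded_continuous X"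
  then obtain f where f: "f \<in> bounded_continuous X" "\<phi> = (\<lambda>\<mu>. integral\<^sup>L \<mu> f)"
    by auto
  have "(\<lambda>x. - f x) \<in> bounded_continuous X"
    using f(1) unfolding bounded_continuous_def
    by (auto intro: continuous_map_minus simp: bounded_pos)
  then have "openin ?W {\<mu> \<in> borel_probs X. - a < integral\<^sup>L \<mu> (\<lambda>x. - f x)}" for a
    by (rule openin_integral_greater[OF H sc])
  then show "continuous_map ?W euclideanreal \<phi>"
    using openin_integral_greater[OF H sc f(1)]
    unfolding continuous_map_upper_lower_semicontinuous_lt f(2) by simp
next
  fix \<phi> assume "\<phi> \<in> (\<lambda>h \<mu>. integral\<^sup>L \<mu> h) ` H"
  moreover have "h \<in> bounded_continuous X" if "h \<in> H" for h
    using bump_familyD[OF H that] unfolding bounded_continuous_def bounded_iff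
    by (auto intro!: exI[of _ 1])
  ultimately show "continuous_map (initial_topology (borel_probs X) ((\<lambda>f \<mu>. integral\<^sup>L \<mu> f) ` bounded_continuous X)) euclideanreal \<phi>"
    by (intro continuous_map_initial_topology) auto
qed

section \<open>Constructing bump families\<close>

text \<open>Tents over the generators separate a point from the complement of a subbasic set, and
  minima handle finite intersections. For a union it suffices to use the member that contains the
  point.\<close>

lemma bump_family_generated:
  assumes A: "\<And>f. f \<in> A \<Longrightarrow> continuous_map (initial_topology S E) euclideanreal f" and "A \<noteq> {}"
    and clos: "\<And>f g \<Phi>. f \<in> A \<Longrightarrow> g \<in> A \<Longrightarrow> continuous_on UNIV (\<lambda>p. \<Phi> (fst p) (snd p)) \<Longrightarrow>
      bounded (range (\<lambda>p. \<Phi> (fst p) (snd p))) \<Longrightarrow> (\<lambda>x. \<Phi> (f x) (g x)) \<in> A"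
    and E: "\<And>e \<Phi>. e \<in> E \<Longrightarrow> continuous_on UNIV \<Phi> \<Longrightarrow> bounded (range \<Phi>) \<Longrightarrow> (\<lambda>x. \<Phi> (e x) :: real) \<in> A"
  shows "bump_family (initial_topology S E) {h \<in> A. \<forall>x\<in>S. 0 \<le> h x \<and> h x \<le> 1}"
proof -
  have unit: "bounded (range \<Phi>)" if "\<And>p :: 'b. 0 \<le> \<Phi> p \<and> \<Phi> p \<le> 1" for \<Phi> :: "'b \<Rightarrow> real"
    using that unfolding bounded_iff by (intro exI[of _ 1]) auto
  \<comment> \<open>Closure is assumed only for bounded operations; truncation to the unit interval
    makes any continuous operation admissible and changes nothing on values already there.\<close>
  have clamp: "(\<lambda>x. max 0 (min 1 (\<Phi> (f x) (g x)))) \<in> A"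
    if "f \<in> A" "g \<in> A" "continuous_on UNIV (\<lambda>p. \<Phi> (fst p) (snd p))" for f g \<Phi>
    using that by (intro clos[of f g "\<lambda>u v. max 0 (min 1 (\<Phi> u v))"] continuous_intros unit) auto
  have const: "(\<lambda>x. c) \<in> A" if "0 \<le> c" "c \<le> 1" for c
  proof -
    obtain f where "f \<in> A"
      using \<open>A \<noteq> {}\<close> by auto
    from clamp[OF this this, of "\<lambda>u v. c"] that show ?thesis
      by simp
  qed
  have peak: "\<exists>h\<in>A. (\<forall>y\<in>S. 0 \<le> h y \<and> h y \<le> 1) \<and> h x = 1 \<and> (\<forall>y\<in>S - G. h y = 0)"
    if "openin (initial_topology S E) G" "x \<in> G" for G x
  proof -
    have "generate_topology_on (insert S {\<phi> -` V \<inter> S |\<phi> V. \<phi> \<in> E \<and> open V}) G"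
      using that(1) by (simp add: initial_topology_def openin_topology_generated_by_iff)
    then show ?thesis
      using that(2)
    proof induction
      case (Int a b)
      then obtain f g where f: "f \<in> A" "\<forall>y\<in>S. 0 \<le> f y \<and> f y \<le> 1" "f x = 1" "\<forall>y\<in>S - a. f y = 0"
        and g: "g \<in> A" "\<forall>y\<in>S. 0 \<le> g y \<and> g y \<le> 1" "g x = 1" "\<forall>y\<in>S - b. g y = 0"
        by auto
      have "(\<lambda>x. max 0 (min 1 (min (f x) (g x)))) \<in> A"
        using f(1) g(1) by (intro clamp continuous_intros)
      moreover have "min (f y) (g y) = 0" if "y \<in> S - a \<inter> b" for y
        using f(2,4) g(2,4) that by (cases "y \<in> a") (auto simp: min_def)
      ultimately show ?case
        using f(3) g(3) by (intro bexI[of _ "\<lambda>x. max 0 (min 1 (min (f x) (g x)))"]) auto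
    next
      case (UN K)
      then obtain k where k: "k \<in> K" "x \<in> k"
        by auto
      then obtain h where "h \<in> A" "\<forall>y\<in>S. 0 \<le> h y \<and> h y \<le> 1" "h x = 1" "\<forall>y\<in>S - k. h y = 0"
        using UN(2)[OF k] by blast
      then show ?case
        using k(1) by (intro bexI[of _ h]) auto
    next
      case (Basis s)
      then consider "s = S" | e V where "e \<in> E" "open V" "s = e -` V \<inter> S"
        by auto
      then show ?case
      proof cases
        case 1
        then show ?thesis
          using const[of 1] by (intro bexI[of _ "\<lambda>_. 1"]) auto
      next
        case 2
        then obtain d where d: "0 < d" "\<And>u. dist u (e x) < d \<Longrightarrow> u \<in> V"
          using Basis(2) unfolding open_dist by auto
        \<comment> \<open>A tent of radius \<open>d\<close> around \<open>e x\<close>, where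
          \<open>d\<close> is small enough for the ball to stay inside \<open>V\<close>.\<close>
        have "(\<lambda>y. max 0 (min 1 (1 - dist (e y) (e x) / d))) \<in> A"
          using d(1) 2(1) by (intro E[of e "\<lambda>u. max 0 (min 1 (1 - dist u (e x) / d))"] continuous_intros unit) auto
        moreover have "max 0 (min 1 (1 - dist (e y) (e x) / d)) = 0" if "y \<in> S - s" for y
        proof -
          have "d \<le> dist (e y) (e x)"
            using d(2)[of "e y"] that 2(3) by (cases "dist (e y) (e x) < d") auto
          then show ?thesis
            using d(1) by (simp add: field_simps)
        qed
        ultimately show ?thesis
          by (intro bexI[of _ "\<lambda>y. max 0 (min 1 (1 - dist (e y) (e x) / d))"]) auto
      qed
    qed auto
  qed
  show ?thesis
    unfolding bump_family_def topspace_initial_topology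
  proof (intro conjI ballI allI impI)
    show "\<exists>h\<in>{h \<in> A. \<forall>x\<in>S. 0 \<le> h x \<and> h x \<le> 1}. \<forall>x\<in>S. h x = 0"
      using const[of 0] by (intro bexI[of _ "\<lambda>_. 0"]) auto
  next
    fix g h assume gh: "g \<in> {h \<in> A. \<forall>x\<in>S. 0 \<le> h x \<and> h x \<le> 1}" "h \<in> {h \<in> A. \<forall>x\<in>S. 0 \<le> h x \<and> h x \<le> 1}"
    then have "(\<lambda>x. max 0 (min 1 (max (g x) (h x)))) \<in> A"
      by (intro clamp continuous_intros) auto
    then show "\<exists>k\<in>{h \<in> A. \<forall>x\<in>S. 0 \<le> h x \<and> h x \<le> 1}. \<forall>x\<in>S. k x = max (g x) (h x)"
      using gh by (intro bexI[of _ "\<lambda>x. max 0 (min 1 (max (g x) (h x)))"]) auto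
  next
    fix G x assume Gx: "openin (initial_topology S E) G" "x \<in> G"
    then obtain h where h: "h \<in> A" "h x = 1" "\<forall>y\<in>S - G. h y = 0"
      using peak by blast
    have x: "x \<in> S"
      using openin_subset[OF Gx(1)] Gx(2) by auto
    have "openin (initial_topology S E) {y \<in> S. 1/2 < h y}"
      using A[OF h(1)]
      unfolding continuous_map_upper_lower_semicontinuous_lt topspace_initial_topology by blast
    \<comment> \<open>Doubling and truncating widens the peak at \<open>x\<close> to a plateau on
      the open set where \<open>h\<close> exceeds 1/2.\<close>
    moreover have "(\<lambda>x. max 0 (min 1 (2 * h x))) \<in> A"
    proof -
      have "continuous_on UNIV (\<lambda>p :: real \<times> real. 2 * fst p)"
        by (intro continuous_intros)
      then show ?thesis
        using clamp[OF h(1) h(1), of "\<lambda>u v. 2 * u"] by simp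
    qed
    ultimately show "\<exists>k\<in>{h \<in> A. \<forall>x\<in>S. 0 \<le> h x \<and> h x \<le> 1}. \<exists>N. openin (initial_topology S E) N \<and> x \<in> N \<and>
        (\<forall>y\<in>N. k y = 1) \<and> (\<forall>y\<in>S - G. k y = 0)"
      using h x by (intro bexI[of _ "\<lambda>x. max 0 (min 1 (2 * h x))"] exI[of _ "{y \<in> S. 1/2 < h y}"]) auto
  qed (use A in auto)
qed

lemma bump_family_completely_regular:
  assumes "completely_regular_space X"
  shows "bump_family X {h. continuous_map X euclideanreal h \<and> (\<forall>x\<in>topspace X. 0 \<le> h x \<and> h x \<le> 1)}"
  unfolding bump_family_def
proof (intro conjI ballI allI impI)
  show "\<exists>h\<in>{h. continuous_map X euclideanreal h \<and> (\<forall>x\<in>topspace X. 0 \<le> h x \<and> h x \<le> 1)}. \<forall>x\<in>topspace X. h x = 0"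
    by (intro bexI[of _ "\<lambda>_. 0"]) auto
next
  fix g h
  assume "g \<in> {h. continuous_map X euclideanreal h \<and> (\<forall>x\<in>topspace X. 0 \<le> h x \<and> h x \<le> 1)}"
    "h \<in> {h. continuous_map X euclideanreal h \<and> (\<forall>x\<in>topspace X. 0 \<le> h x \<and> h x \<le> 1)}"
  then show "\<exists>k\<in>{h. continuous_map X euclideanreal h \<and> (\<forall>x\<in>topspace X. 0 \<le> h x \<and> h x \<le> 1)}.
      \<forall>x\<in>topspace X. k x = max (g x) (h x)"
    by (intro bexI[of _ "\<lambda>x. max (g x) (h x)"]) (auto intro: continuous_map_real_max simp: le_max_iff_disj)
next
  fix G x assume G: "openin X G" "x \<in> G"
  then obtain f where f: "continuous_map X euclideanreal f" "f x = 0" "f ` (topspace X - G) \<subseteq> {1}"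
    using assms unfolding completely_regular_space_alt' by blast
  \<comment> \<open>The separating \<open>f\<close> is 0 at \<open>x\<close> and 1 off
    \<open>G\<close>; this reverses it and flattens it to 1 wherever \<open>f\<close> is below
    1/2.\<close>
  let ?h = "\<lambda>y. max 0 (min 1 (2 - 2 * f y))"
  have "openin X {y \<in> topspace X. f y < 1/2}"
    using f(1) unfolding continuous_map_upper_lower_semicontinuous_lt by blast
  moreover have "continuous_map X euclideanreal ?h"
    using f(1) by (intro continuous_intros continuous_map_real_mult_left) auto
  ultimately show "\<exists>h\<in>{h. continuous_map X euclideanreal h \<and> (\<forall>x\<in>topspace X. 0 \<le> h x \<and> h x \<le> 1)}.
      \<exists>N. openin X N \<and> x \<in> N \<and> (\<forall>y\<in>N. h y = 1) \<and> (\<forall>y\<in>topspace X - G. h y = 0)"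
    using f G openin_subset[OF G(1)]
    by (intro bexI[of _ ?h] exI[of _ "{y \<in> topspace X. f y < 1/2}"]) (auto simp: image_subset_iff)
qed auto

lemma completely_regular_bump_family:
  assumes "bump_family X H"
  shows "completely_regular_space X"
  unfolding completely_regular_space_alt'
proof (intro allI impI)
  fix G x assume G: "openin X G" "x \<in> G"
  obtain h N where h: "h \<in> H" "openin X N" "x \<in> N" "\<forall>y\<in>N. h y = 1" "\<forall>y\<in>topspace X - G. h y = 0"
    using bump_family_bump[OF assms G] .
  show "\<exists>f. continuous_map X euclideanreal f \<and> f x = 0 \<and> f ` (topspace X - G) \<subseteq> {1}"
    using h bump_familyD(1)[OF assms h(1)]
    by (intro exI[of _ "\<lambda>x. 1 - h x"]) (auto intro!: continuous_intros)
qed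

text \<open>The previous construction applies with all continuous functions as the closed family.
  Weak topologies are thereby completely regular by their very form.\<close>

lemma completely_regular_initial_topology: "completely_regular_space (initial_topology S E)"
proof -
  let ?X = "initial_topology S E"
  have "bump_family ?X {h \<in> {f. continuous_map ?X euclideanreal f}. \<forall>x\<in>S. 0 \<le> h x \<and> h x \<le> 1}"
  proof (rule bump_family_generated)
    fix f g :: "'a \<Rightarrow> real" and \<Phi> :: "real \<Rightarrow> real \<Rightarrow> real"
    assume "f \<in> {f. continuous_map ?X euclideanreal f}" "g \<in> {f. continuous_map ?X euclideanreal f}"
      and \<Phi>: "continuous_on UNIV (\<lambda>p. \<Phi> (fst p) (snd p))"
    then have "continuous_map ?X (prod_topology euclideanreal euclideanreal) (\<lambda>x. (f x, g x))"
      by (intro continuous_map_pairedI) auto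
    then have "continuous_map ?X euclidean (\<lambda>x. (f x, g x))"
      by simp
    then have "continuous_map ?X euclideanreal ((\<lambda>p. \<Phi> (fst p) (snd p)) \<circ> (\<lambda>x. (f x, g x)))"
      by (rule continuous_map_compose) (use \<Phi> in simp)
    then show "(\<lambda>x. \<Phi> (f x) (g x)) \<in> {f. continuous_map ?X euclideanreal f}"
      by (simp add: comp_def)
  next
    fix e :: "'a \<Rightarrow> real" and \<Phi> :: "real \<Rightarrow> real" assume "e \<in> E" "continuous_on UNIV \<Phi>"
    then have "continuous_map ?X euclideanreal (\<Phi> \<circ> e)"
      by (intro continuous_map_compose[OF continuous_map_initial_topology]) auto
    then show "(\<lambda>x. \<Phi> (e x)) \<in> {f. continuous_map ?X euclideanreal f}"
      by (simp add: comp_def)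
  next
    show "{f. continuous_map ?X euclideanreal f} \<noteq> {}"
    proof -
      have "(\<lambda>_. 0) \<in> {f. continuous_map ?X euclideanreal f}"
        by simp
      then show ?thesis
        by blast
    qed
  qed auto
  then show ?thesis
    by (rule completely_regular_bump_family)
qed

text \<open>One function for each pair of basic sets that can be separated, closed under finite
  maxima, is still a bump family. Through it the weak topology becomes second countable.\<close>

lemma countable_bump_family:
  assumes cr: "completely_regular_space X" and sc: "second_countable X"
  obtains H where "countable H" "bump_family X H"
proof -
  obtain \<B> where \<B>: "countable \<B>" "\<And>V. V \<in> \<B> \<Longrightarrow> openin X V"
    "\<And>U x. openin X U \<Longrightarrow> x \<in> U \<Longrightarrow> \<exists>V\<in>\<B>. x \<in> V \<and> V \<subseteq> U"
    using sc unfolding second_countable_def by metis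
  define H0 where "H0 = {h. continuous_map X euclideanreal h \<and> (\<forall>x\<in>topspace X. 0 \<le> h x \<and> h x \<le> 1)}"
  have H0: "bump_family X H0"
    unfolding H0_def by (rule bump_family_completely_regular[OF cr])
  define Q where "Q p h \<longleftrightarrow> (\<forall>y\<in>fst p. h y = 1) \<and> (\<forall>y\<in>topspace X - snd p. h y = 0)"
    for p :: "'a set \<times> 'a set" and h :: "'a \<Rightarrow> real"
  \<comment> \<open>Pairs without a separating function receive an arbitrary member of
    \<open>H0\<close>, which does no damage.\<close>
  have "\<exists>c. c \<in> H0 \<and> ((\<exists>h\<in>H0. Q p h) \<longrightarrow> Q p c)" for p
    using bump_family_zero[OF H0] by blast
  then obtain c where c: "\<And>p. c p \<in> H0" "\<And>p h. h \<in> H0 \<Longrightarrow> Q p h \<Longrightarrow> Q p (c p)"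
    by metis
  \<comment> \<open>Lists index the finite maxima: appending lists takes the maximum, and the empty
    list supplies the zero function.\<close>
  define m where "m ps = foldr (\<lambda>p h x. max (c p x) (h x)) ps (\<lambda>_. 0 :: real)" for ps
  have m_append: "m (ps @ qs) x = max (m ps x) (m qs x)" for ps qs x
  proof -
    have "0 \<le> m qs x" for qs
      by (induction qs) (auto simp: m_def le_max_iff_disj)
    then show ?thesis
      by (induction ps) (auto simp: m_def max.assoc)
  qed
  have mH0: "m ps \<in> H0" for ps
  proof (induction ps)
    case Nil
    then show ?case
      by (simp add: m_def H0_def)
  next
    case (Cons p ps)
    then show ?case
      using c(1)[of p] unfolding H0_def m_def by (auto intro: continuous_map_real_max simp: le_max_iff_disj)
  qed
  show thesis
  proof
    show "countable (m ` lists (\<B> \<times> \<B>))"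
      using \<B>(1) by (intro countable_image countable_lists countable_SIGMA)
    show "bump_family X (m ` lists (\<B> \<times> \<B>))"
      unfolding bump_family_def
    proof (intro conjI ballI allI impI)
      show "\<exists>h\<in>m ` lists (\<B> \<times> \<B>). \<forall>x\<in>topspace X. h x = 0"
        by (rule bexI[of _ "m []"], simp add: m_def, rule imageI, simp)
    next
      fix g h assume "g \<in> m ` lists (\<B> \<times> \<B>)" "h \<in> m ` lists (\<B> \<times> \<B>)"
      then obtain ps qs where "g = m ps" "h = m qs" "ps \<in> lists (\<B> \<times> \<B>)" "qs \<in> lists (\<B> \<times> \<B>)"
        by auto
      then show "\<exists>k\<in>m ` lists (\<B> \<times> \<B>). \<forall>x\<in>topspace X. k x = max (g x) (h x)"
        by (intro bexI[of _ "m (ps @ qs)"]) (auto simp: m_append)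
    next
      fix G x assume G: "openin X G" "x \<in> G"
      then obtain V where V: "V \<in> \<B>" "x \<in> V" "V \<subseteq> G"
        using \<B>(3) by blast
      obtain h N where h: "h \<in> H0" "openin X N" "x \<in> N" "\<forall>y\<in>N. h y = 1" "\<forall>y\<in>topspace X - V. h y = 0"
        using bump_family_bump[OF H0 \<B>(2)[OF V(1)] V(2)] .
      obtain U where U: "U \<in> \<B>" "x \<in> U" "U \<subseteq> N"
        using \<B>(3)[OF h(2,3)] by blast
      have "Q (U, V) h"
        using h U(3) by (auto simp: Q_def)
      then have "Q (U, V) (c (U, V))"
        using c(2) h(1) by blast
      then have "\<forall>y\<in>U. c (U, V) y = 1" "\<forall>y\<in>topspace X - G. c (U, V) y = 0"
        using V(3) by (auto simp: Q_def)
      then have "(\<forall>y\<in>U. m [(U, V)] y = 1) \<and> (\<forall>y\<in>topspace X - G. m [(U, V)] y = 0)"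
        by (simp add: m_def)
      then show "\<exists>h\<in>m ` lists (\<B> \<times> \<B>). \<exists>N. openin X N \<and> x \<in> N \<and> (\<forall>y\<in>N. h y = 1) \<and> (\<forall>y\<in>topspace X - G. h y = 0)"
        using U V \<B>(2) by (intro bexI[of _ "m [(U, V)]"] exI[of _ U]) auto
    qed (use mH0 in \<open>auto simp: H0_def\<close>)
  qed
qed

section \<open>The class of state spaces\<close>

text \<open>Complete regularity provides bumps and second countability makes sequences of them
  suffice; the retract provides regular conditional distributions and injective codes of
  laws.\<close>

definition good_space :: "'a topology \<Rightarrow> bool" where
  "good_space X \<longleftrightarrow> completely_regular_space X \<and> second_countable X \<and> real_retract (borel_of X)"

lemma topspace_weak_topology [simp]: "topspace (weak_topology X) = borel_probs X"
  by (simp add: weak_topology_def)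

lemma second_countable_weak_topology:
  assumes "completely_regular_space X" "second_countable X"
  shows "second_countable (weak_topology X)"
proof -
  obtain H where "countable H" "bump_family X H"
    using countable_bump_family[OF assms] .
  then show ?thesis
    using assms(2) by (simp add: weak_topology_bump_family second_countable_initial_topology)
qed

lemma borel_measurable_integral_prob_algebra:
  fixes f :: "'a \<Rightarrow> real"
  assumes "f \<in> borel_measurable S"
  shows "(\<lambda>\<mu>. integral\<^sup>L \<mu> f) \<in> borel_measurable (prob_algebra S)"
  using measurable_compose[OF measurable_prob_algebraD[OF measurable_ident] integral_measurable_subprob_algebra[OF assms]]
  by simp

text \<open>One half of the agreement between the Borel sets of the weak topology and the
  sigma-algebra of \<open>prob_algebra\<close>: integrals of bounded continuous functions are
  measurable, and second countability does the rest.\<close>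

lemma measurable_prob_algebra_weak_topology:
  assumes "completely_regular_space X" "second_countable X"
  shows "(\<lambda>\<mu>. \<mu>) \<in> prob_algebra (borel_of X) \<rightarrow>\<^sub>M borel_of (weak_topology X)"
  unfolding weak_topology_def
proof (rule measurable_into_borel_of_initial_topology)
  show "second_countable (initial_topology (borel_probs X) ((\<lambda>f \<mu>. integral\<^sup>L \<mu> f) ` bounded_continuous X))"
    using second_countable_weak_topology[OF assms] by (simp add: weak_topology_def)
  fix \<phi> assume "\<phi> \<in> (\<lambda>f \<mu>. integral\<^sup>L \<mu> f) ` bounded_continuous X"
  then show "\<phi> \<in> borel_measurable (prob_algebra (borel_of X))"
    by (auto simp: bounded_continuous_def intro!: borel_measurable_integral_prob_algebra continuous_map_borel_measurable)
qed (simp add: borel_probs_def)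

text \<open>The other half: the mass of an open set is a pointwise limit of integrals of bumps,
  which are continuous, and open sets form an intersection-stable generator.\<close>

lemma measurable_weak_topology_prob_algebra:
  assumes cr: "completely_regular_space X" and sc: "second_countable X"
  shows "(\<lambda>\<mu>. \<mu>) \<in> borel_of (weak_topology X) \<rightarrow>\<^sub>M prob_algebra (borel_of X)"
proof (rule measurable_prob_algebra_generated)
  show "sets (borel_of X) = sigma_sets (topspace X) {U. openin X U}"
    by (rule sets_borel_of)
  fix \<mu> assume "\<mu> \<in> space (borel_of (weak_topology X))"
  then have \<mu>: "\<mu> \<in> borel_probs X"
    by simp
  show "prob_space \<mu>" "sets \<mu> = sets (borel_of X)"
    using borel_probsD[OF \<mu>] by auto
next
  fix G assume "G \<in> {U. openin X U}"
  then have G: "openin X G"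
    by simp
  obtain H where H: "bump_family X H"
    using countable_bump_family[OF cr sc] by auto
  obtain h :: "nat \<Rightarrow> 'a \<Rightarrow> real" where h: "\<And>k. h k \<in> H"
    "\<And>k x. x \<in> topspace X - G \<Longrightarrow> h k x = 0" "\<And>x. x \<in> G \<Longrightarrow> (\<lambda>k. h k x) \<longlonglongrightarrow> 1"
    using bump_sequence[OF H sc G] by metis
  have "(\<lambda>\<mu>. measure \<mu> G) \<in> borel_measurable (borel_of (weak_topology X))"
  proof (rule borel_measurable_LIMSEQ_real)
    fix k
    have "continuous_map (weak_topology X) euclideanreal (\<lambda>\<mu>. integral\<^sup>L \<mu> (h k))"
      unfolding weak_topology_bump_family[OF H sc] using h(1) by (intro continuous_map_initial_topology) auto
    then show "(\<lambda>\<mu>. integral\<^sup>L \<mu> (h k)) \<in> borel_measurable (borel_of (weak_topology X))"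
      by (rule continuous_map_borel_measurable)
  next
    fix \<mu> assume "\<mu> \<in> space (borel_of (weak_topology X))"
    then show "(\<lambda>k. integral\<^sup>L \<mu> (h k)) \<longlonglongrightarrow> measure \<mu> G"
      using bump_sequence_integral[OF H h(1) G h(2,3)] by simp
  qed
  then have "(\<lambda>\<mu>. ennreal (measure \<mu> G)) \<in> borel_measurable (borel_of (weak_topology X))"
    by measurable
  moreover have "emeasure \<mu> G = ennreal (measure \<mu> G)" if "\<mu> \<in> space (borel_of (weak_topology X))" for \<mu>
  proof -
    interpret prob_space \<mu>
      using that borel_probsD(1) by simp
    show ?thesis
      by (rule emeasure_eq_measure)
  qed
  ultimately show "(\<lambda>\<mu>. emeasure \<mu> G) \<in> borel_measurable (borel_of (weak_topology X))"
    by (subst measurable_cong)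
qed (auto simp: Int_stable_def dest: openin_subset)

lemma good_space_weak_topology:
  assumes "good_space X"
  shows "good_space (weak_topology X)"
proof -
  have X: "completely_regular_space X" "second_countable X" "real_retract (borel_of X)"
    using assms by (auto simp: good_space_def)
  have "real_retract (borel_of (weak_topology X))"
    by (rule real_retract_trans[OF real_retract_prob_algebra[OF X(3)]
          measurable_weak_topology_prob_algebra[OF X(1,2)] measurable_prob_algebra_weak_topology[OF X(1,2)]]) simp
  then show ?thesis
    using second_countable_weak_topology[OF X(1,2)] completely_regular_initial_topology
    by (auto simp: good_space_def weak_topology_def)
qed

lemma good_space_path_topology:
  assumes "good_space Y"
  shows "good_space (path_topology T Y)"
  using assms second_countable_path_topology real_retract_path_topology
  by (auto simp: good_space_def path_topology_def completely_regular_space_product_topology)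

lemma topspace_transport_topology:
  "inj_on e (topspace X) \<Longrightarrow> topspace (transport_topology e X) = e ` topspace X"
  by (auto simp: transport_topology_def topspace_pullback_topology)

lemma homeomorphic_maps_transport_topology:
  assumes "inj_on e (topspace X)"
  shows "homeomorphic_maps X (transport_topology e X) e (inv_into (topspace X) e)"
  unfolding homeomorphic_maps_def
proof (intro conjI ballI)
  have "continuous_map X X (inv_into (topspace X) e \<circ> e)"
    by (rule continuous_map_eq[OF continuous_map_id]) (use assms in auto)
  then show "continuous_map X (transport_topology e X) e"
    unfolding transport_topology_def by (rule continuous_map_pullback') auto
  show "continuous_map (transport_topology e X) X (inv_into (topspace X) e)"
    using continuous_map_pullback[OF continuous_map_id, of "e ` topspace X" "inv_into (topspace X) e" X]
    by (simp add: transport_topology_def)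
qed (use assms in \<open>auto simp: topspace_transport_topology\<close>)

lemma good_space_transport_topology:
  assumes "good_space X" "inj_on e (topspace X)"
  shows "good_space (transport_topology e X)"
proof -
  have hm: "homeomorphic_maps X (transport_topology e X) e (inv_into (topspace X) e)"
    by (rule homeomorphic_maps_transport_topology[OF assms(2)])
  then have c: "continuous_map X (transport_topology e X) e"
    "continuous_map (transport_topology e X) X (inv_into (topspace X) e)"
    and inv: "\<And>y. y \<in> topspace (transport_topology e X) \<Longrightarrow> e (inv_into (topspace X) e y) = y"
    by (auto simp: homeomorphic_maps_def)
  have "real_retract (borel_of (transport_topology e X))"
    using assms(1) inv
    by (intro real_retract_trans[OF _ continuous_map_measurable_borel_of[OF c(2)] continuous_map_measurable_borel_of[OF c(1)]])
      (auto simp: good_space_def)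
  moreover have "X homeomorphic_space transport_topology e X"
    using hm by (auto simp: homeomorphic_space_def)
  ultimately show ?thesis
    using assms(1) homeomorphic_completely_regular_space homeomorphic_space_second_countability
    unfolding good_space_def by blast
qed

text \<open>The choice in \<open>law_code\<close> succeeds once any injection exists. The retract
  provides a real code for each law, which is used as a constant sequence.\<close>

lemma inj_on_law_code:
  assumes "good_space X"
  shows "inj_on (law_code X) (borel_probs X)"
proof -
  have "real_retract (prob_algebra (borel_of X))"
    using assms real_retract_prob_algebra by (auto simp: good_space_def)
  then obtain f :: "'a measure \<Rightarrow> real" and g where "\<forall>\<mu>\<in>space (prob_algebra (borel_of X)). g (f \<mu>) = \<mu>"
    unfolding real_retract_def by (elim bexE)
  then have "inj_on f (borel_probs X)"
    unfolding borel_probs_def by (intro inj_on_inverseI) auto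
  then have "inj_on (\<lambda>\<mu> (n::nat). f \<mu>) (borel_probs X)"
    by (auto simp: inj_on_def dest: fun_cong)
  then show ?thesis
    unfolding law_code_def by (rule someI[of "\<lambda>c. inj_on c (borel_probs X)"])
qed

section \<open>Separable Banach spaces and their closed subsets\<close>

text \<open>A point is coded by the indices of its approximations in a dense sequence and recovered
  as their limit. Decoding must be measurable on all index sequences, including those whose
  approximations diverge.\<close>

lemma good_space_euclidean: "good_space (euclidean :: 'v::{banach, second_countable_topology} topology)"
proof -
  obtain D :: "'v set" where D: "countable D" "\<And>X. open X \<Longrightarrow> X \<noteq> {} \<Longrightarrow> \<exists>d\<in>D. d \<in> X"
    using countable_dense_setE by blast
  have "D \<noteq> {}"
    using D(2)[of UNIV] by auto
  define q where "q = from_nat_into D"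
  have q: "\<exists>k. dist x (q k) < e" if "0 < e" for x :: 'v and e
  proof -
    have "\<exists>d\<in>D. d \<in> ball x e"
      using that by (intro D(2)) auto
    then obtain d where "d \<in> D" "d \<in> ball x e"
      by blast
    moreover have "range q = D"
      unfolding q_def by (rule range_from_nat_into[OF \<open>D \<noteq> {}\<close> D(1)])
    ultimately show ?thesis
      by (metis imageE mem_ball)
  qed
  have "real_retract (borel :: 'v measure)"
  proof (rule real_retract_trans[OF real_retract_sequences])
    let ?S = "\<Pi>\<^sub>M n\<in>(UNIV::nat set). (borel :: real measure)"
    define i where "i x n = (LEAST k. dist x (q k) < (1/2) ^ n)" for x :: 'v and n :: nat
    have i: "dist x (q (i x n)) < (1/2) ^ n" for x n
      unfolding i_def using q[of "(1/2) ^ n" x] by (auto intro: LeastI_ex)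
    have "(\<lambda>x. i x n) \<in> borel \<rightarrow>\<^sub>M count_space UNIV" for n
      unfolding i_def by measurable
    then have "(\<lambda>x. real (i x n)) \<in> borel_measurable borel" for n
      by (rule measurable_compose) simp
    then show "(\<lambda>x n. real (i x n)) \<in> borel \<rightarrow>\<^sub>M ?S"
      by (intro measurable_PiM_single') auto
    have comp: "(\<lambda>a. a n) \<in> borel_measurable ?S" for n
      by (rule measurable_component_singleton) simp
    have "(\<lambda>a. q (nat \<lfloor>a n\<rfloor>)) \<in> borel_measurable ?S" for n
      by (rule measurable_compose[OF measurable_compose[OF comp measurable_real_floor]]) simp
    then show "(\<lambda>a. lim (\<lambda>n. q (nat \<lfloor>a n\<rfloor>))) \<in> ?S \<rightarrow>\<^sub>M borel"
      by (rule borel_measurable_lim_metric)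
    show "lim (\<lambda>n. q (nat \<lfloor>real (i x n)\<rfloor>)) = x" for x
    proof (rule limI)
      have "(\<lambda>n. dist (q (i x n)) x) \<longlonglongrightarrow> 0"
      proof (rule tendsto_sandwich[of "\<lambda>_. 0" _ _ "\<lambda>n. (1/2) ^ n"])
        show "(\<lambda>n. (1/2::real) ^ n) \<longlonglongrightarrow> 0"
          by (rule LIMSEQ_realpow_zero) auto
      qed (use i in \<open>auto simp: dist_commute intro!: always_eventually less_imp_le\<close>)
      then show "(\<lambda>n. q (nat \<lfloor>real (i x n)\<rfloor>)) \<longlonglongrightarrow> x"
        by (subst tendsto_dist_iff) simp
    qed
  qed
  moreover have "second_countable (euclidean :: 'v topology)"
  proof -
    obtain \<B> :: "'v set set" where B: "countable \<B>" "\<And>C. C \<in> \<B> \<Longrightarrow> open C"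
      "\<And>S. open S \<Longrightarrow> \<exists>U. U \<subseteq> \<B> \<and> S = \<Union>U"
      by (metis univ_second_countable)
    have "\<exists>V\<in>\<B>. x \<in> V \<and> V \<subseteq> U" if U: "open U" "x \<in> U" for U x
    proof -
      obtain \<U> where "\<U> \<subseteq> \<B>" "U = \<Union>\<U>"
        using B(3)[OF U(1)] by auto
      then show ?thesis
        using U(2) by auto
    qed
    then show ?thesis
      unfolding second_countable_def using B(1,2) by (intro exI[of _ \<B>]) simp
  qed
  moreover have "completely_regular_space (euclidean :: 'v topology)"
    using metrizable_imp_completely_regular_space metrizable_space_euclidean by blast
  ultimately show ?thesis
    by (simp add: good_space_def borel_of_euclidean)
qed

lemma good_space_top_of_set:
  fixes K :: "'v::{banach, second_countable_topology} set"
  assumes "closed K" "K \<noteq> {}"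
  shows "good_space (top_of_set K)"
proof -
  have g: "good_space (euclidean :: 'v topology)"
    by (rule good_space_euclidean)
  obtain k where k: "k \<in> K"
    using assms(2) by auto
  have "real_retract (borel_of (top_of_set K))"
  proof (rule real_retract_trans[where N="borel_of (euclidean :: 'v topology)"])
    show "(\<lambda>x. x) \<in> borel_of (top_of_set K) \<rightarrow>\<^sub>M borel_of euclidean"
      by (rule continuous_map_measurable_borel_of) simp
    \<comment> \<open>Collapsing the complement to one point of \<open>K\<close> is discontinuous in
      general but measurable, because \<open>K\<close> is closed and so Borel.\<close>
    show "(\<lambda>x. if x \<in> K then x else k) \<in> borel_of euclidean \<rightarrow>\<^sub>M borel_of (top_of_set K)"
    proof (rule measurable_into_borel_of)
      fix U assume "openin (top_of_set K) U"
      then obtain V where V: "open V" "U = K \<inter> V"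
        by (auto simp: openin_open)
      have "(\<lambda>x. if x \<in> K then x else k) -` U = (K \<inter> V) \<union> (if k \<in> V then - K else {})"
        using V(2) k by (auto split: if_splits)
      then show "(\<lambda>x. if x \<in> K then x else k) -` U \<inter> space (borel_of euclidean) \<in> sets (borel_of euclidean)"
        using V(1) assms(1) by (auto simp: borel_of_euclidean)
    qed (use k in auto)
  qed (use g in \<open>auto simp: good_space_def\<close>)
  then show ?thesis
    using g by (auto simp: good_space_def intro: completely_regular_space_subtopology second_countable_subtopology)
qed

section \<open>Prediction processes\<close>

abbreviation pred_paths :: "nat \<Rightarrow> 'u topology \<Rightarrow> nat \<Rightarrow> (nat \<Rightarrow> 'u pred_point) topology" where
  "pred_paths T U r \<equiv> path_topology T (pred_space T U r)"

abbreviation pred_path :: "nat \<Rightarrow> 'u topology \<Rightarrow> nat \<Rightarrow> ('w, 'u) adapted_process \<Rightarrow> 'w \<Rightarrow> nat \<Rightarrow> 'u pred_point" where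
  "pred_path T U r X \<omega> \<equiv> \<lambda>t\<in>{..T}. pred_process T U X r t \<omega>"

definition encode_law :: "nat \<Rightarrow> 'u topology \<Rightarrow> nat \<Rightarrow> (nat \<Rightarrow> 'u pred_point) measure \<Rightarrow> 'u pred_point" where
  "encode_law T U r \<mu> = Law (law_code (pred_paths T U r) \<mu>)"

definition decode_law :: "nat \<Rightarrow> 'u topology \<Rightarrow> nat \<Rightarrow> 'u pred_point \<Rightarrow> (nat \<Rightarrow> 'u pred_point) measure" where
  "decode_law T U r = inv_into (borel_probs (pred_paths T U r)) (encode_law T U r)"

definition cond_kernel ::
    "nat \<Rightarrow> 'u topology \<Rightarrow> nat \<Rightarrow> ('w, 'u) adapted_process \<Rightarrow> nat \<Rightarrow> 'w \<Rightarrow> (nat \<Rightarrow> 'u pred_point) measure" where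
  "cond_kernel T U r X t = (SOME \<kappa>. regular_cond_distr (pspace X) (filt X t)
     (borel_of (pred_paths T U r)) (pred_path T U r X) \<kappa>)"

text \<open>Evaluated along the path of the prediction process of rank \<open>r + 1\<close>, this is
  the conditional expectation at time \<open>t\<close> of \<open>f\<close> of the path of rank
  \<open>r\<close>.\<close>

definition integral_at ::
    "nat \<Rightarrow> 'u topology \<Rightarrow> nat \<Rightarrow> nat \<Rightarrow> ((nat \<Rightarrow> 'u pred_point) \<Rightarrow> real) \<Rightarrow> (nat \<Rightarrow> 'u pred_point) \<Rightarrow> real" where
  "integral_at T U r t f p = integral\<^sup>L (decode_law T U r (p t)) f"

lemma pred_process_Suc:
  "pred_process T U X (Suc r) t \<omega> = encode_law T U r (cond_kernel T U r X t \<omega>)"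
  by (simp add: encode_law_def cond_kernel_def)

lemma pred_space_Suc:
  "pred_space T U (Suc r) = transport_topology (encode_law T U r) (weak_topology (pred_paths T U r))"
  by (simp add: encode_law_def[abs_def])

declare pred_space.simps [simp del] pred_process.simps [simp del]

lemma path_topology_coordinate_topspace:
  "p \<in> topspace (path_topology T Y) \<Longrightarrow> t \<le> T \<Longrightarrow> p t \<in> topspace Y"
  by (auto simp: path_topology_def)

lemma adapted_processesD:
  assumes "X \<in> adapted_processes T U" "t \<le> T"
  shows "prob_space (pspace X)" "subalgebra (pspace X) (filt X t)"
    "proc X t \<in> filt X t \<rightarrow>\<^sub>M borel_of U" "s \<le> t \<Longrightarrow> subalgebra (filt X t) (filt X s)"
proof -
  show *: "prob_space (pspace X)" "subalgebra (pspace X) (filt X t)" "proc X t \<in> filt X t \<rightarrow>\<^sub>M borel_of U"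
    using assms by (simp_all add: adapted_processes_def)
  assume "s \<le> t"
  then have "subalgebra (pspace X) (filt X s)" "sets (filt X s) \<subseteq> sets (filt X t)"
    using assms by (simp_all add: adapted_processes_def)
  then show "subalgebra (filt X t) (filt X s)"
    using *(2) by (simp add: subalgebra_def)
qed

context
  fixes T :: nat and U :: "'u topology"
  assumes U: "good_space U"
begin

lemma good_pred_space: "good_space (pred_space T U r)"
proof (induction r)
  case 0
  then show ?case
    using U by (simp add: good_space_transport_topology inj_on_def pred_space.simps(1))
next
  case (Suc r)
  have g: "good_space (pred_paths T U r)"
    by (rule good_space_path_topology[OF Suc])
  have "inj_on (encode_law T U r) (borel_probs (pred_paths T U r))"
    using inj_on_law_code[OF g] by (simp add: encode_law_def inj_on_def)
  then show ?case
    unfolding pred_space_Suc using good_space_weak_topology[OF g] by (intro good_space_transport_topology) auto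
qed

lemma good_pred_paths: "good_space (pred_paths T U r)"
  by (rule good_space_path_topology[OF good_pred_space])

lemma inj_on_encode_law: "inj_on (encode_law T U r) (borel_probs (pred_paths T U r))"
  using inj_on_law_code[OF good_pred_paths[of r]] by (simp add: encode_law_def inj_on_def)

lemma decode_encode_law: "\<mu> \<in> borel_probs (pred_paths T U r) \<Longrightarrow> decode_law T U r (encode_law T U r \<mu>) = \<mu>"
  unfolding decode_law_def by (rule inv_into_f_f[OF inj_on_encode_law])

lemma
  shows continuous_map_decode_law: "continuous_map (pred_space T U (Suc r)) (weak_topology (pred_paths T U r)) (decode_law T U r)"
    and continuous_map_encode_law: "continuous_map (weak_topology (pred_paths T U r)) (pred_space T U (Suc r)) (encode_law T U r)"
  using homeomorphic_maps_transport_topology[of "encode_law T U r" "weak_topology (pred_paths T U r)"] inj_on_encode_law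
  unfolding pred_space_Suc decode_law_def by (simp_all add: homeomorphic_maps_def)

lemma topspace_pred_space_Suc: "topspace (pred_space T U (Suc r)) = encode_law T U r ` borel_probs (pred_paths T U r)"
  unfolding pred_space_Suc using inj_on_encode_law by (simp add: topspace_transport_topology)

lemma decode_law_borel_probs:
  "p \<in> topspace (pred_paths T U (Suc r)) \<Longrightarrow> t \<le> T \<Longrightarrow> decode_law T U r (p t) \<in> borel_probs (pred_paths T U r)"
  using path_topology_coordinate_topspace[of p T "pred_space T U (Suc r)" t] continuous_map_decode_law[of r]
  by (auto simp: continuous_map_def)

lemma integral_at_bounded_continuous:
  assumes f: "f \<in> bounded_continuous (pred_paths T U r)" and t: "t \<le> T"
  shows "integral_at T U r t f \<in> bounded_continuous (pred_paths T U (Suc r))"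
proof -
  have "continuous_map (weak_topology (pred_paths T U r)) euclideanreal (\<lambda>\<mu>. integral\<^sup>L \<mu> f)"
    unfolding weak_topology_def using f by (intro continuous_map_initial_topology) auto
  from continuous_map_compose[OF continuous_map_compose[OF continuous_map_path_coordinate[OF t] continuous_map_decode_law] this]
  have "continuous_map (pred_paths T U (Suc r)) euclideanreal (integral_at T U r t f)"
    by (simp add: integral_at_def[abs_def] comp_def)
  moreover obtain B where "\<And>x. x \<in> topspace (pred_paths T U r) \<Longrightarrow> \<bar>f x\<bar> \<le> B"
    using bounded_continuousD(2)[OF f] by auto
  then have "\<bar>integral_at T U r t f p\<bar> \<le> B" if "p \<in> topspace (pred_paths T U (Suc r))" for p
    unfolding integral_at_def
    by (rule integral_bounded_continuous_bound[OF decode_law_borel_probs[OF that t] bounded_continuousD(1)[OF f]])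
  ultimately show ?thesis
    by (auto simp: bounded_continuous_def bounded_iff)
qed

context
  fixes X :: "('w, 'u) adapted_process"
  assumes X: "X \<in> adapted_processes T U"
begin

interpretation prob_space "pspace X"
  by (rule adapted_processesD(1)[OF X le0])

text \<open>Measurability at rank \<open>r + 1\<close> needs the kernel of rank \<open>r\<close>,
  which exists only if the path of rank \<open>r\<close> is measurable. This lemma and the next are
  stated conditionally so that one induction can resolve the dependence.\<close>

lemma measurable_pred_path_if:
  assumes "\<And>t. t \<le> T \<Longrightarrow> pred_process T U X r t \<in> filt X t \<rightarrow>\<^sub>M borel_of (pred_space T U r)"
  shows "pred_path T U r X \<in> filt X T \<rightarrow>\<^sub>M borel_of (pred_paths T U r)"
proof (rule measurable_into_path_topology)
  show "second_countable (pred_space T U r)"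
    using good_pred_space by (simp add: good_space_def)
  fix i assume i: "i \<le> T"
  have "(\<lambda>\<omega>. pred_path T U r X \<omega> i) = pred_process T U X r i"
    using i by (simp only: restrict_apply atMost_iff if_True)
  moreover have "pred_process T U X r i \<in> filt X T \<rightarrow>\<^sub>M borel_of (pred_space T U r)"
    by (rule measurable_from_subalg[OF adapted_processesD(4)[OF X order_refl i] assms[OF i]])
  ultimately show "(\<lambda>\<omega>. pred_path T U r X \<omega> i) \<in> filt X T \<rightarrow>\<^sub>M borel_of (pred_space T U r)"
    by (simp only:)
qed (rule restrict_extensional)

lemma cond_kernel_if:
  assumes "pred_path T U r X \<in> filt X T \<rightarrow>\<^sub>M borel_of (pred_paths T U r)" "t \<le> T"
  shows "regular_cond_distr (pspace X) (filt X t) (borel_of (pred_paths T U r)) (pred_path T U r X) (cond_kernel T U r X t)"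
proof -
  have "\<exists>\<kappa>. regular_cond_distr (pspace X) (filt X t) (borel_of (pred_paths T U r)) (pred_path T U r X) \<kappa>"
  proof (rule regular_cond_distr_exists)
    show "pred_path T U r X \<in> pspace X \<rightarrow>\<^sub>M borel_of (pred_paths T U r)"
      by (rule measurable_from_subalg[OF adapted_processesD(2)[OF X order_refl] assms(1)])
    show "real_retract (borel_of (pred_paths T U r))"
      using good_pred_paths by (simp add: good_space_def)
  qed (use adapted_processesD[OF X assms(2)] in auto)
  then show ?thesis
    unfolding cond_kernel_def by (rule someI_ex)
qed

text \<open>Adaptedness, rather than measurability on the whole space, is the claim: it makes the
  path measurable at time \<open>T\<close>, so that conditioning there changes nothing.\<close>

lemma measurable_pred_process:
  "t \<le> T \<Longrightarrow> pred_process T U X r t \<in> filt X t \<rightarrow>\<^sub>M borel_of (pred_space T U r)"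
proof (induction r arbitrary: t)
  case 0
  have "continuous_map U (pred_space T U 0) Point"
    using homeomorphic_maps_transport_topology[of Point U]
    by (simp add: homeomorphic_maps_def inj_on_def pred_space.simps(1))
  from measurable_compose[OF adapted_processesD(3)[OF X 0] continuous_map_measurable_borel_of[OF this]]
  show ?case
    by (simp add: pred_process.simps(1))
next
  case (Suc r)
  have "regular_cond_distr (pspace X) (filt X t) (borel_of (pred_paths T U r)) (pred_path T U r X) (cond_kernel T U r X t)"
    by (intro cond_kernel_if measurable_pred_path_if Suc)
  then have "cond_kernel T U r X t \<in> filt X t \<rightarrow>\<^sub>M prob_algebra (borel_of (pred_paths T U r))"
    by (simp add: regular_cond_distr_def)
  moreover have "(\<lambda>\<mu>. \<mu>) \<in> prob_algebra (borel_of (pred_paths T U r)) \<rightarrow>\<^sub>M borel_of (weak_topology (pred_paths T U r))"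
    using good_pred_paths by (intro measurable_prob_algebra_weak_topology) (simp_all add: good_space_def)
  ultimately have "cond_kernel T U r X t \<in> filt X t \<rightarrow>\<^sub>M borel_of (weak_topology (pred_paths T U r))"
    by (rule measurable_compose)
  from measurable_compose[OF this continuous_map_measurable_borel_of[OF continuous_map_encode_law]]
  show ?case
    unfolding pred_process_Suc .
qed

lemma measurable_pred_path_filt: "pred_path T U r X \<in> filt X T \<rightarrow>\<^sub>M borel_of (pred_paths T U r)"
  by (rule measurable_pred_path_if[OF measurable_pred_process])

lemma measurable_pred_path: "pred_path T U r X \<in> pspace X \<rightarrow>\<^sub>M borel_of (pred_paths T U r)"
  by (rule measurable_from_subalg[OF adapted_processesD(2)[OF X order_refl] measurable_pred_path_filt])

lemma pred_path_topspace: "\<omega> \<in> space (pspace X) \<Longrightarrow> pred_path T U r X \<omega> \<in> topspace (pred_paths T U r)"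
  using measurable_space[OF measurable_pred_path] by simp

lemma borel_measurable_of_pred_path:
  "F \<in> bounded_continuous (pred_paths T U r) \<Longrightarrow> (\<lambda>\<omega>. F (pred_path T U r X \<omega>)) \<in> borel_measurable (pspace X)"
  by (rule measurable_compose[OF measurable_pred_path continuous_map_borel_measurable[OF bounded_continuousD(1)]])

text \<open>Decoding the prediction process at time \<open>t\<close> returns the chosen kernel
  itself, and integrals against that kernel are conditional expectations.\<close>

lemma cond_exp_pred_path:
  assumes f: "f \<in> bounded_continuous (pred_paths T U r)" and t: "t \<le> T"
  shows "AE \<omega> in pspace X. real_cond_exp (pspace X) (filt X t) (\<lambda>\<omega>. f (pred_path T U r X \<omega>)) \<omega>
      = integral_at T U r t f (pred_path T U (Suc r) X \<omega>)"
proof -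
  interpret kernel_setup "pspace X" "filt X t" "borel_of (pred_paths T U r)" "pred_path T U r X"
    using adapted_processesD(2)[OF X t] measurable_pred_path by unfold_locales
  have k: "regular_cond_distr (pspace X) (filt X t) (borel_of (pred_paths T U r)) (pred_path T U r X) (cond_kernel T U r X t)"
    by (rule cond_kernel_if[OF measurable_pred_path_filt t])
  obtain B where B: "\<And>x. x \<in> topspace (pred_paths T U r) \<Longrightarrow> \<bar>f x\<bar> \<le> B"
    using bounded_continuousD(2)[OF f] by auto
  have "AE \<omega> in pspace X. real_cond_exp (pspace X) (filt X t) (\<lambda>\<omega>. f (pred_path T U r X \<omega>)) \<omega>
      = integral\<^sup>L (cond_kernel T U r X t \<omega>) f"
    using continuous_map_borel_measurable[OF bounded_continuousD(1)[OF f]] B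
    by (intro regular_cond_distr_integral[OF k]) auto
  then show ?thesis
    using AE_space
  proof eventually_elim
    case (elim \<omega>)
    have "cond_kernel T U r X t \<in> filt X t \<rightarrow>\<^sub>M prob_algebra (borel_of (pred_paths T U r))"
      using k unfolding regular_cond_distr_def by (rule conjunct1)
    then have "cond_kernel T U r X t \<omega> \<in> borel_probs (pred_paths T U r)"
      unfolding borel_probs_def by (rule measurable_space) (use elim(2) space_F in simp)
    then have "decode_law T U r (pred_path T U (Suc r) X \<omega> t) = cond_kernel T U r X t \<omega>"
      using t by (simp only: restrict_apply atMost_iff if_True pred_process_Suc decode_encode_law)
    then show ?case
      using elim(1) by (simp only: integral_at_def)
  qed
qed

text \<open>The path of \<open>X\<^sup>r\<close> is measurable at the final time, so conditioning on the sigma-algebra of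
  time \<open>T\<close> expresses a functional of it through the next prediction process.\<close>

lemma pred_path_lift:
  assumes f: "f \<in> bounded_continuous (pred_paths T U r)"
  shows "AE \<omega> in pspace X. f (pred_path T U r X \<omega>) = integral_at T U r T f (pred_path T U (Suc r) X \<omega>)"
proof -
  interpret ce: sigma_finite_subalgebra "pspace X" "filt X T"
    by (rule sigma_finite_subalgebraI[OF adapted_processesD(2)[OF X order_refl]])
  obtain B where B: "\<And>x. x \<in> topspace (pred_paths T U r) \<Longrightarrow> \<bar>f x\<bar> \<le> B"
    using bounded_continuousD(2)[OF f] by auto
  have "AE \<omega> in pspace X. real_cond_exp (pspace X) (filt X T) (\<lambda>\<omega>. f (pred_path T U r X \<omega>)) \<omega> = f (pred_path T U r X \<omega>)"
  proof (rule ce.real_cond_exp_F_meas)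
    show "integrable (pspace X) (\<lambda>\<omega>. f (pred_path T U r X \<omega>))"
      using B[OF pred_path_topspace] borel_measurable_of_pred_path[OF f]
      by (intro integrable_const_bound[where B=B]) auto
    show "(\<lambda>\<omega>. f (pred_path T U r X \<omega>)) \<in> borel_measurable (filt X T)"
      by (rule measurable_compose[OF measurable_pred_path_filt continuous_map_borel_measurable[OF bounded_continuousD(1)[OF f]]])
  qed
  then show ?thesis
    using cond_exp_pred_path[OF f order_refl] by eventually_elim simp
qed

lemma pred_law_borel_probs: "pred_law T U r X \<in> borel_probs (pred_paths T U r)"
  unfolding pred_law_def borel_probs_def space_prob_algebra
  using prob_space_distr[OF measurable_pred_path] by simp

lemma integral_pred_law:
  "F \<in> bounded_continuous (pred_paths T U r) \<Longrightarrow>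
    integral\<^sup>L (pred_law T U r X) F = (\<integral>\<omega>. F (pred_path T U r X \<omega>) \<partial>pspace X)"
  unfolding pred_law_def
  by (rule integral_distr[OF measurable_pred_path continuous_map_borel_measurable[OF bounded_continuousD(1)]])

end

section \<open>Adapted functionals as functions of prediction processes\<close>

text \<open>One function \<open>F\<close> has to serve all processes; equality is almost sure
  because conditional expectations are determined only up to null sets. Measurability is carried
  along for comparing expectations and conditional expectations of both sides.\<close>

definition represents ::
    "nat \<Rightarrow> ('w, 'u) functional \<Rightarrow> ((nat \<Rightarrow> 'u pred_point) \<Rightarrow> real) \<Rightarrow> bool" where
  "represents r \<phi> F \<longleftrightarrow> F \<in> bounded_continuous (pred_paths T U r) \<and>
     (\<forall>X\<in>adapted_processes T U. \<phi> X \<in> borel_measurable (pspace X) \<and>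
        (AE \<omega> in pspace X. \<phi> X \<omega> = F (pred_path T U r X \<omega>)))"

lemma representsI_pointwise:
  assumes F: "F \<in> bounded_continuous (pred_paths T U r)" and "\<And>X \<omega>. \<phi> X \<omega> = F (pred_path T U r X \<omega>)"
  shows "represents r \<phi> F"
proof -
  have "\<phi> X = (\<lambda>\<omega>. F (pred_path T U r X \<omega>))" for X
    using assms(2) by auto
  then show ?thesis
    using F by (simp add: represents_def borel_measurable_of_pred_path)
qed

lemma represents_Suc:
  assumes "represents r \<phi> F"
  shows "represents (Suc r) \<phi> (integral_at T U r T F)"
  unfolding represents_def
proof (intro conjI ballI)
  have F: "F \<in> bounded_continuous (pred_paths T U r)"
    using assms by (simp add: represents_def)
  then show "integral_at T U r T F \<in> bounded_continuous (pred_paths T U (Suc r))"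
    by (intro integral_at_bounded_continuous) auto
  fix X :: "('a, 'u) adapted_process" assume X: "X \<in> adapted_processes T U"
  show "\<phi> X \<in> borel_measurable (pspace X)"
    using assms X by (simp add: represents_def)
  have "AE \<omega> in pspace X. \<phi> X \<omega> = F (pred_path T U r X \<omega>)"
    using assms X by (simp add: represents_def)
  then show "AE \<omega> in pspace X. \<phi> X \<omega> = integral_at T U r T F (pred_path T U (Suc r) X \<omega>)"
    using pred_path_lift[OF X F] by eventually_elim simp
qed

text \<open>Functionals of different ranks have to be brought to a common path space before a
  continuous operation can combine them.\<close>

lemma represents_le:
  assumes "represents k \<phi> F" "k \<le> r"
  shows "\<exists>G. represents r \<phi> G"
  using assms(2)
proof (induction r rule: dec_induct)
  case base
  then show ?case
    using assms(1) by blast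
next
  case (step n)
  then show ?case
    using represents_Suc by blast
qed

lemma represents_cond:
  assumes "represents r \<phi> F" and t: "t \<le> T"
  shows "represents (Suc r) (\<lambda>X. real_cond_exp (pspace X) (filt X t) (\<phi> X)) (integral_at T U r t F)"
  unfolding represents_def
proof (intro conjI ballI)
  have F: "F \<in> bounded_continuous (pred_paths T U r)"
    using assms by (simp add: represents_def)
  then show "integral_at T U r t F \<in> bounded_continuous (pred_paths T U (Suc r))"
    using t by (intro integral_at_bounded_continuous)
  fix X :: "('a, 'u) adapted_process" assume X: "X \<in> adapted_processes T U"
  interpret prob_space "pspace X"
    by (rule adapted_processesD(1)[OF X le0])
  interpret ce: sigma_finite_subalgebra "pspace X" "filt X t"
    by (rule sigma_finite_subalgebraI[OF adapted_processesD(2)[OF X t]])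
  show "real_cond_exp (pspace X) (filt X t) (\<phi> X) \<in> borel_measurable (pspace X)"
    by simp
  have "AE \<omega> in pspace X. \<phi> X \<omega> = F (pred_path T U r X \<omega>)" "\<phi> X \<in> borel_measurable (pspace X)"
    using assms X by (simp_all add: represents_def)
  then have "AE \<omega> in pspace X. real_cond_exp (pspace X) (filt X t) (\<phi> X) \<omega>
      = real_cond_exp (pspace X) (filt X t) (\<lambda>\<omega>. F (pred_path T U r X \<omega>)) \<omega>"
    using borel_measurable_of_pred_path[OF X F] by (rule ce.real_cond_exp_cong)
  then show "AE \<omega> in pspace X. real_cond_exp (pspace X) (filt X t) (\<phi> X) \<omega> = integral_at T U r t F (pred_path T U (Suc r) X \<omega>)"
    using cond_exp_pred_path[OF X F t] by eventually_elim simp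
qed

lemma represents_comp:
  fixes \<phi>s :: "nat \<Rightarrow> ('w, 'u) functional"
  assumes n: "0 < n" and r: "\<And>i. i < n \<Longrightarrow> represents r (\<phi>s i) (Fs i)"
    and f: "f \<in> bounded_continuous (product_topology (\<lambda>_. euclideanreal) {..<n})"
  shows "represents r (\<lambda>X \<omega>. f (\<lambda>i\<in>{..<n}. \<phi>s i X \<omega>)) (\<lambda>p. f (\<lambda>i\<in>{..<n}. Fs i p))"
  unfolding represents_def
proof (intro conjI ballI)
  \<comment> \<open>This rewrites \<open>{..<n}\<close> as \<open>{..m}\<close>, so the
    measurability lemma for paths also covers tuples of real values.\<close>
  obtain m where m: "n = Suc m"
    using n by (cases n) auto
  have cf: "continuous_map (product_topology (\<lambda>_. euclideanreal) {..<n}) euclideanreal f"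
    by (rule bounded_continuousD(1)[OF f])
  have Fs: "Fs i \<in> bounded_continuous (pred_paths T U r)" if "i < n" for i
    using r[OF that] by (simp add: represents_def)
  have "continuous_map (pred_paths T U r) (product_topology (\<lambda>_. euclideanreal) {..<n}) (\<lambda>p. \<lambda>i\<in>{..<n}. Fs i p)"
    unfolding continuous_map_componentwise using bounded_continuousD(1)[OF Fs] by auto
  from continuous_map_compose[OF this cf]
  have "continuous_map (pred_paths T U r) euclideanreal (\<lambda>p. f (\<lambda>i\<in>{..<n}. Fs i p))"
    by (simp add: comp_def)
  moreover have "\<exists>B>0. \<forall>x\<in>topspace (product_topology (\<lambda>_. euclideanreal) {..<n}). \<bar>f x\<bar> \<le> B"
    by (rule bounded_continuousD(2)[OF f])
  then obtain B where "\<And>x. x \<in> (\<Pi>\<^sub>E i\<in>{..<n}. UNIV) \<Longrightarrow> \<bar>f x\<bar> \<le> B"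
    by auto
  then have "\<bar>f (\<lambda>i\<in>{..<n}. Fs i p)\<bar> \<le> B" for p
    by auto
  ultimately show "(\<lambda>p. f (\<lambda>i\<in>{..<n}. Fs i p)) \<in> bounded_continuous (pred_paths T U r)"
    by (auto simp: bounded_continuous_def bounded_iff)
  fix X :: "('w, 'u) adapted_process" assume X: "X \<in> adapted_processes T U"
  have \<phi>s: "\<phi>s i X \<in> borel_measurable (pspace X)" "AE \<omega> in pspace X. \<phi>s i X \<omega> = Fs i (pred_path T U r X \<omega>)" if "i < n" for i
    using r[OF that] X by (simp_all add: represents_def)
  have "(\<lambda>\<omega>. \<lambda>i\<in>{..m}. \<phi>s i X \<omega>) \<in> pspace X \<rightarrow>\<^sub>M borel_of (path_topology m euclideanreal)"
  proof (rule measurable_into_path_topology)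
    show "second_countable euclideanreal"
      using good_space_euclidean[where 'v=real] by (simp add: good_space_def)
  qed (use \<phi>s(1) m in \<open>auto simp: borel_of_euclidean\<close>)
  moreover have "f \<in> borel_measurable (borel_of (path_topology m euclideanreal))"
    using continuous_map_borel_measurable[OF cf] by (simp add: m path_topology_def lessThan_Suc_atMost)
  ultimately show "(\<lambda>\<omega>. f (\<lambda>i\<in>{..<n}. \<phi>s i X \<omega>)) \<in> borel_measurable (pspace X)"
    unfolding m lessThan_Suc_atMost by (rule measurable_compose)
  have "AE \<omega> in pspace X. \<forall>i\<in>{..<n}. \<phi>s i X \<omega> = Fs i (pred_path T U r X \<omega>)"
    using \<phi>s(2) by (intro AE_finite_allI) auto
  then show "AE \<omega> in pspace X. f (\<lambda>i\<in>{..<n}. \<phi>s i X \<omega>) = f (\<lambda>i\<in>{..<n}. Fs i (pred_path T U r X \<omega>))"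
  proof eventually_elim
    case (elim \<omega>)
    then have "(\<lambda>i\<in>{..<n}. \<phi>s i X \<omega>) = (\<lambda>i\<in>{..<n}. Fs i (pred_path T U r X \<omega>))"
      by (intro restrict_ext) auto
    then show ?case
      by simp
  qed
qed

lemma pred_path_0_continuous: "continuous_map (pred_paths T U 0) (product_topology (\<lambda>_. U) I)
    (\<lambda>p. \<lambda>i\<in>I. inv_into (topspace U) Point (p (ts i)))" if "\<And>i. i \<in> I \<Longrightarrow> ts i \<le> T"
proof -
  have "continuous_map (pred_space T U 0) U (inv_into (topspace U) Point)"
    using homeomorphic_maps_transport_topology[of Point U]
    by (simp add: homeomorphic_maps_def inj_on_def pred_space.simps(1))
  from continuous_map_compose[OF continuous_map_path_coordinate this]
  have "continuous_map (pred_paths T U 0) U (\<lambda>p. inv_into (topspace U) Point (p (ts i)))" if "i \<in> I" for i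
    using \<open>i \<in> I \<Longrightarrow> ts i \<le> T\<close> that by (simp add: comp_def)
  then show ?thesis
    unfolding continuous_map_componentwise by auto
qed

lemma represents_base:
  assumes ts: "\<forall>i<n. ts i \<le> T" and f: "f \<in> bounded_continuous (product_topology (\<lambda>_. U) {..<n})"
  shows "represents 0 (\<lambda>(X :: ('w, 'u) adapted_process) \<omega>. f (\<lambda>i\<in>{..<n}. proc X (ts i) \<omega>))
     (\<lambda>p. f (\<lambda>i\<in>{..<n}. inv_into (topspace U) Point (p (ts i))))"
  unfolding represents_def
proof (intro conjI ballI)
  let ?g = "\<lambda>p. \<lambda>i\<in>{..<n}. inv_into (topspace U) Point (p (ts i))"
  have g: "continuous_map (pred_paths T U 0) (product_topology (\<lambda>_. U) {..<n}) ?g"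
    using ts by (intro pred_path_0_continuous) auto
  have "continuous_map (pred_paths T U 0) euclideanreal (\<lambda>p. f (?g p))"
    using continuous_map_compose[OF g bounded_continuousD(1)[OF f]] by (simp add: comp_def)
  moreover obtain B where "\<forall>x\<in>topspace (product_topology (\<lambda>_. U) {..<n}). \<bar>f x\<bar> \<le> B"
    using bounded_continuousD(2)[OF f] by auto
  then have "\<bar>f (?g p)\<bar> \<le> B" if "p \<in> topspace (pred_paths T U 0)" for p
    using g that unfolding continuous_map_def by blast
  ultimately show F: "(\<lambda>p. f (?g p)) \<in> bounded_continuous (pred_paths T U 0)"
    by (auto simp: bounded_continuous_def bounded_iff)
  fix X :: "('w, 'u) adapted_process" assume X: "X \<in> adapted_processes T U"
  have eq: "f (\<lambda>i\<in>{..<n}. proc X (ts i) \<omega>) = f (?g (pred_path T U 0 X \<omega>))" if \<omega>: "\<omega> \<in> space (pspace X)" for \<omega>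
  proof -
    have "proc X (ts i) \<omega> \<in> topspace U" if "i < n" for i
      using measurable_space[OF adapted_processesD(3)[OF X], of "ts i" \<omega>] adapted_processesD(2)[OF X, of "ts i"] ts that \<omega>
      by (auto simp: subalgebra_def)
    then have "(\<lambda>i\<in>{..<n}. proc X (ts i) \<omega>) = ?g (pred_path T U 0 X \<omega>)"
      using ts by (intro restrict_ext) (simp add: inv_into_f_f inj_on_def pred_process.simps(1))
    then show ?thesis
      by simp
  qed
  show "(\<lambda>\<omega>. f (\<lambda>i\<in>{..<n}. proc X (ts i) \<omega>)) \<in> borel_measurable (pspace X)"
    using borel_measurable_of_pred_path[OF X F] eq by (subst measurable_cong) auto
  show "AE \<omega> in pspace X. f (\<lambda>i\<in>{..<n}. proc X (ts i) \<omega>) = f (?g (pred_path T U 0 X \<omega>))"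
    using eq by (rule AE_I2)
qed

text \<open>Every rank \<open>r\<close> above \<open>k\<close> is included in the claim, since in
  the composition case the parts may have smaller ranks than their maximum.\<close>

lemma af_construction_represents:
  fixes \<phi> :: "('w, 'u) functional"
  assumes "af_construction T U \<phi> k" "k \<le> r"
  shows "\<exists>F. represents r \<phi> F"
  using assms
proof (induction arbitrary: r rule: af_construction.induct)
  case (base n ts f)
  then show ?case
    using represents_le[OF represents_base] by blast
next
  case (comp n \<phi>s ks f)
  have "\<exists>F. represents r (\<phi>s i) F" if "i < n" for i
  proof -
    have "ks i \<le> Max (ks ` {..<n})"
      using that by (intro Max_ge) auto
    then have "ks i \<le> r"
      using comp.prems by simp
    then show ?thesis
      using comp.IH that by blast
  qed
  then obtain Fs where "\<And>i. i < n \<Longrightarrow> represents r (\<phi>s i) (Fs i)"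
    by metis
  then show ?case
    using represents_comp[OF comp.hyps(1) _ comp.hyps(2)] by blast
next
  case (cond \<phi> k t)
  then obtain q where q: "r = Suc q" "k \<le> q"
    by (cases r) auto
  then obtain F where "represents q \<phi> F"
    using cond.IH by blast
  then show ?case
    using represents_cond cond.hyps(2) unfolding q(1) by blast
qed

lemma represents_expectation:
  assumes "represents r \<phi> F" and X: "X \<in> adapted_processes T U"
  shows "integral\<^sup>L (pspace X) (\<phi> X) = integral\<^sup>L (pred_law T U r X) F"
proof -
  have F: "F \<in> bounded_continuous (pred_paths T U r)"
    and m: "\<phi> X \<in> borel_measurable (pspace X)" and ae: "AE \<omega> in pspace X. \<phi> X \<omega> = F (pred_path T U r X \<omega>)"
    using assms by (simp_all add: represents_def)
  show ?thesis
    unfolding integral_pred_law[OF X F]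
    by (rule integral_cong_AE[OF m borel_measurable_of_pred_path[OF X F] ae])
qed

lemma AF_upto_iff: "\<phi> \<in> AF_upto T U r \<longleftrightarrow> (\<exists>k\<le>r. af_construction T U \<phi> k)"
proof
  assume "\<phi> \<in> AF_upto T U r"
  then have "\<exists>k. af_construction T U \<phi> k" "af_rank T U \<phi> \<le> r"
    by (auto simp: AF_upto_def AF_def)
  then show "\<exists>k\<le>r. af_construction T U \<phi> k"
    unfolding af_rank_def using LeastI_ex[of "af_construction T U \<phi>"] by blast
next
  assume "\<exists>k\<le>r. af_construction T U \<phi> k"
  then obtain k where "k \<le> r" "af_construction T U \<phi> k"
    by auto
  then show "\<phi> \<in> AF_upto T U r"
    using Least_le[of "af_construction T U \<phi>" k] by (auto simp: AF_upto_def AF_def af_rank_def)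
qed

lemma topspace_extended_weak_topology: "topspace (extended_weak_topology T U r) = adapted_processes T U"
  using pred_law_borel_probs by (auto simp: extended_weak_topology_def topspace_pullback_topology)

text \<open>The expectation of a represented functional is the integral of one fixed bounded
  continuous function against the law, hence weakly continuous in that law.\<close>

lemma openin_adapted_imp_extended_weak:
  fixes W :: "('w, 'u) adapted_process set"
  assumes "openin (adapted_topology T U r) W"
  shows "openin (extended_weak_topology T U r) W"
proof (rule openin_initial_topology_mono[OF _ topspace_extended_weak_topology assms[unfolded adapted_topology_def]])
  fix \<Phi> :: "('w, 'u) adapted_process \<Rightarrow> real"
  assume "\<Phi> \<in> (\<lambda>\<phi> X. integral\<^sup>L (pspace X) (\<phi> X)) ` AF_upto T U r"
  then obtain \<phi> k where \<phi>: "\<Phi> = (\<lambda>X. integral\<^sup>L (pspace X) (\<phi> X))" "af_construction T U \<phi> k" "k \<le> r"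
    by (auto simp: AF_upto_iff)
  obtain F where F: "represents r \<phi> F"
    using af_construction_represents[OF \<phi>(2,3)] by auto
  then have "continuous_map (weak_topology (pred_paths T U r)) euclideanreal (\<lambda>\<mu>. integral\<^sup>L \<mu> F)"
    unfolding weak_topology_def by (intro continuous_map_initial_topology) (auto simp: represents_def)
  then have "continuous_map (extended_weak_topology T U r) euclideanreal ((\<lambda>\<mu>. integral\<^sup>L \<mu> F) \<circ> pred_law T U r)"
    unfolding extended_weak_topology_def by (rule continuous_map_pullback)
  then show "continuous_map (extended_weak_topology T U r) euclideanreal \<Phi>"
    by (rule continuous_map_eq) (simp add: topspace_extended_weak_topology represents_expectation[OF F] \<phi>(1))
qed

section \<open>The representable functions generate the weak topologies\<close>

text \<open>The type of the underlying sample points occurs in the functional but not in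
  \<open>F\<close>; the argument of type \<open>'w itself\<close> keeps it fixed.\<close>

definition representable :: "'w itself \<Rightarrow> nat \<Rightarrow> ((nat \<Rightarrow> 'u pred_point) \<Rightarrow> real) set" where
  "representable _ r = {F. \<exists>\<phi> :: ('w, 'u) functional. \<phi> \<in> AF_upto T U r \<and> represents r \<phi> F}"

lemma representable_bounded_continuous:
  "F \<in> representable TYPE('w) r \<Longrightarrow> F \<in> bounded_continuous (pred_paths T U r)"
  by (auto simp: representable_def represents_def)

lemma representable_comp:
  assumes f: "f \<in> representable TYPE('w) r" and g: "g \<in> representable TYPE('w) r"
    and cont: "continuous_on UNIV (\<lambda>p. \<Phi> (fst p) (snd p))" and bd: "bounded (range (\<lambda>p. \<Phi> (fst p) (snd p)))"
  shows "(\<lambda>x. \<Phi> (f x) (g x) :: real) \<in> representable TYPE('w) r"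
proof -
  obtain \<phi> \<psi> :: "('w, 'u) functional" and k l where
    \<phi>: "af_construction T U \<phi> k" "k \<le> r" "represents r \<phi> f" and
    \<psi>: "af_construction T U \<psi> l" "l \<le> r" "represents r \<psi> g"
    using f g by (auto simp: representable_def AF_upto_iff)
  \<comment> \<open>The pair of functionals is presented as a tuple indexed by
    \<open>{..<2}\<close>, the form in which adapted functionals are composed.\<close>
  define \<phi>s where "\<phi>s i = (if i = (0::nat) then \<phi> else \<psi>)" for i
  define ks where "ks i = (if i = (0::nat) then k else l)" for i
  define Fs where "Fs i = (if i = (0::nat) then f else g)" for i
  let ?P = "product_topology (\<lambda>_. euclideanreal) {..<2::nat}"
  let ?h = "\<lambda>v :: nat \<Rightarrow> real. \<Phi> (v 0) (v 1)"
  have "continuous_map ?P euclideanreal (\<lambda>v. v 0)" "continuous_map ?P euclideanreal (\<lambda>v. v 1)"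
    by (intro continuous_map_product_projection; simp)+
  then have "continuous_map ?P (prod_topology euclideanreal euclideanreal) (\<lambda>v. (v 0, v 1))"
    by (rule continuous_map_pairedI)
  then have "continuous_map ?P euclidean (\<lambda>v. (v 0, v 1))"
    by simp
  then have "continuous_map ?P euclideanreal ((\<lambda>p. \<Phi> (fst p) (snd p)) \<circ> (\<lambda>v. (v 0, v 1)))"
    by (rule continuous_map_compose) (use cont in simp)
  then have h: "?h \<in> bounded_continuous ?P"
    using bd by (auto simp: bounded_continuous_def comp_def bounded_iff)
  have "Max (ks ` {..<2}) \<le> r"
    using \<phi>(2) \<psi>(2) by (auto simp: ks_def)
  moreover have "af_construction T U (\<lambda>X \<omega>. ?h (\<lambda>i\<in>{..<2}. \<phi>s i X \<omega>)) (Max (ks ` {..<2}))"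
    using \<phi>(1) \<psi>(1) by (intro af_construction.comp h) (auto simp: \<phi>s_def ks_def)
  moreover have "represents r (\<lambda>X \<omega>. ?h (\<lambda>i\<in>{..<2}. \<phi>s i X \<omega>)) (\<lambda>p. ?h (\<lambda>i\<in>{..<2}. Fs i p))"
    using \<phi>(3) \<psi>(3) by (intro represents_comp h) (auto simp: \<phi>s_def Fs_def)
  ultimately have "(\<lambda>p. ?h (\<lambda>i\<in>{..<2}. Fs i p)) \<in> representable TYPE('w) r"
    unfolding representable_def AF_upto_iff by blast
  then show ?thesis
    by (simp add: Fs_def)
qed

text \<open>At rank 0 the prediction path is the tagged process, so a function of the whole path is
  a base functional using all \<open>Suc T\<close> times.\<close>

lemma representable_0:
  assumes F: "F \<in> bounded_continuous (pred_paths T U 0)"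
  shows "F \<in> representable TYPE('w) 0"
proof -
  let ?P = "product_topology (\<lambda>_. U) {..<Suc T}"
  define f where "f v = F (\<lambda>i\<in>{..T}. Point (v i))" for v
  have P: "continuous_map U (pred_space T U 0) Point"
    using homeomorphic_maps_transport_topology[of Point U]
    by (simp add: homeomorphic_maps_def inj_on_def pred_space.simps(1))
  have "continuous_map ?P (pred_space T U 0) (\<lambda>v. Point (v i))" if "i \<le> T" for i
  proof -
    have "continuous_map ?P U (\<lambda>v. v i)"
      using that by (intro continuous_map_product_projection) auto
    from continuous_map_compose[OF this P] show ?thesis
      by (simp add: comp_def)
  qed
  then have c: "continuous_map ?P (pred_paths T U 0) (\<lambda>v. \<lambda>i\<in>{..T}. Point (v i))"
    unfolding path_topology_def continuous_map_componentwise by auto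
  then have "continuous_map ?P euclideanreal f"
    using continuous_map_compose[OF c bounded_continuousD(1)[OF F]] by (simp add: f_def[abs_def] comp_def)
  moreover obtain B where "\<forall>x\<in>topspace (pred_paths T U 0). \<bar>F x\<bar> \<le> B"
    using bounded_continuousD(2)[OF F] by auto
  then have "\<bar>f v\<bar> \<le> B" if "v \<in> topspace ?P" for v
    using c that unfolding continuous_map_def f_def by blast
  ultimately have "f \<in> bounded_continuous ?P"
    by (auto simp: bounded_continuous_def bounded_iff)
  then have "af_construction T U (\<lambda>(X :: ('w, 'u) adapted_process) \<omega>. f (\<lambda>i\<in>{..<Suc T}. proc X i \<omega>)) 0"
    by (intro af_construction.base[where ts="\<lambda>i. i"]) auto
  moreover have "represents 0 (\<lambda>(X :: ('w, 'u) adapted_process) \<omega>. f (\<lambda>i\<in>{..<Suc T}. proc X i \<omega>)) F"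
  proof (rule representsI_pointwise[OF F])
    fix X :: "('w, 'u) adapted_process" and \<omega>
    have "(\<lambda>i\<in>{..T}. Point ((\<lambda>i\<in>{..<Suc T}. proc X i \<omega>) i)) = pred_path T U 0 X \<omega>"
      by (intro restrict_ext) (simp add: pred_process.simps(1))
    then show "f (\<lambda>i\<in>{..<Suc T}. proc X i \<omega>) = F (pred_path T U 0 X \<omega>)"
      by (simp add: f_def)
  qed
  ultimately show ?thesis
    unfolding representable_def AF_upto_iff by blast
qed

lemma representable_integral_at:
  assumes "F \<in> representable TYPE('w) r" "t \<le> T"
  shows "integral_at T U r t F \<in> representable TYPE('w) (Suc r)"
proof -
  obtain \<phi> :: "('w, 'u) functional" and k where "af_construction T U \<phi> k" "k \<le> r" "represents r \<phi> F"
    using assms(1) by (auto simp: representable_def AF_upto_iff)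
  then have "af_construction T U (\<lambda>X. real_cond_exp (pspace X) (filt X t) (\<phi> X)) (Suc k)" "Suc k \<le> Suc r"
    "represents (Suc r) (\<lambda>X. real_cond_exp (pspace X) (filt X t) (\<phi> X)) (integral_at T U r t F)"
    using assms(2) by (auto intro: af_construction.cond represents_cond)
  then show ?thesis
    unfolding representable_def AF_upto_iff by blast
qed

text \<open>The path space of rank \<open>r + 1\<close> is a product of copies of the weak topology
  of rank \<open>r\<close>, and integrals over a bump family already generate that weak
  topology.\<close>

lemma pred_paths_Suc_initial:
  assumes "bump_family (pred_paths T U r) H" and H: "H \<subseteq> bounded_continuous (pred_paths T U r)"
  shows "pred_paths T U (Suc r) = initial_topology (topspace (pred_paths T U (Suc r)))
    {integral_at T U r t h |t h. t \<le> T \<and> h \<in> H}" (is "?P = initial_topology ?S ?E")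
  unfolding topology_eq
proof (intro allI iffI)
  fix W assume "openin (initial_topology ?S ?E) W"
  then show "openin ?P W"
  proof (rule openin_initial_topology_mono[rotated 2])
    fix e assume "e \<in> ?E"
    then show "continuous_map ?P euclideanreal e"
      using H by (auto intro!: bounded_continuousD(1)[OF integral_at_bounded_continuous])
  qed simp
next
  fix W assume W: "openin ?P W"
  let ?I = "initial_topology ?S ?E"
  have sc: "second_countable (pred_paths T U r)"
    using good_pred_paths by (simp add: good_space_def)
  have "continuous_map ?I (pred_space T U (Suc r)) (\<lambda>p. p t)" if t: "t \<le> T" for t
  proof -
    let ?W = "weak_topology (pred_paths T U r)"
    \<comment> \<open>In this form, continuity of a coordinate reduces to continuity of the law it
      encodes.\<close>
    have eq: "pred_space T U (Suc r) = pullback_topology (encode_law T U r ` topspace ?W) (decode_law T U r) ?W"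
      by (simp add: pred_space_Suc transport_topology_def decode_law_def)
    have "continuous_map ?I (weak_topology (pred_paths T U r)) (\<lambda>p. decode_law T U r (p t))"
      unfolding weak_topology_bump_family[OF assms(1) sc]
    proof (rule continuous_map_into_initial_topology)
      show "(\<lambda>p. decode_law T U r (p t)) ` topspace ?I \<subseteq> borel_probs (pred_paths T U r)"
        using decode_law_borel_probs[OF _ t] by auto
      fix \<phi> assume "\<phi> \<in> (\<lambda>h \<mu>. integral\<^sup>L \<mu> h) ` H"
      then obtain h where h: "h \<in> H" "\<phi> = (\<lambda>\<mu>. integral\<^sup>L \<mu> h)"
        by auto
      have "continuous_map ?I euclideanreal (integral_at T U r t h)"
        using h(1) t by (intro continuous_map_initial_topology) auto
      then show "continuous_map ?I euclideanreal (\<lambda>p. \<phi> (decode_law T U r (p t)))"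
        by (simp add: h(2) integral_at_def[abs_def])
    qed
    then have "continuous_map ?I (pullback_topology (encode_law T U r ` topspace ?W) (decode_law T U r) ?W) (\<lambda>p. p t)"
    proof (intro continuous_map_pullback')
      show "topspace ?I \<subseteq> (\<lambda>p. p t) -` encode_law T U r ` topspace ?W"
        using path_topology_coordinate_topspace[OF _ t, of _ "pred_space T U (Suc r)"] topspace_pred_space_Suc by auto
    qed (simp add: comp_def)
    then show ?thesis
      unfolding eq[symmetric] .
  qed
  then have "continuous_map ?I ?P (\<lambda>p. p)"
    unfolding path_topology_def continuous_map_componentwise
    by (auto simp: PiE_iff)
  from openin_continuous_map_preimage[OF this W]
  have "openin ?I {p \<in> ?S. p \<in> W}"
    by simp
  moreover have "{p \<in> ?S. p \<in> W} = W"
    using openin_subset[OF W] by auto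
  ultimately show "openin ?I W"
    by simp
qed

text \<open>At rank 0 all bounded continuous functions are representable. In the step, the bumps of
  rank \<open>r\<close> give generating functions of rank \<open>r + 1\<close> that arise by
  conditioning, and closure under continuous operations builds bumps from them.\<close>

lemma bump_family_representable:
  "bump_family (pred_paths T U r)
     {h \<in> representable TYPE('w) r. \<forall>x\<in>topspace (pred_paths T U r). 0 \<le> h x \<and> h x \<le> 1}"
proof (induction r)
  case 0
  have "{h \<in> representable TYPE('w) 0. \<forall>x\<in>topspace (pred_paths T U 0). 0 \<le> h x \<and> h x \<le> 1}
    = {h. continuous_map (pred_paths T U 0) euclideanreal h \<and> (\<forall>x\<in>topspace (pred_paths T U 0). 0 \<le> h x \<and> h x \<le> 1)}"
    (is "?A = ?B")
  proof
    show "?A \<subseteq> ?B"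
      using bounded_continuousD(1)[OF representable_bounded_continuous] by auto
    show "?B \<subseteq> ?A"
    proof
      fix h assume h: "h \<in> ?B"
      then have "h \<in> bounded_continuous (pred_paths T U 0)"
        unfolding bounded_continuous_def bounded_iff by (auto intro!: exI[of _ 1])
      then show "h \<in> ?A"
        using h representable_0 by auto
    qed
  qed
  then show ?case
    using bump_family_completely_regular[of "pred_paths T U 0"] good_pred_paths[of 0]
    by (simp add: good_space_def del: pred_space.simps)
next
  case (Suc r)
  let ?H = "{h \<in> representable TYPE('w) r. \<forall>x\<in>topspace (pred_paths T U r). 0 \<le> h x \<and> h x \<le> 1}"
  let ?S = "topspace (pred_paths T U (Suc r))"
  let ?E = "{integral_at T U r t h |t h. t \<le> T \<and> h \<in> ?H}"
  have "?H \<subseteq> bounded_continuous (pred_paths T U r)"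
    using representable_bounded_continuous by auto
  then have eq: "pred_paths T U (Suc r) = initial_topology ?S ?E"
    by (rule pred_paths_Suc_initial[OF Suc])
  have E: "?E \<subseteq> representable TYPE('w) (Suc r)"
    using representable_integral_at by auto
  have "bump_family (initial_topology ?S ?E)
      {h \<in> representable TYPE('w) (Suc r). \<forall>x\<in>?S. 0 \<le> h x \<and> h x \<le> 1}"
  proof (rule bump_family_generated)
    fix f assume "f \<in> representable TYPE('w) (Suc r)"
    then show "continuous_map (initial_topology ?S ?E) euclideanreal f"
      using bounded_continuousD(1)[OF representable_bounded_continuous] unfolding eq[symmetric] by blast
  next
    obtain h where "h \<in> ?H"
      using bump_family_zero[OF Suc] by blast
    then have "integral_at T U r 0 h \<in> ?E"
      by blast
    then show "representable TYPE('w) (Suc r) \<noteq> {}"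
      using E by blast
  next
    fix e and \<Phi> :: "real \<Rightarrow> real" assume "e \<in> ?E" and \<Phi>: "continuous_on UNIV \<Phi>" "bounded (range \<Phi>)"
    then have e: "e \<in> representable TYPE('w) (Suc r)"
      using E by blast
    have "continuous_on UNIV (\<lambda>p :: real \<times> real. \<Phi> (fst p))"
      by (rule continuous_on_compose2[OF \<Phi>(1)]) (auto intro: continuous_on_fst)
    moreover have "bounded (range (\<lambda>p :: real \<times> real. \<Phi> (fst p)))"
      using \<Phi>(2) by (rule bounded_subset) auto
    ultimately show "(\<lambda>x. \<Phi> (e x)) \<in> representable TYPE('w) (Suc r)"
      using representable_comp[OF e e, of "\<lambda>u v. \<Phi> u"] by simp
  qed (rule representable_comp)
  then show ?case
    unfolding eq[symmetric] .
qed

text \<open>With the weak topology generated by representable functions, continuity of the law map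
  need only be tested on expectations of adapted functionals, which are continuous by
  definition.\<close>

lemma openin_extended_weak_imp_adapted:
  fixes W :: "('w, 'u) adapted_process set"
  assumes "openin (extended_weak_topology T U r) W"
  shows "openin (adapted_topology T U r) W"
proof -
  let ?H = "{h \<in> representable TYPE('w) r. \<forall>x\<in>topspace (pred_paths T U r). 0 \<le> h x \<and> h x \<le> 1}"
  have sc: "second_countable (pred_paths T U r)"
    using good_pred_paths by (simp add: good_space_def)
  obtain V where V: "openin (weak_topology (pred_paths T U r)) V" "W = pred_law T U r -` V \<inter> adapted_processes T U"
    using assms by (auto simp: extended_weak_topology_def openin_pullback_topology)
  have "continuous_map (adapted_topology T U r) (weak_topology (pred_paths T U r))
      (pred_law T U r :: ('w, 'u) adapted_process \<Rightarrow> _)"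
    unfolding weak_topology_bump_family[OF bump_family_representable[where 'w='w] sc]
  proof (rule continuous_map_into_initial_topology)
    show "pred_law T U r ` topspace (adapted_topology T U r :: ('w, 'u) adapted_process topology) \<subseteq> borel_probs (pred_paths T U r)"
      using pred_law_borel_probs by (auto simp: adapted_topology_def)
    fix \<Phi> :: "(nat \<Rightarrow> 'u pred_point) measure \<Rightarrow> real" assume "\<Phi> \<in> (\<lambda>h \<mu>. integral\<^sup>L \<mu> h) ` ?H"
    then obtain h and \<phi> :: "('w, 'u) functional" where
      h: "\<Phi> = (\<lambda>\<mu>. integral\<^sup>L \<mu> h)" "\<phi> \<in> AF_upto T U r" "represents r \<phi> h"
      by (auto simp: representable_def)
    have "continuous_map (adapted_topology T U r) euclideanreal (\<lambda>X. integral\<^sup>L (pspace X) (\<phi> X))"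
      unfolding adapted_topology_def using h(2) by (intro continuous_map_initial_topology) auto
    then show "continuous_map (adapted_topology T U r) euclideanreal (\<lambda>X :: ('w, 'u) adapted_process. \<Phi> (pred_law T U r X))"
      by (rule continuous_map_eq) (simp add: adapted_topology_def h(1) represents_expectation[OF h(3)])
  qed
  from openin_continuous_map_preimage[OF this V(1)]
  have "openin (adapted_topology T U r) {X \<in> (adapted_processes T U :: ('w, 'u) adapted_process set). pred_law T U r X \<in> V}"
    by (simp add: adapted_topology_def)
  moreover have "{X \<in> adapted_processes T U. pred_law T U r X \<in> V} = W"
    by (auto simp: V(2))
  ultimately show ?thesis
    by simp
qed

lemma adapted_topology_eq_extended_weak_topology:
  "(adapted_topology T U r :: ('w, 'u) adapted_process topology) = extended_weak_topology T U r"
  unfolding topology_eq using openin_adapted_imp_extended_weak openin_extended_weak_imp_adapted by blast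

end

section \<open>The empty state space and the comparison of topologies\<close>

text \<open>A probability space has a point, and its image under the process would lie in the empty
  carrier. The case is separate because retracts of the line are nonempty.\<close>

lemma adapted_processes_empty:
  assumes "topspace U = {}"
  shows "adapted_processes T U = {}"
proof (rule equals0I)
  fix X assume X: "X \<in> adapted_processes T U"
  have "space (pspace X) = {}"
    using measurable_space[OF adapted_processesD(3)[OF X le0]] adapted_processesD(2)[OF X le0] assms
    by (auto simp: subalgebra_def)
  then show False
    using prob_space.not_empty[OF adapted_processesD(1)[OF X le0]] by simp
qed

theorem proposition7:
  fixes T r :: nat
  shows
    "(\<forall>W :: ('w, 'v::{banach, second_countable_topology}) adapted_process set.
        openin (adapted_topology T euclidean r) W \<longrightarrow>
        openin (extended_weak_topology T euclidean r) W) \<and>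
     (\<forall>(Xs :: nat \<Rightarrow> ('w, 'v) adapted_process) X.
        limitin (extended_weak_topology T euclidean r) Xs X sequentially \<longrightarrow>
        limitin (adapted_topology T euclidean r) Xs X sequentially) \<and>
     (\<forall>K :: 'v set. compact K \<longrightarrow>
        (adapted_topology T (top_of_set K) r :: ('w, 'v) adapted_process topology) =
        extended_weak_topology T (top_of_set K) r)"
proof (intro conjI allI impI)
  have eq: "(adapted_topology T euclidean r :: ('w, 'v) adapted_process topology) = extended_weak_topology T euclidean r"
    by (rule adapted_topology_eq_extended_weak_topology[OF good_space_euclidean])
  show "openin (extended_weak_topology T euclidean r) W" if "openin (adapted_topology T euclidean r) W"
    for W :: "('w, 'v) adapted_process set"
    using that eq by simp
  show "limitin (adapted_topology T euclidean r) Xs X sequentially"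
    if "limitin (extended_weak_topology T euclidean r) Xs X sequentially" for Xs and X :: "('w, 'v) adapted_process"
    using that eq by simp
  fix K :: "'v set" assume "compact K"
  show "(adapted_topology T (top_of_set K) r :: ('w, 'v) adapted_process topology) = extended_weak_topology T (top_of_set K) r"
  proof (cases "K = {}")
    case True
    then have "adapted_processes T (top_of_set K) = ({} :: ('w, 'v) adapted_process set)"
      by (intro adapted_processes_empty) simp
    then have "topspace (adapted_topology T (top_of_set K) r :: ('w, 'v) adapted_process topology) = {}"
      "topspace (extended_weak_topology T (top_of_set K) r :: ('w, 'v) adapted_process topology) = {}"
      by (simp_all add: adapted_topology_def extended_weak_topology_def topspace_pullback_topology)
    then show ?thesis
      by simp
  next
    case False
    then show ?thesis
      \<comment> \<open>Compactness enters through closedness, which makes \<open>K\<close> a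
        measurable retract of the surrounding space.\<close>
      using \<open>compact K\<close> by (intro adapted_topology_eq_extended_weak_topology good_space_top_of_set compact_imp_closed)
  qed
qed

end
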